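(* For every integer $n\ge 3$, the loop braid group $LB_n$ is not commensurable to any group that splits non-trivially over an NF subgroup.
   Context: Let $F_n$ be the free group with free generating set $\{x_1,\dots,x_n\}$. The loop braid group $LB_n$ is the group of symmetric automorphisms of $F_n$, where an automorphism $\alpha\in\mathrm{Aut}(F_n)$ is called symmetric if it takes each $x_i$ to a conjugate of some $x_j$ or $x_j^{-1}$. Two groups are (abstractly) commensurable if they contain isomorphic finite index subgroups. A group $G$ splits non-trivially over a subgroup $C$ if $G$ decomposes as an amalgamated product $G=A*_C B$ with $G\ne A,B$ or as an HNN-extension $G=A*_C$ with $G\ne A$. A group is NF if it contains no non-abelian free subgroups. *)

theory Defs
  imports "HOL-Algebra.Coset" "HOL-Algebra.Bij"
begin

section \<open>Groups given by presentations\<close>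

text \<open>A letter \<open>(True, x)\<close> stands for \<open>x\<close> and \<open>(False, x)\<close> for its formal inverse.\<close>

type_synonym 'x gword = "(bool \<times> 'x) list"

definition gwords :: "'x set \<Rightarrow> 'x gword set"
  where "gwords X = lists (UNIV \<times> X)"

text \<open>The congruence on words over \<open>X\<close> generated by free cancellation and by the
  relations \<open>r = s\<close> for \<open>(r, s)\<close> in \<open>R\<close>.\<close>

inductive_set pres_cong :: "'x set \<Rightarrow> ('x gword \<times> 'x gword) set \<Rightarrow> ('x gword \<times> 'x gword) set"
  for X R where
  refl: "w \<in> gwords X \<Longrightarrow> (w, w) \<in> pres_cong X R"
| sym: "(v, w) \<in> pres_cong X R \<Longrightarrow> (w, v) \<in> pres_cong X R"
| trans: "(u, v) \<in> pres_cong X R \<Longrightarrow> (v, w) \<in> pres_cong X R \<Longrightarrow> (u, w) \<in> pres_cong X R"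
| cancel: "u \<in> gwords X \<Longrightarrow> v \<in> gwords X \<Longrightarrow> x \<in> X \<Longrightarrow>
    (u @ [(b, x), (\<not> b, x)] @ v, u @ v) \<in> pres_cong X R"
| rel: "u \<in> gwords X \<Longrightarrow> v \<in> gwords X \<Longrightarrow> (r, s) \<in> R \<Longrightarrow> r \<in> gwords X \<Longrightarrow> s \<in> gwords X \<Longrightarrow>
    (u @ r @ v, u @ s @ v) \<in> pres_cong X R"

definition presented_group :: "'x set \<Rightarrow> ('x gword \<times> 'x gword) set \<Rightarrow> 'x gword set monoid"
  where "presented_group X R =
    \<lparr>carrier = gwords X // pres_cong X R,
     monoid.mult = (\<lambda>U V. \<Union>u\<in>U. \<Union>v\<in>V. pres_cong X R `` {u @ v}),
     one = pres_cong X R `` {[]}\<rparr>"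

definition pres_gen :: "'x set \<Rightarrow> ('x gword \<times> 'x gword) set \<Rightarrow> 'x \<Rightarrow> 'x gword set"
  where "pres_gen X R x = pres_cong X R `` {[(True, x)]}"

definition free_group :: "'x set \<Rightarrow> 'x gword set monoid"
  where "free_group X = presented_group X {}"

lemma gwords_append [simp]: "u @ v \<in> gwords X \<longleftrightarrow> u \<in> gwords X \<and> v \<in> gwords X"
  and gwords_Nil [simp]: "[] \<in> gwords X"
  and gwords_Cons [simp]: "l # v \<in> gwords X \<longleftrightarrow> snd l \<in> X \<and> v \<in> gwords X"
  by (cases l; auto simp: gwords_def)+

lemma pres_cong_gwords: "(u, v) \<in> pres_cong X R \<Longrightarrow> u \<in> gwords X \<and> v \<in> gwords X"
  by (induction rule: pres_cong.induct) auto

lemma equiv_pres_cong: "equiv (gwords X) (pres_cong X R)"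
  by (intro equivI refl_onI symI transI)
    (auto dest: pres_cong_gwords intro: pres_cong.refl pres_cong.sym pres_cong.trans)

lemma pres_cong_context:
  "(u, v) \<in> pres_cong X R \<Longrightarrow> p \<in> gwords X \<Longrightarrow> q \<in> gwords X \<Longrightarrow> (p @ u @ q, p @ v @ q) \<in> pres_cong X R"
proof (induction rule: pres_cong.induct)
  case (cancel u v x b)
  then show ?case using pres_cong.cancel[of "p @ u" X "v @ q" x b R] by simp
next
  case (rel u v r s)
  then show ?case using pres_cong.rel[of "p @ u" X "v @ q" r s R] by simp
qed (auto intro: pres_cong.intros)

lemma pres_cong_append:
  assumes "(u, u') \<in> pres_cong X R" "(v, v') \<in> pres_cong X R"
  shows "(u @ v, u' @ v') \<in> pres_cong X R"
  using pres_cong_context[OF assms(1), of "[]" v] pres_cong_context[OF assms(2), of u' "[]"]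
    pres_cong_gwords[OF assms(1)] pres_cong_gwords[OF assms(2)]
  by (auto intro: pres_cong.trans)

lemma presented_group_mult:
  assumes "u \<in> gwords X" "v \<in> gwords X"
  shows "pres_cong X R `` {u} \<otimes>\<^bsub>presented_group X R\<^esub> pres_cong X R `` {v} = pres_cong X R `` {u @ v}"
proof -
  have "congruent2 (pres_cong X R) (pres_cong X R) (\<lambda>u v. pres_cong X R `` {u @ v})"
    by (rule congruent2I') (metis equiv_class_eq equiv_pres_cong pres_cong_append)
  from UN_equiv_class2[OF equiv_pres_cong equiv_pres_cong this assms]
  show ?thesis by (simp add: presented_group_def)
qed

lemma gwords_inverse: "w \<in> gwords X \<Longrightarrow> rev (map (apfst Not) w) \<in> gwords X"
  by (induction w) auto

lemma pres_cong_inverse: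
  "w \<in> gwords X \<Longrightarrow> (rev (map (apfst Not) w) @ w, []) \<in> pres_cong X R"
proof (induction w)
  case (Cons l w)
  obtain b x where l: "l = (b, x)" by (cases l)
  let ?w' = "rev (map (apfst Not) w)"
  have w': "?w' \<in> gwords X" using Cons.prems by (simp add: gwords_inverse)
  have "(?w' @ [(\<not> b, x), (\<not> \<not> b, x)] @ w, ?w' @ w) \<in> pres_cong X R"
    by (rule pres_cong.cancel) (use Cons.prems w' l in auto)
  then have "(?w' @ [(\<not> b, x), (\<not> \<not> b, x)] @ w, []) \<in> pres_cong X R"
    using Cons by (auto intro: pres_cong.trans)
  then show ?case by (simp add: l)
qed (auto intro: pres_cong.refl)

lemma group_presented_group: "group (presented_group X R)"
proof (rule groupI)
  let ?P = "presented_group X R" and ?c = "\<lambda>w. pres_cong X R `` {w}"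
  have carr: "U \<in> carrier ?P \<longleftrightarrow> (\<exists>u\<in>gwords X. U = ?c u)" for U
    by (auto simp: presented_group_def quotient_def)
  have one: "\<one>\<^bsub>?P\<^esub> = ?c []" by (simp add: presented_group_def)
  note m = presented_group_mult[where R = R]
  show "\<one>\<^bsub>?P\<^esub> \<in> carrier ?P" unfolding carr one by auto
  show "U \<otimes>\<^bsub>?P\<^esub> V \<in> carrier ?P" if "U \<in> carrier ?P" "V \<in> carrier ?P" for U V
    using that unfolding carr by (metis gwords_append m)
  show "U \<otimes>\<^bsub>?P\<^esub> V \<otimes>\<^bsub>?P\<^esub> W = U \<otimes>\<^bsub>?P\<^esub> (V \<otimes>\<^bsub>?P\<^esub> W)"
    if "U \<in> carrier ?P" "V \<in> carrier ?P" "W \<in> carrier ?P" for U V W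
    using that unfolding carr by (auto simp: m)
  show "\<one>\<^bsub>?P\<^esub> \<otimes>\<^bsub>?P\<^esub> U = U" if "U \<in> carrier ?P" for U
    using that unfolding carr one by (auto simp: m)
  show "\<exists>V\<in>carrier ?P. V \<otimes>\<^bsub>?P\<^esub> U = \<one>\<^bsub>?P\<^esub>" if "U \<in> carrier ?P" for U
  proof -
    obtain u where u: "u \<in> gwords X" "U = ?c u" using \<open>U \<in> carrier ?P\<close> carr by auto
    let ?u' = "rev (map (apfst Not) u)"
    have u': "?u' \<in> gwords X" using u(1) by (rule gwords_inverse)
    have "?c ?u' \<otimes>\<^bsub>?P\<^esub> U = \<one>\<^bsub>?P\<^esub>"
      unfolding u(2) one m[OF u' u(1)]
      by (rule equiv_class_eq[OF equiv_pres_cong pres_cong_inverse[OF u(1)]])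
    then show ?thesis using u' carr by blast
  qed
qed

section \<open>Loop braid groups\<close>

definition symmetric_automorphisms :: "nat \<Rightarrow> (nat gword set \<Rightarrow> nat gword set) set"
  where "symmetric_automorphisms n =
    (let F = free_group {1..n}; x = pres_gen {1..n} {} in
      {\<alpha> \<in> auto F. \<forall>i\<in>{1..n}. \<exists>j\<in>{1..n}. \<exists>g\<in>carrier F.
         \<alpha> (x i) = g \<otimes>\<^bsub>F\<^esub> x j \<otimes>\<^bsub>F\<^esub> inv\<^bsub>F\<^esub> g \<or>
         \<alpha> (x i) = g \<otimes>\<^bsub>F\<^esub> inv\<^bsub>F\<^esub> (x j) \<otimes>\<^bsub>F\<^esub> inv\<^bsub>F\<^esub> g})"

definition loop_braid_group :: "nat \<Rightarrow> (nat gword set \<Rightarrow> nat gword set) monoid"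
  where "loop_braid_group n =
    (AutoGroup (free_group {1..n})) \<lparr>carrier := symmetric_automorphisms n\<rparr>"

section \<open>Commensurability and NF groups\<close>

definition finite_index :: "'a set \<Rightarrow> ('a, 'm) monoid_scheme \<Rightarrow> bool"
  where "finite_index H G \<longleftrightarrow> subgroup H G \<and> finite (rcosets\<^bsub>G\<^esub> H)"

definition commensurable :: "('a, 'm) monoid_scheme \<Rightarrow> ('b, 'k) monoid_scheme \<Rightarrow> bool"
  where "commensurable G H \<longleftrightarrow>
    (\<exists>G' H'. finite_index G' G \<and> finite_index H' H \<and> G\<lparr>carrier := G'\<rparr> \<cong> H\<lparr>carrier := H'\<rparr>)"

text \<open>Restricting the basis to the element type of the group loses nothing, since a basis can
  be taken to be a subset of the group.\<close>

definition is_free_group :: "('a, 'm) monoid_scheme \<Rightarrow> bool"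
  where "is_free_group G \<longleftrightarrow> (\<exists>X :: 'a set. G \<cong> free_group X)"

definition NF :: "('a, 'm) monoid_scheme \<Rightarrow> bool"
  where "NF G \<longleftrightarrow>
    \<not> (\<exists>H. subgroup H G \<and> is_free_group (G\<lparr>carrier := H\<rparr>) \<and> \<not> comm_group (G\<lparr>carrier := H\<rparr>))"

section \<open>Splittings\<close>

text \<open>The multiplication table of \<open>A\<close>, written in generators \<open>f a\<close> for the elements \<open>a\<close> of \<open>A\<close>.\<close>

definition mult_table :: "('a, 'm) monoid_scheme \<Rightarrow> ('a \<Rightarrow> 'x) \<Rightarrow> ('x gword \<times> 'x gword) set"
  where "mult_table A f =
    {([(True, f a), (True, f b)], [(True, f (a \<otimes>\<^bsub>A\<^esub> b))]) | a b. a \<in> carrier A \<and> b \<in> carrier A}"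

definition amalgam_gens :: "('a, 'm) monoid_scheme \<Rightarrow> ('b, 'k) monoid_scheme \<Rightarrow> ('a + 'b) set"
  where "amalgam_gens A B = Inl ` carrier A \<union> Inr ` carrier B"

definition amalgam_rels ::
  "('a, 'm) monoid_scheme \<Rightarrow> ('b, 'k) monoid_scheme \<Rightarrow> 'c set \<Rightarrow> ('c \<Rightarrow> 'a) \<Rightarrow> ('c \<Rightarrow> 'b) \<Rightarrow>
    (('a + 'b) gword \<times> ('a + 'b) gword) set"
  where "amalgam_rels A B C i j =
    mult_table A Inl \<union> mult_table B Inr \<union> {([(True, Inl (i c))], [(True, Inr (j c))]) | c. c \<in> C}"

text \<open>\<open>G\<close> is the amalgamated product of its subgroups \<open>A\<close> and \<open>B\<close> over the common subgroup \<open>C\<close>: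
  the map from the abstract amalgamated product to \<open>G\<close> induced by the inclusions of \<open>A\<close> and \<open>B\<close>
  is an isomorphism.\<close>

definition is_amalgamated_product ::
  "('a, 'm) monoid_scheme \<Rightarrow> 'a set \<Rightarrow> 'a set \<Rightarrow> 'a set \<Rightarrow> bool"
  where "is_amalgamated_product G A B C \<longleftrightarrow>
    subgroup A G \<and> subgroup B G \<and> subgroup C G \<and> C \<subseteq> A \<and> C \<subseteq> B \<and>
    (let X = amalgam_gens (G\<lparr>carrier := A\<rparr>) (G\<lparr>carrier := B\<rparr>);
         R = amalgam_rels (G\<lparr>carrier := A\<rparr>) (G\<lparr>carrier := B\<rparr>) C (\<lambda>c. c) (\<lambda>c. c)
     in \<exists>h\<in>iso (presented_group X R) G.
          (\<forall>a\<in>A. h (pres_gen X R (Inl a)) = a) \<and> (\<forall>b\<in>B. h (pres_gen X R (Inr b)) = b))"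

text \<open>In the HNN-extension, \<open>None\<close> is the stable letter; it conjugates \<open>c\<close> to \<open>\<phi> c\<close>.\<close>

definition hnn_gens :: "('a, 'm) monoid_scheme \<Rightarrow> 'a option set"
  where "hnn_gens A = insert None (Some ` carrier A)"

definition hnn_rels ::
  "('a, 'm) monoid_scheme \<Rightarrow> 'a set \<Rightarrow> ('a \<Rightarrow> 'a) \<Rightarrow> ('a option gword \<times> 'a option gword) set"
  where "hnn_rels A C \<phi> =
    mult_table A Some \<union>
    {([(True, None), (True, Some c), (False, None)], [(True, Some (\<phi> c))]) | c. c \<in> C}"

text \<open>\<open>G\<close> is an HNN-extension of its subgroup \<open>A\<close> with associated subgroups \<open>C\<close> and \<open>\<phi> ` C\<close>.\<close>

definition is_hnn_extension :: "('a, 'm) monoid_scheme \<Rightarrow> 'a set \<Rightarrow> 'a set \<Rightarrow> bool"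
  where "is_hnn_extension G A C \<longleftrightarrow>
    subgroup A G \<and> subgroup C G \<and> C \<subseteq> A \<and>
    (\<exists>\<phi>\<in>hom (G\<lparr>carrier := C\<rparr>) (G\<lparr>carrier := A\<rparr>). inj_on \<phi> C \<and>
      (let X = hnn_gens (G\<lparr>carrier := A\<rparr>);
           R = hnn_rels (G\<lparr>carrier := A\<rparr>) C \<phi>
       in \<exists>h\<in>iso (presented_group X R) G. \<forall>a\<in>A. h (pres_gen X R (Some a)) = a))"

definition splits_nontrivially_over :: "('a, 'm) monoid_scheme \<Rightarrow> 'a set \<Rightarrow> bool"
  where "splits_nontrivially_over G C \<longleftrightarrow>
    (\<exists>A B. is_amalgamated_product G A B C \<and> A \<noteq> carrier G \<and> B \<noteq> carrier G) \<or>
    (\<exists>A. is_hnn_extension G A C \<and> A \<noteq> carrier G)"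

end

theory Submission
  imports Defs
begin

text \<open>A splitting of \<open>G\<close> over \<open>C\<close> yields an action of \<open>G\<close> on its Bass--Serre tree with edge
  stabilizers conjugate into \<open>C\<close>, in which some element has no power fixing a vertex. If \<open>LB\<^sub>n\<close>
  were commensurable to \<open>G\<close>, a finite index subgroup \<open>K\<close> of \<open>LB\<^sub>n\<close> would act on this tree, and it
  suffices to show that \<open>K\<close> fixes a vertex.

  Let \<open>m\<close> be such that all \<open>m\<close>-th powers lie in \<open>K\<close>. If two non-abelian free groups commute and edge
  stabilizers are NF, then each of them fixes a unique vertex. For different \<open>i, j, k\<close> this applies to
  the group generated by the \<open>m\<close>-th powers of conjugation by \<open>x\<^sub>i\<close> and by \<open>x\<^sub>j\<close>, which commutes with the
  automorphisms conjugating \<open>x\<^sub>k\<close> by a word in \<open>x\<^sub>i\<^sup>m, x\<^sub>j\<^sup>m\<close> and fixing all other generators. By the Helly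
  property, all \<open>m\<close>-th powers of conjugations by members of the basis \<open>x\<close> fix a common vertex \<open>v\<close>. The
  same holds for every basis \<open>\<beta>(x)\<close>, and bases with two common members have the same vertex. Changing
  one member at a time shows that \<open>v\<close> belongs to all bases \<open>w x w\<inverse>\<close>. As \<open>\<alpha> \<in> K\<close> maps every \<open>x\<^sub>i\<close>
  to a conjugate of some \<open>x\<^sub>j\<close> or its inverse, it fixes \<open>v\<close>.\<close>

text \<open>Why commuting forces fixed vertices: an element commuting with a hyperbolic g preserves
  both ends of its axis, and its shift along the axis is a homomorphism from the centralizer of g to
  the integers. Commutators therefore fix the axis, and a free group of rank two contains two
  commutators that again form a free pair, which contradicts NF edge stabilizers. So the generators
  and their product are elliptic, and Serre's argument yields a common vertex. A third generator x_k
  serves twice: it carries the commuting partner, and it detects words in x_i and x_j, so that the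
  maps into Aut are injective on them. Two obstacles shape the setting. Conjugations by generators
  need not lie in K, so a single exponent must bring all of them into K; a factorial of the number
  of cosets does this. Moreover, \<open>symmetric\<close> is visibly closed under products only, so
  that powers are taken in a subgroup \<open>symmetric_units\<close> of it, and inverses in K are
  found through the isomorphism with a subgroup of G. Trees are treated as integer-valued metrics,
  which turns arguments about axes and medians into linear arithmetic.\<close>

section \<open>Group actions on trees\<close>

text \<open>Axioms for the vertex set of a simplicial tree without edges or paths: the four-point
  condition makes the metric tree-like, and \<open>geodesic\<close> puts a vertex at every integer
  point of a segment. \<open>d_parity\<close> makes branch points vertices; the triangle graph with
  all distances 1 satisfies the other axioms.\<close>

locale tree_metric =
  fixes V :: "'v set" and d :: "'v \<Rightarrow> 'v \<Rightarrow> nat"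
  assumes d_eq_0: "x \<in> V \<Longrightarrow> y \<in> V \<Longrightarrow> d x y = 0 \<longleftrightarrow> x = y"
    and d_sym: "x \<in> V \<Longrightarrow> y \<in> V \<Longrightarrow> d x y = d y x"
    and d_triangle: "x \<in> V \<Longrightarrow> y \<in> V \<Longrightarrow> z \<in> V \<Longrightarrow> d x z \<le> d x y + d y z"
    and four_point: "x \<in> V \<Longrightarrow> y \<in> V \<Longrightarrow> z \<in> V \<Longrightarrow> w \<in> V \<Longrightarrow>
      d x y + d z w \<le> max (d x z + d y w) (d x w + d y z)"
    and geodesic: "x \<in> V \<Longrightarrow> y \<in> V \<Longrightarrow> k \<le> d x y \<Longrightarrow> \<exists>z\<in>V. d x z = k \<and> k + d z y = d x y"
    and d_parity: "x \<in> V \<Longrightarrow> y \<in> V \<Longrightarrow> z \<in> V \<Longrightarrow> even (d x y + d y z + d x z)"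
begin

lemma geodesic_unique:
  assumes "x \<in> V" "y \<in> V" "p \<in> V" "q \<in> V" "d x p = d x q"
    "d x p + d p y = d x y" "d x q + d q y = d x y"
  shows "p = q"
proof -
  have "d x y + d p q \<le> max (d x p + d y q) (d x q + d y p)"
    by (rule four_point; fact)
  then have "d p q = 0" using assms d_sym[of p y] d_sym[of q y] by simp
  then show ?thesis using d_eq_0 assms by blast
qed

text \<open>In the four-point inequality, \<open>d x z + d y w\<close> exceeds
  \<open>d x y + d z w\<close> by \<open>2 * d y z\<close>, which is positive, so the alternative
  containing \<open>d x w\<close> must hold. This passage from local to global geodesics is what
  produces axes.\<close>

lemma geodesic_concat:
  assumes "x \<in> V" "y \<in> V" "z \<in> V" "w \<in> V" "y \<noteq> z"
    "d x y + d y z = d x z" "d y z + d z w = d y w"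
  shows "d x w = d x y + d y z + d z w"
proof -
  have "d y z > 0" using assms d_eq_0 by auto
  moreover have "d x z + d y w \<le> max (d x y + d z w) (d x w + d z y)"
    by (rule four_point; fact)
  moreover have "d x w \<le> d x z + d z w" by (rule d_triangle; fact)
  moreover have "d z y = d y z" using d_sym assms by blast
  ultimately show ?thesis using assms by linarith
qed

text \<open>Equidistance of \<open>x\<close> from \<open>z\<close> and \<open>w\<close> means that
  the geodesics from \<open>x\<close> to them separate exactly at the midpoint
  \<open>p\<close>.\<close>

lemma midpoint_equidistant:
  assumes "x \<in> V" "z \<in> V" "w \<in> V" "p \<in> V" "d x z = d x w" "d z p = d p w" "2 * d z p = d z w"
  shows "d x p + d p z = d x z" "d x p + d p w = d x w"
proof -
  have "d x p + d z w \<le> max (d x z + d p w) (d x w + d p z)"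
    by (rule four_point; fact)
  moreover have "d x z \<le> d x p + d p z" by (rule d_triangle; fact)
  moreover have "d z p = d p z" using d_sym assms by blast
  ultimately show "d x p + d p z = d x z" "d x p + d p w = d x w" using assms by linarith+
qed

lemma midpoint:
  assumes "z \<in> V" "w \<in> V" "even (d z w)"
  obtains p where "p \<in> V" "d z p = d p w" "2 * d z p = d z w"
proof -
  have "d z w div 2 \<le> d z w" by simp
  from geodesic[OF assms(1,2) this] obtain p where "p \<in> V" "d z p = d z w div 2" "d z w div 2 + d p w = d z w"
    by blast
  with assms(3) show thesis using that[of p] by auto
qed

lemma median:
  assumes "p \<in> V" "q \<in> V" "r \<in> V"
  obtains m where "m \<in> V" "d p m + d m q = d p q" "d p m + d m r = d p r" "d q m + d m r = d q r"
proof -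
  \<comment> \<open>\<open>k\<close> is the Gromov product of \<open>q\<close> and \<open>r\<close>
    at \<open>p\<close>, the distance from \<open>p\<close> to the branch point; parity makes the
    division exact.\<close>
  define k where "k = (d p q + d p r - d q r) div 2"
  have tri: "d q r \<le> d p q + d p r" "d p r \<le> d p q + d q r" "d p q \<le> d p r + d q r"
    using d_triangle[of q p r] d_triangle[of p q r] d_triangle[of p r q] assms
      d_sym[of p q] d_sym[of r q] d_sym[of p r] by auto
  have "even (d p q + d q r + d p r)" by (rule d_parity; fact)
  then have k: "2 * k + d q r = d p q + d p r" using tri unfolding k_def by presburger
  then have "k \<le> d p q" using tri by linarith
  from geodesic[OF assms(1,2) this] obtain m where m: "m \<in> V" "d p m = k" "k + d m q = d p q" by blast
  have s: "d m p = d p m" "d m q = d q m" "d q p = d p q" "d r m = d m r"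
    using m assms d_sym by auto
  have "d p q + d m r \<le> max (d p m + d q r) (d p r + d q m)"
    using four_point[OF assms(1,2) m(1) assms(3)] by simp
  moreover have "d p r \<le> d p m + d m r" "d q r \<le> d q m + d m r"
    by ((rule d_triangle; fact)+)
  ultimately show thesis using that[of m] m k s by auto
qed

end

section \<open>Isometric actions: fixed vertices and axes\<close>

locale tree_action = group G + tree_metric V d
  for G :: "('a, 'm) monoid_scheme" (structure) and V :: "'v set" and d +
  fixes act :: "'a \<Rightarrow> 'v \<Rightarrow> 'v"
  assumes act_closed: "g \<in> carrier G \<Longrightarrow> x \<in> V \<Longrightarrow> act g x \<in> V"
    and act_one: "x \<in> V \<Longrightarrow> act \<one> x = x"
    and act_mult: "g \<in> carrier G \<Longrightarrow> h \<in> carrier G \<Longrightarrow> x \<in> V \<Longrightarrow> act (g \<otimes> h) x = act g (act h x)"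
    and act_isometry: "g \<in> carrier G \<Longrightarrow> x \<in> V \<Longrightarrow> y \<in> V \<Longrightarrow> d (act g x) (act g y) = d x y"
begin

definition elliptic :: "'a \<Rightarrow> bool"
  where "elliptic g \<longleftrightarrow> (\<exists>x\<in>V. act g x = x)"

text \<open>Even displacement means that the two colour classes of the tree are preserved. This
  excludes inversions of edges, so that a non-elliptic element has an axis.\<close>

definition even_displacement :: "'a \<Rightarrow> bool"
  where "even_displacement g \<longleftrightarrow> (\<forall>x\<in>V. even (d x (act g x)))"

lemma act_inv_act: "g \<in> carrier G \<Longrightarrow> x \<in> V \<Longrightarrow> act (inv g) (act g x) = x"
  by (metis act_mult act_one inv_closed l_inv)

lemma act_act_inv: "g \<in> carrier G \<Longrightarrow> x \<in> V \<Longrightarrow> act g (act (inv g) x) = x"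
  by (metis act_mult act_one inv_closed r_inv)

lemma act_shift: "g \<in> carrier G \<Longrightarrow> x \<in> V \<Longrightarrow> y \<in> V \<Longrightarrow> d x (act g y) = d (act (inv g) x) y"
  by (metis act_act_inv act_closed act_isometry inv_closed)

lemma act_inv_fixed: "g \<in> carrier G \<Longrightarrow> x \<in> V \<Longrightarrow> act g x = x \<Longrightarrow> act (inv g) x = x"
  by (metis act_inv_act)

lemma act_fixes_geodesic:
  assumes "g \<in> carrier G" "x \<in> V" "y \<in> V" "p \<in> V" "act g x = x" "act g y = y"
    "d x p + d p y = d x y"
  shows "act g p = p"
proof -
  have "d x (act g p) = d x p" "d (act g p) y = d p y"
    using act_isometry[of g x p] act_isometry[of g p y] assms by auto
  then show ?thesis using geodesic_unique[of x y "act g p" p] assms act_closed by auto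
qed

lemma even_displacement_square:
  assumes "g \<in> carrier G" shows "even_displacement (g \<otimes> g)"
  unfolding even_displacement_def
proof
  fix x assume x: "x \<in> V"
  have "even (d x (act g x) + d (act g x) (act g (act g x)) + d x (act g (act g x)))"
    using assms x by (intro d_parity act_closed)
  then show "even (d x (act (g \<otimes> g) x))"
    using act_isometry[of g x "act g x"] assms x by (auto simp: act_mult act_closed)
qed

lemma even_displacement_mult:
  assumes "g \<in> carrier G" "h \<in> carrier G" "even_displacement g" "even_displacement h"
  shows "even_displacement (g \<otimes> h)"
  unfolding even_displacement_def
proof
  fix x assume x: "x \<in> V"
  have "even (d x (act h x) + d (act h x) (act g (act h x)) + d x (act g (act h x)))"
    using assms x by (intro d_parity act_closed)
  moreover have "even (d x (act h x))" "even (d (act h x) (act g (act h x)))"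
    using assms x act_closed unfolding even_displacement_def by auto
  ultimately show "even (d x (act (g \<otimes> h) x))"
    using assms x by (auto simp: act_mult act_closed)
qed

text \<open>As \<open>g\<close> fixes \<open>x\<close>, the vertices \<open>z\<close> and
  \<open>act g z\<close> are equally far from \<open>x\<close>, and \<open>p\<close> lies on both
  geodesics from \<open>x\<close>. So \<open>p\<close> and \<open>act g p\<close> are points of one
  geodesic at the same distance from \<open>x\<close>.\<close>

lemma midpoint_fixed:
  assumes "g \<in> carrier G" "x \<in> V" "z \<in> V" "p \<in> V" "act g x = x"
    "d z p = d p (act g z)" "2 * d z p = d z (act g z)"
  shows "act g p = p"
proof -
  have V: "act g z \<in> V" "act g p \<in> V" using assms act_closed by auto
  have e: "d x z = d x (act g z)" "d x (act g p) = d x p" "d (act g p) (act g z) = d p z"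
    using act_isometry[of g x z] act_isometry[of g x p] act_isometry[of g p z] assms by auto
  note m = midpoint_equidistant[OF assms(2,3) V(1) assms(4) e(1) assms(6,7)]
  show ?thesis
    by (rule geodesic_unique[OF assms(2) V(1) V(2) assms(4)]) (use m e in auto)
qed

text \<open>Serre's argument: if \<open>z\<close> is fixed by \<open>a \<otimes> b\<close>, then
  \<open>act b z\<close> equals \<open>act (inv a) z\<close>, and the midpoint of \<open>z\<close>
  and this vertex is fixed by both \<open>b\<close> and \<open>inv a\<close>.\<close>

lemma common_fixed_point:
  assumes "a \<in> carrier G" "b \<in> carrier G" "elliptic a" "elliptic b" "elliptic (a \<otimes> b)"
  obtains p where "p \<in> V" "act a p = p" "act b p = p"
proof -
  obtain x y z where x: "x \<in> V" "act a x = x" and y: "y \<in> V" "act b y = y"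
    and z: "z \<in> V" "act (a \<otimes> b) z = z" using assms unfolding elliptic_def by blast
  have w: "act b z = act (inv a) z"
    using z assms by (metis act_closed act_inv_act act_mult)
  have V: "act b z \<in> V" using act_closed assms z by blast
  \<comment> \<open>Two sides of this triangle are equal because \<open>b\<close> fixes
    \<open>y\<close>, so the third is even and its midpoint is a vertex.\<close>
  have "even (d y z + d z (act b z) + d y (act b z))"
    by (rule d_parity; fact)
  moreover have "d y (act b z) = d y z" using act_isometry[of b y z] assms y z by simp
  ultimately have "even (d z (act b z))" by presburger
  then obtain p where p: "p \<in> V" "d z p = d p (act b z)" "2 * d z p = d z (act b z)"
    using midpoint[OF z(1) V] by blast
  have "act b p = p" by (rule midpoint_fixed[OF assms(2) y(1) z(1) p(1) y(2) p(2,3)])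
  moreover have "act (inv a) p = p"
    by (rule midpoint_fixed[of _ x z]) (use assms x z p w act_inv_fixed in auto)
  then have "act a p = p" using assms(1) p(1) act_inv_fixed[of "inv a" p] by simp
  ultimately show thesis using that p by blast
qed

text \<open>Fixed sets are convex, and the median of \<open>p\<close>, \<open>q\<close>,
  \<open>r\<close> lies between two fixed vertices of each of the three elements.\<close>

lemma helly:
  assumes "a \<in> carrier G" "b \<in> carrier G" "c \<in> carrier G"
    and p: "p \<in> V" "act a p = p" "act b p = p"
    and q: "q \<in> V" "act b q = q" "act c q = q"
    and r: "r \<in> V" "act a r = r" "act c r = r"
  obtains m where "m \<in> V" "act a m = m" "act b m = m" "act c m = m"
proof -
  obtain m where m: "m \<in> V" "d p m + d m q = d p q" "d p m + d m r = d p r" "d q m + d m r = d q r"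
    using median p q r by blast
  show thesis
    using act_fixes_geodesic[of a p r m] act_fixes_geodesic[of b p q m] act_fixes_geodesic[of c q r m]
      assms m by (intro that[of m]) auto
qed

text \<open>The equation says that there is no backtracking at \<open>act a x\<close>; hence all
  translates of \<open>x\<close> by powers of \<open>a\<close> lie on one line, and \<open>x\<close>
  is on the axis of the hyperbolic element \<open>a\<close>.\<close>

definition axial :: "'a \<Rightarrow> 'v \<Rightarrow> bool"
  where "axial a x \<longleftrightarrow> act a x \<noteq> x \<and> d x (act a (act a x)) = 2 * d x (act a x)"

text \<open>Take \<open>v\<close> of minimal displacement \<open>?D\<close>. The midpoint
  \<open>p\<close> of \<open>v\<close> and \<open>act a v\<close> is moved by at least
  \<open>?D\<close>, but by at most two halves of \<open>?D\<close> through \<open>act a v\<close>.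
  So the path from \<open>p\<close> to \<open>act a p\<close> does not backtrack there.\<close>

lemma exists_axial:
  assumes a: "a \<in> carrier G" "even_displacement a" "\<not> elliptic a" and "V \<noteq> {}"
  obtains x where "x \<in> V" "axial a x"
proof -
  obtain x0 where "x0 \<in> V" using \<open>V \<noteq> {}\<close> by blast
  obtain v where v: "v \<in> V" "\<And>w. w \<in> V \<Longrightarrow> d v (act a v) \<le> d w (act a w)"
    using \<open>x0 \<in> V\<close> ex_has_least_nat[of "\<lambda>v. v \<in> V" x0 "\<lambda>v. d v (act a v)"] by blast
  let ?D = "d v (act a v)"
  have av: "act a v \<in> V" "act a (act a v) \<in> V" using v a act_closed by auto
  have ne: "act a v \<noteq> v" using a v unfolding elliptic_def by blast
  have "even ?D" using a v unfolding even_displacement_def by blast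
  then obtain p where p: "p \<in> V" "d v p = d p (act a v)" "2 * d v p = ?D"
    using midpoint[OF v(1) av(1)] by blast
  have ap: "act a p \<in> V" using p a act_closed by blast
  have 1: "d (act a v) (act a (act a v)) = ?D" "d (act a v) (act a p) = d v p"
    "d (act a p) (act a (act a v)) = d p (act a v)"
    using a v av p act_isometry by auto
  have min: "?D \<le> d p (act a p)" using v p by blast
  have s: "d (act a v) p = d p (act a v)" "d (act a p) p = d p (act a p)" "d (act a p) v = d v (act a p)"
    "d (act a p) (act a v) = d (act a v) (act a p)" "d (act a v) v = ?D"
    "d (act a (act a v)) (act a v) = d (act a v) (act a (act a v))"
    using d_sym v av p ap by auto
  have pos: "d v p > 0" using p ne v av d_eq_0[of v "act a v"] by (cases "d v p") auto
  have "p \<noteq> act a v" using pos p av d_eq_0[of p "act a v"] by auto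
  have apne: "act a v \<noteq> act a p" using pos 1 av ap d_eq_0[of "act a v" "act a p"] by auto
  have tri: "d p (act a p) \<le> d p (act a v) + d (act a v) (act a p)"
    by (rule d_triangle; fact)
  have 2: "d v (act a p) = d v p + d p (act a v) + d (act a v) (act a p)"
    using min tri p 1 \<open>p \<noteq> act a v\<close>
    by (intro geodesic_concat v p av ap) auto
  have "d v (act a (act a v)) = d v (act a v) + d (act a v) (act a p) + d (act a p) (act a (act a v))"
    using 2 p 1 by (intro geodesic_concat v p av ap apne) auto
  then have "axial a v" using ne p 1 unfolding axial_def by auto
  then show thesis using that v by blast
qed

lemma axial_pow:
  assumes a: "a \<in> carrier G" and x: "x \<in> V" "axial a x"
  shows "d x (act (a [^] (k::nat)) x) = k * d x (act a x)"
proof -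
  let ?D = "d x (act a x)"
  have V: "act (a [^] i) x \<in> V" for i :: nat using act_closed a x by auto
  have s: "act (a [^] Suc i) x = act (a [^] i) (act a x)" for i
    using a x by (simp add: act_mult)
  have step: "d (act (a [^] i) x) (act (a [^] Suc i) x) = ?D" for i :: nat
    unfolding s using a x by (simp add: act_isometry act_closed)
  have step2: "d (act (a [^] i) x) (act (a [^] Suc (Suc i)) x) = 2 * ?D" for i :: nat
  proof -
    have "act (a [^] Suc (Suc i)) x = act (a [^] i) (act a (act a x))"
      unfolding s using a x by (simp add: act_mult act_closed)
    then show ?thesis using a x by (simp add: act_isometry act_closed axial_def)
  qed
  have ne: "act (a [^] i) x \<noteq> act (a [^] Suc i) x" for i :: nat
    using step[of i] V d_eq_0[of x "act a x"] x d_eq_0[OF V V] a act_closed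
    unfolding axial_def by metis
  have "d x (act (a [^] k) x) = k * ?D \<and> d x (act (a [^] Suc k) x) = Suc k * ?D"
  proof (induction k)
    case 0
    then show ?case using a x d_eq_0[of x x] by (simp add: act_one)
  next
    case (Suc k)
    have "d x (act (a [^] Suc (Suc k)) x) = d x (act (a [^] k) x) + d (act (a [^] k) x) (act (a [^] Suc k) x)
       + d (act (a [^] Suc k) x) (act (a [^] Suc (Suc k)) x)"
      by (rule geodesic_concat[OF x(1) V V V ne]) (use Suc step[of k] step[of "Suc k"] step2[of k] in auto)
    then show ?case using Suc step[of k] step[of "Suc k"] by auto
  qed
  then show ?thesis by blast
qed

lemma axial_inv:
  assumes a: "a \<in> carrier G" and x: "x \<in> V" "axial a x"
  shows "axial (inv a) x" "d x (act (inv a) x) = d x (act a x)"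
proof -
  show 1: "d x (act (inv a) x) = d x (act a x)"
    using act_shift[of a x x] d_sym a x act_closed by auto
  have "d x (act (inv a) (act (inv a) x)) = d (act a (act a x)) x"
    using act_shift[of "inv a" x "act (inv a) x"] act_shift[of "inv a" "act a x" x]
      a x act_closed by auto
  then show "axial (inv a) x"
    using 1 x a act_inv_fixed[of "inv a" x] unfolding axial_def
    by (metis act_closed d_sym inv_closed inv_inv)
qed

text \<open>A fixed vertex \<open>v\<close> would keep the orbit of \<open>x\<close> under the power
  within \<open>2 * d x v\<close> of \<open>x\<close>, whereas displacement along the axis grows
  linearly. The multiplier \<open>j\<close> is chosen to exceed that bound.\<close>

lemma axial_not_elliptic_pow:
  assumes a: "a \<in> carrier G" and x: "x \<in> V" "axial a x" and k: "(k::nat) > 0"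
  shows "\<not> elliptic (a [^] k)"
proof
  assume "elliptic (a [^] k)"
  then obtain v where v: "v \<in> V" "act (a [^] k) v = v" unfolding elliptic_def by blast
  have fix_v: "act (a [^] (k * j)) v = v" for j :: nat
  proof (induction j)
    case 0 then show ?case using v act_one by simp
  next
    case (Suc j)
    have "a [^] (k * Suc j) = a [^] k \<otimes> a [^] (k * j)"
      using a by (simp add: nat_pow_mult)
    then show ?case using Suc v a by (simp add: act_mult)
  qed
  define j where "j = Suc (2 * d x v)"
  let ?g = "a [^] (k * j)"
  have V: "act ?g x \<in> V" using a x act_closed by auto
  have "d x (act ?g x) \<le> d x v + d v (act ?g x)" by (rule d_triangle; fact)
  also have "d v (act ?g x) = d v x" using act_isometry[of ?g v x] a v x fix_v by simp
  finally have "k * j * d x (act a x) \<le> 2 * d x v"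
    using axial_pow[OF a x, of "k * j"] d_sym[of v x] v x by simp
  moreover have "d x (act a x) > 0" using x a act_closed d_eq_0[of x "act a x"] unfolding axial_def by auto
  then have "j * 1 \<le> k * j * d x (act a x)" using k
    by (metis One_nat_def Suc_leI mult.commute mult_le_mono mult.left_neutral le_refl)
  ultimately have "j * 1 \<le> 2 * d x v" by (rule order_trans[rotated])
  then show False unfolding j_def by simp
qed

text \<open>Distances from the far point \<open>act (a [^] k) x\<close> represent the Busemann
  function of an end of the axis. As \<open>b\<close> commutes with \<open>a\<close>, it fixes this
  end and shifts the function by a constant: the shifts at \<open>w\<close> and \<open>w'\<close>
  agree. The terms are arranged to avoid subtraction on \<open>nat\<close>.\<close>

lemma busemann_shift:
  assumes a: "a \<in> carrier G" and x: "x \<in> V" "axial a x"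
    and b: "b \<in> carrier G" "a \<otimes> b = b \<otimes> a" and w: "w \<in> V" "w' \<in> V"
  shows "\<forall>\<^sub>F k in sequentially. d (act (a [^] k) x) (act b w) + d (act (a [^] k) x) w' =
    d (act (a [^] k) x) (act b w') + d (act (a [^] k) x) w"
proof (rule eventually_sequentiallyI)
  \<comment> \<open>The points \<open>?s\<close> and \<open>?s'\<close> stay
    \<open>d x (act (inv b) x)\<close> apart. Beyond this threshold they are so far from
    \<open>w\<close> and \<open>w'\<close> that the alternative with \<open>d w w'\<close> drops out
    of both four-point inequalities.\<close>
  fix k assume k: "2 * d x w + 2 * d x w' + 2 * d x (act (inv b) x) + 1 \<le> k"
  let ?s = "act (a [^] k) x" and ?s' = "act (a [^] k) (act (inv b) x)"
  have comm: "inv b \<otimes> a [^] k = a [^] k \<otimes> inv b"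
  proof -
    have "a [^] k \<otimes> b = b \<otimes> a [^] k" using group_commutes_pow[OF b(2) a b(1)] .
    then show ?thesis using a b by (metis inv_solve_left inv_solve_right m_assoc m_closed inv_closed nat_pow_closed)
  qed
  have V: "?s \<in> V" "?s' \<in> V" "act (inv b) x \<in> V" using a b x act_closed by auto
  have "d ?s (act b y) = d ?s' y" if "y \<in> V" for y
    using act_shift[OF b(1) V(1) that] comm a b x by (metis act_mult inv_closed nat_pow_closed)
  note sh = this[OF w(1)] this[OF w(2)]
  have "d x (act a x) > 0" using x a act_closed d_eq_0[of x "act a x"] unfolding axial_def by auto
  then have kk: "k \<le> d x ?s" unfolding axial_pow[OF a x] by simp
  have "d ?s ?s' = d x (act (inv b) x)" using act_isometry a x V by auto
  moreover have "d x ?s \<le> d x w + d w ?s" "d x ?s \<le> d x w' + d w' ?s" "d ?s w \<le> d ?s ?s' + d ?s' w"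
    "d ?s w' \<le> d ?s ?s' + d ?s' w'" "d w w' \<le> d w x + d x w'"
    by ((rule d_triangle; fact)+)
  moreover have "d w ?s = d ?s w" "d w' ?s = d ?s w'" "d w x = d x w" "d w ?s' = d ?s' w" "d w' ?s' = d ?s' w'"
    "d w' w = d w w'"
    using d_sym V w x by auto
  moreover have "d ?s w + d ?s' w' \<le> max (d ?s ?s' + d w w') (d ?s w' + d w ?s')"
    "d ?s w' + d ?s' w \<le> max (d ?s ?s' + d w' w) (d ?s w + d w' ?s')"
    by ((rule four_point; fact)+)
  ultimately show "d ?s (act b w) + d ?s w' = d ?s (act b w') + d ?s w"
    unfolding sh using k kk by linarith
qed

abbreviation comm :: "'a \<Rightarrow> 'a \<Rightarrow> 'a" where "comm b c \<equiv> b \<otimes> c \<otimes> inv b \<otimes> inv c"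

text \<open>The shift is additive on the centralizer of \<open>a\<close>, so it vanishes on
  commutators. The proof follows \<open>x\<close> through the four factors; the contributions of
  \<open>b\<close> and \<open>c\<close> cancel against those of their inverses.\<close>

lemma busemann_commutator:
  assumes a: "a \<in> carrier G" and x: "x \<in> V" "axial a x"
    and b: "b \<in> carrier G" "a \<otimes> b = b \<otimes> a" and c: "c \<in> carrier G" "a \<otimes> c = c \<otimes> a"
  shows "\<forall>\<^sub>F k in sequentially. d (act (a [^] k) x) (act (comm b c) x) = d (act (a [^] k) x) x"
proof -
  define y1 where "y1 = act (inv c) x"
  define y2 where "y2 = act (inv b) y1"
  define y3 where "y3 = act c y2"
  have V: "y1 \<in> V" "y2 \<in> V" "y3 \<in> V" using b c x act_closed unfolding y1_def y2_def y3_def by auto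
  have u: "act (comm b c) x = act b y3"
    unfolding y1_def y2_def y3_def using b c x by (simp add: act_mult act_closed)
  have "act c y1 = x" "act b y2 = y1"
    unfolding y2_def using y1_def b c x V by (auto simp: act_act_inv)
  note cb = this
  have "\<forall>\<^sub>F k in sequentially. d (act (a [^] k) x) y3 + d (act (a [^] k) x) y1 =
      d (act (a [^] k) x) x + d (act (a [^] k) x) y2"
    using busemann_shift[OF a x c V(2) V(1)] unfolding cb y3_def[symmetric] .
  moreover have "\<forall>\<^sub>F k in sequentially. d (act (a [^] k) x) (act b y3) + d (act (a [^] k) x) y2 =
      d (act (a [^] k) x) y1 + d (act (a [^] k) x) y3"
    using busemann_shift[OF a x b V(3) V(2)] unfolding cb .
  ultimately show ?thesis unfolding u by eventually_elim linarith
qed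

text \<open>The shift vanishes at both ends, as seen from \<open>a\<close> and from
  \<open>inv a\<close>. So \<open>?y\<close> is as far as \<open>x\<close> from two points of the
  axis on either side of \<open>x\<close>, and geodesics are unique.\<close>

lemma commutator_fixes_axis:
  assumes a: "a \<in> carrier G" and x: "x \<in> V" "axial a x"
    and b: "b \<in> carrier G" "a \<otimes> b = b \<otimes> a" and c: "c \<in> carrier G" "a \<otimes> c = c \<otimes> a"
  shows "act (comm b c) x = x"
proof -
  have com: "inv a \<otimes> g = g \<otimes> inv a" if "g \<in> carrier G" "a \<otimes> g = g \<otimes> a" for g
    using that a by (metis inv_closed inv_solve_left inv_solve_right m_assoc m_closed)
  let ?y = "act (comm b c) x"
  have "\<forall>\<^sub>F k in sequentially. d (act (a [^] k) x) ?y = d (act (a [^] k) x) x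
     \<and> d (act (inv a [^] k) x) ?y = d (act (inv a [^] k) x) x"
    using busemann_commutator[OF a x b c]
      busemann_commutator[OF inv_closed[OF a] x(1) axial_inv(1)[OF a x] b(1) com[OF b] c(1) com[OF c]]
    by eventually_elim auto
  from eventually_happens'[OF sequentially_bot this]
  obtain k :: nat where k: "d (act (a [^] k) x) ?y = d (act (a [^] k) x) x"
    "d (act (inv a [^] k) x) ?y = d (act (inv a [^] k) x) x"
    by blast
  let ?l = "act (inv a [^] k) x" and ?r = "act (a [^] k) x"
  have V: "?l \<in> V" "?r \<in> V" "?y \<in> V" using a b c x act_closed by auto
  have "d ?l ?r = d x (act (a [^] k) ?r)"
    using act_shift[of "inv a [^] k" ] a x V
    by (metis act_isometry act_act_inv inv_closed nat_pow_closed nat_pow_inv)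
  also have "act (a [^] k) ?r = act (a [^] (k + k)) x"
    using a x by (simp add: act_mult nat_pow_mult[symmetric])
  also have "d x \<dots> = (k + k) * d x (act a x)" by (rule axial_pow[OF a x])
  finally have lr: "d ?l ?r = k * d x (act a x) + k * d x (act a x)" by (simp add: algebra_simps)
  have l: "d ?l x = k * d x (act a x)"
    using axial_pow[OF inv_closed[OF a] x(1) axial_inv(1)[OF a x]] axial_inv(2)[OF a x] d_sym V x by auto
  have r: "d ?r x = k * d x (act a x)"
    using axial_pow[OF a x] d_sym V x by auto
  show ?thesis
    by (rule geodesic_unique[OF V(1,2,3) x(1)]) (use k l r lr V x d_sym in auto)
qed

end

text \<open>Trees are described without cycles, as connected graphs in which every edge is a bridge:
  \<open>H\<close> is the side of \<open>y\<close>, entered from outside only through the edge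
  itself. For Bass--Serre trees such a side can be read off from the presentation.\<close>

locale bridge_graph =
  fixes V :: "'v set" and r :: "('v \<times> 'v) set"
  assumes edges: "r \<subseteq> V \<times> V"
    and edge_sym: "(x, y) \<in> r \<Longrightarrow> (y, x) \<in> r"
    and connected: "x \<in> V \<Longrightarrow> y \<in> V \<Longrightarrow> (x, y) \<in> r\<^sup>*"
    and bridge: "(x, y) \<in> r \<Longrightarrow>
      \<exists>H. x \<notin> H \<and> y \<in> H \<and> (\<forall>p q. (p, q) \<in> r \<longrightarrow> p \<notin> H \<longrightarrow> q \<in> H \<longrightarrow> p = x \<and> q = y)"
begin

definition gdist :: "'v \<Rightarrow> 'v \<Rightarrow> nat"
  where "gdist x y = (LEAST n. (x, y) \<in> r ^^ n)"

lemma gdist_walk: "x \<in> V \<Longrightarrow> y \<in> V \<Longrightarrow> (x, y) \<in> r ^^ gdist x y"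
  unfolding gdist_def by (rule LeastI_ex) (use connected rtrancl_power in blast)

lemma gdist_le: "(x, y) \<in> r ^^ n \<Longrightarrow> gdist x y \<le> n"
  unfolding gdist_def by (rule Least_le)

lemma walk_sym: "(x, y) \<in> r ^^ n \<Longrightarrow> (y, x) \<in> r ^^ n"
proof (induction n arbitrary: y)
  case (Suc n)
  then obtain z where "(x, z) \<in> r ^^ n" "(z, y) \<in> r" by auto
  then show ?case using Suc.IH edge_sym relpow_Suc_I2 by metis
qed simp

lemma walk_closed: "(x, y) \<in> r ^^ n \<Longrightarrow> x \<in> V \<Longrightarrow> y \<in> V"
  by (cases n) (use edges in auto)

lemma gdist_self [simp]: "gdist x x = 0"
  using gdist_le[of x x 0] by simp

lemma gdist_sym: "x \<in> V \<Longrightarrow> y \<in> V \<Longrightarrow> gdist x y = gdist y x"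
  by (meson antisym gdist_le gdist_walk walk_sym)

lemma gdist_triangle:
  assumes "x \<in> V" "y \<in> V" "z \<in> V" shows "gdist x z \<le> gdist x y + gdist y z"
  by (rule gdist_le) (use gdist_walk assms in \<open>auto simp: relpow_add\<close>)

lemma gdist_geodesic:
  assumes "x \<in> V" "y \<in> V" "k \<le> gdist x y"
  shows "\<exists>z\<in>V. gdist x z = k \<and> k + gdist z y = gdist x y"
proof -
  have "(x, y) \<in> r ^^ (k + (gdist x y - k))" using gdist_walk assms by simp
  then obtain z where z: "(x, z) \<in> r ^^ k" "(z, y) \<in> r ^^ (gdist x y - k)"
    unfolding relpow_add by blast
  have "z \<in> V" using z walk_closed assms by blast
  moreover have "gdist x y \<le> gdist x z + gdist z y" using gdist_triangle assms \<open>z \<in> V\<close> by blast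
  ultimately show ?thesis using gdist_le[OF z(1)] gdist_le[OF z(2)] assms by (intro bexI[of _ z]) auto
qed

lemma walk_crossing:
  assumes "(u, v) \<in> r ^^ n" "u \<notin> H" "v \<in> H"
  shows "\<exists>i j p q. n = i + 1 + j \<and> (u, p) \<in> r ^^ i \<and> (p, q) \<in> r \<and> p \<notin> H \<and> q \<in> H \<and> (q, v) \<in> r ^^ j"
  using assms
proof (induction n arbitrary: u)
  case (Suc n)
  from relpow_Suc_D2[OF Suc.prems(1)] obtain u' where u': "(u, u') \<in> r" "(u', v) \<in> r ^^ n" by blast
  show ?case
  proof (cases "u' \<in> H")
    case True
    with u' Suc.prems show ?thesis by (intro exI[of _ 0] exI[of _ n] exI[of _ u] exI[of _ u']) auto
  next
    case False
    from Suc.IH[OF u'(2) False Suc.prems(3)] obtain i j p q where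
      "n = i + 1 + j" "(u', p) \<in> r ^^ i" "(p, q) \<in> r" "p \<notin> H" "q \<in> H" "(q, v) \<in> r ^^ j" by blast
    moreover from this have "(u, p) \<in> r ^^ Suc i" using u' relpow_Suc_I2 by metis
    ultimately show ?thesis by (intro exI[of _ "Suc i"] exI[of _ j] exI[of _ p] exI[of _ q]) auto
  qed
qed simp

text \<open>A shortest walk between the two sides has to use the bridge, and its parts before and
  after the bridge are at least as long as the respective distances.\<close>

lemma edge_cut:
  assumes "(w, w') \<in> r"
  obtains H where "w \<notin> H" "w' \<in> H"
    "\<And>u v. u \<in> V \<Longrightarrow> v \<in> V \<Longrightarrow> u \<notin> H \<Longrightarrow> v \<in> H \<Longrightarrow> gdist u v = gdist u w + 1 + gdist v w'"
proof -
  from bridge[OF assms] obtain H where H: "w \<notin> H" "w' \<in> H"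
    and cross: "\<forall>p q. (p, q) \<in> r \<longrightarrow> p \<notin> H \<longrightarrow> q \<in> H \<longrightarrow> p = w \<and> q = w'"
    by (elim exE conjE)
  have "gdist u v = gdist u w + 1 + gdist v w'" if uv: "u \<in> V" "v \<in> V" "u \<notin> H" "v \<in> H" for u v
  proof -
    have w: "w \<in> V" "w' \<in> V" using assms edges by auto
    obtain i j where ij: "gdist u v = i + 1 + j" "(u, w) \<in> r ^^ i" "(w', v) \<in> r ^^ j"
      using walk_crossing[OF gdist_walk[OF uv(1,2)] uv(3,4)] cross by metis
    have "(w, w') \<in> r ^^ 1" using assms by simp
    then have "gdist w w' \<le> 1" by (rule gdist_le)
    then have "gdist u v \<le> gdist u w + 1 + gdist w' v"
      using gdist_triangle[of u w v] gdist_triangle[of w w' v] uv w by linarith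
    with ij gdist_le[OF ij(2)] gdist_le[OF ij(3)] gdist_sym[of w' v] w uv show ?thesis by linarith
  qed
  then show thesis by (rule that[OF H])
qed

text \<open>The three inequalities together say that the two largest sums coincide. Let the last
  point move along an edge from \<open>w0\<close> to \<open>w\<close>. If \<open>x\<close>,
  \<open>y\<close>, \<open>z\<close> are on the same side, all three sums change by one in the same
  direction; otherwise the edge separates the points, and the sums are compared through the
  bridge.\<close>

lemma gdist_four_point:
  assumes "x \<in> V" "y \<in> V" "z \<in> V" "(z, w) \<in> r ^^ n"
  defines "a \<equiv> gdist x y + gdist z w" and "b \<equiv> gdist x z + gdist y w" and "c \<equiv> gdist x w + gdist y z"
  shows "a \<le> max b c \<and> b \<le> max a c \<and> c \<le> max a b"
  using assms(4) unfolding a_def b_def c_def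
proof (induction n arbitrary: w)
  case 0
  then have "w = z" by simp
  then show ?case using gdist_triangle[of x z y] gdist_sym[of y z] assms(1-3) by simp
next
  case (Suc n)
  then obtain w0 where w0: "(z, w0) \<in> r ^^ n" "(w0, w) \<in> r" by auto
  note IH = Suc.IH[OF w0(1)]
  obtain H where H: "w0 \<notin> H" "w \<in> H"
    "\<And>u v. u \<in> V \<Longrightarrow> v \<in> V \<Longrightarrow> u \<notin> H \<Longrightarrow> v \<in> H \<Longrightarrow> gdist u v = gdist u w0 + 1 + gdist v w"
    using edge_cut[OF w0(2)] by blast
  have w: "w0 \<in> V" "w \<in> V" using w0 edges by auto
  have out: "gdist u w = gdist u w0 + 1" if "u \<in> V" "u \<notin> H" for u
    using H(3)[OF that(1) w(2) that(2) H(2)] by simp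
  have inn: "gdist u w0 = gdist u w + 1" if "u \<in> V" "u \<in> H" for u
    using H(3)[OF w(1) that(1) H(1) that(2)] gdist_sym[OF that(1) w(1)] by simp
  have T: "gdist u v \<le> gdist u t + gdist v t" if "u \<in> V" "v \<in> V" "t \<in> V" for u v t
    using gdist_triangle[of u t v] gdist_sym[of v t] that by auto
  have cut: "gdist u v = gdist u w0 + 1 + gdist v w" "gdist v u = gdist u w0 + 1 + gdist v w"
    if "u \<in> V" "v \<in> V" "u \<notin> H" "v \<in> H" for u v
    using H(3)[OF that] gdist_sym[OF that(1,2)] by simp_all
  have two_largest: "A \<le> max B C \<and> B \<le> max A C \<and> C \<le> max A B"
    if "A = B \<and> C \<le> A \<or> A = C \<and> B \<le> A \<or> B = C \<and> A \<le> B" for A B C :: nat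
    using that by auto
  consider "x \<in> H \<longleftrightarrow> z \<in> H" "y \<in> H \<longleftrightarrow> z \<in> H"
    | "x \<in> H" "y \<notin> H" "z \<notin> H" | "x \<notin> H" "y \<in> H" "z \<in> H"
    | "x \<notin> H" "y \<in> H" "z \<notin> H" | "x \<in> H" "y \<notin> H" "z \<in> H"
    | "x \<notin> H" "y \<notin> H" "z \<in> H" | "x \<in> H" "y \<in> H" "z \<notin> H"
    by blast
  then show ?case
  proof cases
    case 1
    then consider "gdist x w = gdist x w0 + 1" "gdist y w = gdist y w0 + 1" "gdist z w = gdist z w0 + 1"
      | "gdist x w0 = gdist x w + 1" "gdist y w0 = gdist y w + 1" "gdist z w0 = gdist z w + 1"
      using out[OF assms(1)] out[OF assms(2)] out[OF assms(3)] inn[OF assms(1)] inn[OF assms(2)] inn[OF assms(3)]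
      by blast
    then show ?thesis using IH by cases (auto simp: le_max_iff_disj)
  next
    case 2
    show ?thesis
      using cut[OF assms(2,1) 2(2,1)] cut[OF assms(3,1) 2(3,1)] out[OF assms(2) 2(2)] out[OF assms(3) 2(3)] T[OF assms(2,3) w(1)]
      by (intro two_largest disjI1 conjI) linarith+
  next
    case 3
    show ?thesis
      using cut[OF assms(1,2) 3(1,2)] cut[OF assms(1,3) 3(1,3)] out[OF assms(1) 3(1)] T[OF assms(2,3) w(2)]
      by (intro two_largest disjI1 conjI) linarith+
  next
    case 4
    show ?thesis
      using cut[OF assms(1,2) 4(1,2)] cut[OF assms(3,2) 4(3,2)] out[OF assms(1) 4(1)] out[OF assms(3) 4(3)] T[OF assms(1,3) w(1)]
      by (intro two_largest disjI2[OF disjI1] conjI) linarith+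
  next
    case 5
    show ?thesis
      using cut[OF assms(2,1) 5(2,1)] cut[OF assms(2,3) 5(2,3)] out[OF assms(2) 5(2)] T[OF assms(1,3) w(2)]
      by (intro two_largest disjI2[OF disjI1] conjI) linarith+
  next
    case 6
    show ?thesis
      using cut[OF assms(1,3) 6(1,3)] cut[OF assms(2,3) 6(2,3)] out[OF assms(1) 6(1)] out[OF assms(2) 6(2)] T[OF assms(1,2) w(1)]
      by (intro two_largest disjI2[OF disjI2] conjI) linarith+
  next
    case 7
    show ?thesis
      using cut[OF assms(3,1) 7(3,1)] cut[OF assms(3,2) 7(3,2)] out[OF assms(3) 7(3)] T[OF assms(1,2) w(2)]
      by (intro two_largest disjI2[OF disjI2] conjI) linarith+
  qed
qed

lemma gdist_parity:
  assumes "x \<in> V" "y \<in> V" "(y, z) \<in> r ^^ n"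
  shows "even (gdist x y + gdist y z + gdist x z)"
  using assms(3)
proof (induction n arbitrary: z)
  case (Suc n)
  then obtain w where w: "(y, w) \<in> r ^^ n" "(w, z) \<in> r" by auto
  obtain H where H: "w \<notin> H" "z \<in> H"
    "\<And>u v. u \<in> V \<Longrightarrow> v \<in> V \<Longrightarrow> u \<notin> H \<Longrightarrow> v \<in> H \<Longrightarrow> gdist u v = gdist u w + 1 + gdist v z"
    using edge_cut[OF w(2)] by blast
  have V: "w \<in> V" "z \<in> V" using w edges by auto
  have "odd (gdist u w + gdist u z)" if "u \<in> V" for u
  proof (cases "u \<in> H")
    case True
    then show ?thesis using H(3)[OF V(1) that H(1) True] gdist_sym[OF that V(1)] by simp
  next
    case False
    then show ?thesis using H(3)[OF that V(2) False H(2)] by simp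
  qed
  from this[OF assms(1)] this[OF assms(2)] Suc.IH[OF w(1)] show ?case by presburger
qed simp

sublocale tree_metric V gdist
proof
  fix x y z w k assume x: "x \<in> V" and y: "y \<in> V"
  show "gdist x y = 0 \<longleftrightarrow> x = y" using gdist_walk[OF x y] by auto
  show "gdist x y = gdist y x" using gdist_sym x y .
  show "k \<le> gdist x y \<Longrightarrow> \<exists>z\<in>V. gdist x z = k \<and> k + gdist z y = gdist x y"
    using gdist_geodesic x y .
  assume z: "z \<in> V"
  show "gdist x z \<le> gdist x y + gdist y z" using gdist_triangle x y z .
  show "even (gdist x y + gdist y z + gdist x z)" using gdist_parity[OF x y gdist_walk[OF y z]] .
  assume w: "w \<in> V"
  show "gdist x y + gdist z w \<le> max (gdist x z + gdist y w) (gdist x w + gdist y z)"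
    using gdist_four_point[OF x y z gdist_walk[OF z w]] by blast
qed

lemma gdist_eq_1: "x \<in> V \<Longrightarrow> y \<in> V \<Longrightarrow> gdist x y = 1 \<Longrightarrow> (x, y) \<in> r"
  using gdist_walk[of x y] by simp

lemma edge_gdist: "(x, y) \<in> r \<Longrightarrow> gdist x y = 1"
  using gdist_le[of x y 1] edges bridge[of x y] d_eq_0[of x y] by (cases "gdist x y") auto

end

text \<open>Common interface for both kinds of splitting: all edges are translates of the base edge
  from \<open>p\<close> to \<open>q\<close>, and \<open>H\<close> is the half of the tree at
  \<open>q\<close>. By \<open>separates\<close>, a translate of the base edge straddles
  \<open>H\<close> only if it is the base edge with its orientation; this gives the bridges, the
  edge stabilizer \<open>C\<close> and the absence of inversions at once.\<close>

locale edge_transitive_tree = group G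
  for G :: "('a, 'm) monoid_scheme" (structure) +
  fixes V :: "'v set" and act :: "'a \<Rightarrow> 'v \<Rightarrow> 'v" and p q :: 'v and H :: "'v set" and C :: "'a set"
  assumes act_closed: "g \<in> carrier G \<Longrightarrow> x \<in> V \<Longrightarrow> act g x \<in> V"
    and act_one: "x \<in> V \<Longrightarrow> act \<one> x = x"
    and act_mult: "g \<in> carrier G \<Longrightarrow> h \<in> carrier G \<Longrightarrow> x \<in> V \<Longrightarrow> act (g \<otimes> h) x = act g (act h x)"
    and subgroup: "subgroup C G"
    and base: "p \<in> V" "q \<in> V" "p \<notin> H"
    and C_fixes: "c \<in> C \<Longrightarrow> act c p = p" "c \<in> C \<Longrightarrow> act c q = q"
    and orbits: "x \<in> V \<Longrightarrow> \<exists>g\<in>carrier G. x = act g p \<or> x = act g q"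
    and separates: "g \<in> carrier G \<Longrightarrow> (act g p \<in> H \<longleftrightarrow> act g q \<notin> H) \<longleftrightarrow> g \<in> C"
    and base_connected: "g \<in> carrier G \<Longrightarrow>
      (p, act g p) \<in> ({(act h p, act h q) | h. h \<in> carrier G} \<union> {(act h q, act h p) | h. h \<in> carrier G})\<^sup>*"
begin

definition edge_rel :: "('v \<times> 'v) set"
  where "edge_rel = {(act h p, act h q) | h. h \<in> carrier G} \<union> {(act h q, act h p) | h. h \<in> carrier G}"

lemma q_in: "q \<in> H"
  using separates[of \<one>] base act_one subgroup.one_closed[OF subgroup] by auto

lemma act_inv_act': "g \<in> carrier G \<Longrightarrow> x \<in> V \<Longrightarrow> act (inv g) (act g x) = x"
  by (metis act_mult act_one inv_closed l_inv)

lemma act_act_inv': "g \<in> carrier G \<Longrightarrow> x \<in> V \<Longrightarrow> act g (act (inv g) x) = x"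
  by (metis act_mult act_one inv_closed r_inv)

lemma crossing_translate:
  assumes "g \<in> carrier G" "h \<in> carrier G"
    "(act (inv g) (act h p) \<in> H) \<noteq> (act (inv g) (act h q) \<in> H)"
  shows "act h p = act g p" "act h q = act g q"
proof -
  have "inv g \<otimes> h \<in> C" using separates[of "inv g \<otimes> h"] assms base by (auto simp: act_mult)
  then have "act (inv g) (act h p) = p" "act (inv g) (act h q) = q"
    using C_fixes assms base by (metis act_mult inv_closed)+
  then show "act h p = act g p" "act h q = act g q"
    using act_act_inv' assms act_closed base by metis+
qed

sublocale bridge_graph V edge_rel
proof
  show "edge_rel \<subseteq> V \<times> V" unfolding edge_rel_def using base act_closed by auto
  show sym: "(y, x) \<in> edge_rel" if "(x, y) \<in> edge_rel" for x y
    using that unfolding edge_rel_def by blast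
  have p_conn: "(p, x) \<in> edge_rel\<^sup>*" if x: "x \<in> V" for x
  proof -
    obtain g where g: "g \<in> carrier G" "x = act g p \<or> x = act g q"
      using orbits[OF x] by (elim bexE) (rule that)
    have "(p, act g p) \<in> edge_rel\<^sup>*" using base_connected[OF g(1)] unfolding edge_rel_def .
    moreover have "(act g p, act g q) \<in> edge_rel" using g unfolding edge_rel_def by blast
    ultimately show ?thesis using g by auto
  qed
  have "sym edge_rel" using sym by (auto simp: sym_def)
  then have "(x, p) \<in> edge_rel\<^sup>*" if "x \<in> V" for x
    using p_conn[OF that] by (metis sym_rtrancl symD)
  then show "(x, y) \<in> edge_rel\<^sup>*" if "x \<in> V" "y \<in> V" for x y
    using p_conn that by (meson rtrancl_trans)
next
  fix x y assume "(x, y) \<in> edge_rel"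
  then obtain g where g: "g \<in> carrier G" "(x, y) = (act g p, act g q) \<or> (x, y) = (act g q, act g p)"
    unfolding edge_rel_def by blast
  have gpq: "act (inv g) (act g p) = p" "act (inv g) (act g q) = q" using g(1) base act_inv_act' by auto
  have cross: "u = act g p \<and> v = act g q"
    if uv: "(u, v) \<in> edge_rel" "act (inv g) u \<notin> H" "act (inv g) v \<in> H" for u v
  proof -
    obtain h where h: "h \<in> carrier G" "(u, v) = (act h p, act h q) \<or> (u, v) = (act h q, act h p)"
      using uv(1) unfolding edge_rel_def by blast
    have "(act (inv g) (act h p) \<in> H) \<noteq> (act (inv g) (act h q) \<in> H)" using h(2) uv(2,3) by auto
    note eq = crossing_translate[OF g(1) h(1) this]
    from h(2) show ?thesis
    proof
      assume "(u, v) = (act h q, act h p)"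
      then have "act (inv g) u = q" using eq gpq by simp
      then show ?thesis using uv(2) q_in by simp
    qed (use eq in simp)
  qed
  have sym: "(v, u) \<in> edge_rel" if "(u, v) \<in> edge_rel" for u v
    using that unfolding edge_rel_def by blast
  \<comment> \<open>The required side is the translate of \<open>H\<close> by \<open>g\<close>, or
    its complement if the edge is traversed backwards.\<close>
  let ?H = "{v. act (inv g) v \<in> H}"
  from g(2) show "\<exists>H. x \<notin> H \<and> y \<in> H \<and>
    (\<forall>p q. (p, q) \<in> edge_rel \<longrightarrow> p \<notin> H \<longrightarrow> q \<in> H \<longrightarrow> p = x \<and> q = y)"
  proof
    assume "(x, y) = (act g p, act g q)"
    then show ?thesis using gpq base q_in cross by (intro exI[of _ ?H]) simp
  next
    assume "(x, y) = (act g q, act g p)"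
    then show ?thesis using gpq base q_in cross[OF sym] by (intro exI[of _ "- ?H"]) simp
  qed
qed

lemma act_walk:
  assumes "g \<in> carrier G" "x \<in> V" "(x, y) \<in> edge_rel ^^ n"
  shows "(act g x, act g y) \<in> edge_rel ^^ n"
  using assms(3)
proof (induction n arbitrary: y)
  case (Suc n)
  then obtain z where z: "(x, z) \<in> edge_rel ^^ n" "(z, y) \<in> edge_rel" by auto
  then obtain h where h: "h \<in> carrier G" "(z, y) = (act h p, act h q) \<or> (z, y) = (act h q, act h p)"
    unfolding edge_rel_def by blast
  then have "(act g z, act g y) = (act (g \<otimes> h) p, act (g \<otimes> h) q) \<or> (act g z, act g y) = (act (g \<otimes> h) q, act (g \<otimes> h) p)"
    using assms base by (auto simp: act_mult)
  then have "(act g z, act g y) \<in> edge_rel" using h assms unfolding edge_rel_def by blast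
  then show ?case using Suc.IH z by auto
qed simp

lemma gdist_act_le: "g \<in> carrier G \<Longrightarrow> x \<in> V \<Longrightarrow> y \<in> V \<Longrightarrow> gdist (act g x) (act g y) \<le> gdist x y"
  using gdist_le act_walk gdist_walk by blast

sublocale tree_action G V gdist act
proof
  fix g x y assume *: "g \<in> carrier G" "x \<in> V" "y \<in> V"
  show "gdist (act g x) (act g y) = gdist x y"
    using gdist_act_le[OF *] gdist_act_le[of "inv g" "act g x" "act g y"] * act_closed act_inv_act'
    by auto
qed (use act_closed act_one act_mult in auto)

lemma edge_stabilizer:
  assumes "x \<in> V" "y \<in> V" "gdist x y = 1"
  shows "\<exists>g\<in>carrier G. \<forall>h\<in>carrier G. act h x = x \<longrightarrow> act h y = y \<longrightarrow> inv g \<otimes> h \<otimes> g \<in> C"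
proof -
  obtain g where g: "g \<in> carrier G" "(x, y) = (act g p, act g q) \<or> (x, y) = (act g q, act g p)"
    using gdist_eq_1[OF assms] unfolding edge_rel_def by blast
  have "inv g \<otimes> h \<otimes> g \<in> C" if h: "h \<in> carrier G" "act h x = x" "act h y = y" for h
  proof -
    have "act h (act g p) = act g p" "act h (act g q) = act g q" using h g by auto
    then have "act (inv g \<otimes> h \<otimes> g) p = p" "act (inv g \<otimes> h \<otimes> g) q = q"
      using g h base by (auto simp: act_mult act_closed act_inv_act')
    then show ?thesis using separates[of "inv g \<otimes> h \<otimes> g"] g h base q_in by auto
  qed
  with g show ?thesis by blast
qed

end

section \<open>Words and presentations\<close>

abbreviation pclass :: "'x set \<Rightarrow> ('x gword \<times> 'x gword) set \<Rightarrow> 'x gword \<Rightarrow> 'x gword set"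
  where "pclass X R w \<equiv> pres_cong X R `` {w}"

abbreviation inv_letter :: "bool \<times> 'x \<Rightarrow> bool \<times> 'x"
  where "inv_letter \<equiv> apfst Not"

definition inv_word :: "'x gword \<Rightarrow> 'x gword"
  where "inv_word w = rev (map inv_letter w)"

primrec word_prod :: "('a, 'm) monoid_scheme \<Rightarrow> ('x \<Rightarrow> 'a) \<Rightarrow> 'x gword \<Rightarrow> 'a"
  where "word_prod G f [] = \<one>\<^bsub>G\<^esub>"
  | "word_prod G f (l # w) = (if fst l then f (snd l) else inv\<^bsub>G\<^esub> (f (snd l))) \<otimes>\<^bsub>G\<^esub> word_prod G f w"

lemma presented_group_carrier: "U \<in> carrier (presented_group X R) \<longleftrightarrow> (\<exists>w\<in>gwords X. U = pclass X R w)"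
  by (auto simp: presented_group_def quotient_def)

lemma presented_group_one: "\<one>\<^bsub>presented_group X R\<^esub> = pclass X R []"
  by (simp add: presented_group_def)

lemma pclass_eq_iff:
  "u \<in> gwords X \<Longrightarrow> v \<in> gwords X \<Longrightarrow> pclass X R u = pclass X R v \<longleftrightarrow> (u, v) \<in> pres_cong X R"
  by (rule eq_equiv_class_iff[OF equiv_pres_cong])

lemma pclass_closed: "w \<in> gwords X \<Longrightarrow> pclass X R w \<in> carrier (presented_group X R)"
  by (auto simp: presented_group_carrier)

lemma pres_gen_closed: "x \<in> X \<Longrightarrow> pres_gen X R x \<in> carrier (presented_group X R)"
  unfolding pres_gen_def by (rule pclass_closed) simp

lemma inv_word_gwords [simp]: "inv_word w \<in> gwords X \<longleftrightarrow> w \<in> gwords X"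
  by (induction w) (auto simp: inv_word_def)

lemma inv_inv_word [simp]: "inv_word (inv_word w) = w"
  by (simp add: inv_word_def rev_map o_def apfst_def map_prod_def case_prod_unfold)

lemma inv_word_Nil [simp]: "inv_word [] = []"
  and inv_word_Cons: "inv_word (l # w) = inv_word w @ [inv_letter l]"
  by (simp_all add: inv_word_def)

lemma pclass_inv:
  assumes "w \<in> gwords X"
  shows "inv\<^bsub>presented_group X R\<^esub> (pclass X R w) = pclass X R (inv_word w)"
proof -
  interpret P: group "presented_group X R" by (rule group_presented_group)
  have "pclass X R (inv_word w @ w) = pclass X R []"
    using pclass_eq_iff[of "inv_word w @ w" X "[]"] pres_cong_inverse[OF assms] assms
    by (simp add: inv_word_def[symmetric])
  then have "pclass X R (inv_word w) \<otimes>\<^bsub>presented_group X R\<^esub> pclass X R w = \<one>\<^bsub>presented_group X R\<^esub>"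
    using assms by (simp add: presented_group_mult presented_group_one)
  then show ?thesis using P.inv_equality assms pclass_closed by (metis inv_word_gwords)
qed

context group
begin

lemma word_prod_closed [simp]: "f \<in> X \<rightarrow> carrier G \<Longrightarrow> w \<in> gwords X \<Longrightarrow> word_prod G f w \<in> carrier G"
  by (induction w) (auto simp: Pi_iff)

lemma word_prod_append:
  "f \<in> X \<rightarrow> carrier G \<Longrightarrow> v \<in> gwords X \<Longrightarrow> w \<in> gwords X \<Longrightarrow>
    word_prod G f (v @ w) = word_prod G f v \<otimes> word_prod G f w"
  by (induction v) (auto simp: m_assoc Pi_iff word_prod_closed[of f X])

lemma word_prod_inv:
  "f \<in> X \<rightarrow> carrier G \<Longrightarrow> w \<in> gwords X \<Longrightarrow> word_prod G f (inv_word w) = inv (word_prod G f w)"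
proof (induction w)
  case (Cons l w)
  then have "f (snd l) \<in> carrier G" "word_prod G f w \<in> carrier G" by (auto simp: word_prod_closed[of f X])
  with Cons show ?case
    by (cases l) (auto simp: inv_word_Cons word_prod_append[where X = X] inv_mult_group)
qed simp

lemma word_prod_pres_cong:
  assumes f: "f \<in> X \<rightarrow> carrier G"
    and R: "\<And>r s. (r, s) \<in> R \<Longrightarrow> r \<in> gwords X \<Longrightarrow> s \<in> gwords X \<Longrightarrow> word_prod G f r = word_prod G f s"
    and "(u, v) \<in> pres_cong X R"
  shows "word_prod G f u = word_prod G f v"
  using assms(3)
proof (induction rule: pres_cong.induct)
  case (cancel u v x b)
  then have "f x \<in> carrier G" using f by auto
  then have "word_prod G f ([(b, x), (\<not> b, x)] @ v) = word_prod G f v"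
    using cancel f word_prod_closed[OF f cancel(2)] by (cases b) (auto simp: m_assoc[symmetric])
  then show ?case using cancel f by (simp add: word_prod_append[OF f])
next
  case (rel u v r s)
  then show ?case using R[of r s] by (simp add: word_prod_append[OF f])
qed auto

lemma hom_word_prod:
  assumes "group K" "h \<in> hom G K" "f \<in> X \<rightarrow> carrier G" "w \<in> gwords X"
  shows "h (word_prod G f w) = word_prod K (\<lambda>x. h (f x)) w"
proof -
  interpret hom: group_hom G K h
    using assms(1,2) is_group by (auto simp: group_hom_def group_hom_axioms_def)
  show ?thesis
    using assms(3,4)
  proof (induction w)
    case (Cons l w)
    then have "f (snd l) \<in> carrier G" "word_prod G f w \<in> carrier G"
      by (auto simp: word_prod_closed[of f X])
    with Cons show ?case by auto
  qed simp
qed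

end

lemma word_prod_cong:
  "w \<in> gwords X \<Longrightarrow> (\<And>x. x \<in> X \<Longrightarrow> f x = g x) \<Longrightarrow> word_prod G f w = word_prod G g w"
  by (induction w) auto

lemma word_prod_pres_gen:
  "w \<in> gwords X \<Longrightarrow> word_prod (presented_group X R) (pres_gen X R) w = pclass X R w"
proof (induction w)
  case (Cons l w)
  then show ?case
    by (cases l) (auto simp: pres_gen_def pclass_inv presented_group_mult inv_word_def)
qed (simp add: presented_group_one)

lemma hom_pclass:
  assumes "group G" "h \<in> hom (presented_group X R) G" "w \<in> gwords X"
  shows "h (pclass X R w) = word_prod G (\<lambda>x. h (pres_gen X R x)) w"
proof -
  interpret P: group "presented_group X R" by (rule group_presented_group)
  have "pres_gen X R \<in> X \<rightarrow> carrier (presented_group X R)" by (simp add: pres_gen_closed Pi_iff)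
  from P.hom_word_prod[OF assms(1,2) this assms(3)] show ?thesis
    using assms(3) by (simp add: word_prod_pres_gen)
qed

lemma hom_presented_eqI:
  assumes "group G" "h \<in> hom (presented_group X R) G" "h' \<in> hom (presented_group X R) G"
    "\<And>x. x \<in> X \<Longrightarrow> h (pres_gen X R x) = h' (pres_gen X R x)" "U \<in> carrier (presented_group X R)"
  shows "h U = h' U"
proof -
  obtain w where w: "w \<in> gwords X" "U = pclass X R w" using assms(5) presented_group_carrier by metis
  have "word_prod G (\<lambda>x. h (pres_gen X R x)) w = word_prod G (\<lambda>x. h' (pres_gen X R x)) w"
    using w(1) assms(4) by (rule word_prod_cong)
  then show ?thesis
    using hom_pclass[OF assms(1,2) w(1)] hom_pclass[OF assms(1,3) w(1)] w(2) by simp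
qed

text \<open>The map given by the universal property of the presentation. It is restricted to the
  carrier because members of \<open>auto\<close> must be extensional.\<close>

definition pres_lift ::
  "'x set \<Rightarrow> ('x gword \<times> 'x gword) set \<Rightarrow> ('a, 'm) monoid_scheme \<Rightarrow> ('x \<Rightarrow> 'a) \<Rightarrow> 'x gword set \<Rightarrow> 'a"
  where "pres_lift X R G f = (\<lambda>U \<in> carrier (presented_group X R). word_prod G f (SOME w. w \<in> U))"

lemma (in group) pres_lift_pclass:
  assumes f: "f \<in> X \<rightarrow> carrier G"
    and R: "\<And>r s. (r, s) \<in> R \<Longrightarrow> r \<in> gwords X \<Longrightarrow> s \<in> gwords X \<Longrightarrow> word_prod G f r = word_prod G f s"
    and w: "w \<in> gwords X"
  shows "pres_lift X R G f (pclass X R w) = word_prod G f w"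
proof -
  have "(SOME v. v \<in> pclass X R w) \<in> pclass X R w"
    by (rule someI[of _ w]) (use w in \<open>auto intro: pres_cong.refl\<close>)
  then have "word_prod G f w = word_prod G f (SOME v. v \<in> pclass X R w)"
    using word_prod_pres_cong[OF f R] by auto
  then show ?thesis using pclass_closed[OF w] by (simp add: pres_lift_def)
qed

lemma (in group) pres_lift_hom:
  assumes f: "f \<in> X \<rightarrow> carrier G"
    and R: "\<And>r s. (r, s) \<in> R \<Longrightarrow> r \<in> gwords X \<Longrightarrow> s \<in> gwords X \<Longrightarrow> word_prod G f r = word_prod G f s"
  shows "pres_lift X R G f \<in> hom (presented_group X R) G"
proof (rule homI)
  note l = pres_lift_pclass[OF f R]
  fix U assume "U \<in> carrier (presented_group X R)"
  then show "pres_lift X R G f U \<in> carrier G"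
    using l word_prod_closed[OF f] unfolding presented_group_carrier by auto
  fix V assume "V \<in> carrier (presented_group X R)"
  then show "pres_lift X R G f (U \<otimes>\<^bsub>presented_group X R\<^esub> V) = pres_lift X R G f U \<otimes> pres_lift X R G f V"
    using \<open>U \<in> _\<close> l word_prod_append[OF f] unfolding presented_group_carrier
    by (auto simp: presented_group_mult)
qed

subsection \<open>Reduced words\<close>

definition reduced :: "'x gword \<Rightarrow> bool"
  where "reduced = successively (\<lambda>l l'. l' \<noteq> inv_letter l)"

fun reduce_Cons :: "bool \<times> 'x \<Rightarrow> 'x gword \<Rightarrow> 'x gword"
  where "reduce_Cons l [] = [l]"
  | "reduce_Cons l (l' # w) = (if l' = inv_letter l then w else l # l' # w)"

definition reduce :: "'x gword \<Rightarrow> 'x gword"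
  where "reduce w = foldr reduce_Cons w []"

lemma inv_inv_letter [simp]: "inv_letter (inv_letter l) = l"
  by (cases l) simp

lemma reduced_Nil [simp]: "reduced []"
  and reduced_single [simp]: "reduced [l]"
  and reduced_Cons2 [simp]: "reduced (l # l' # w) \<longleftrightarrow> l' \<noteq> inv_letter l \<and> reduced (l' # w)"
  by (auto simp: reduced_def)

lemma reduced_append:
  "reduced (v @ w) \<longleftrightarrow> reduced v \<and> reduced w \<and> (v = [] \<or> w = [] \<or> hd w \<noteq> inv_letter (last v))"
  by (auto simp: reduced_def successively_append_iff)

lemma reduced_inv_word: "reduced (inv_word w) \<longleftrightarrow> reduced w"
proof -
  have "reduced (inv_word w)" if "reduced w" for w :: "'x gword"
    using that
  proof (induction w rule: induct_list012)
    case (3 l l' w)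
    then have "reduced (inv_word (l' # w))" "l' \<noteq> inv_letter l" by auto
    then show ?case by (auto simp: inv_word_Cons reduced_append)
  qed (auto simp: inv_word_Cons)
  then show ?thesis using inv_inv_word by metis
qed

lemma reduced_reduce_Cons: "reduced w \<Longrightarrow> reduced (reduce_Cons l w)"
  by (cases w; cases "tl w") auto

text \<open>Van der Waerden's device: on reduced words, prepending a letter is undone by prepending
  its inverse. Hence \<open>reduce\<close> does not see free cancellation, and reduced forms are
  unique without a confluence argument.\<close>

lemma reduce_Cons_cancel: "reduced w \<Longrightarrow> reduce_Cons l (reduce_Cons (inv_letter l) w) = w"
  by (cases w; cases "tl w") auto

lemma reduced_foldr: "reduced w \<Longrightarrow> reduced (foldr reduce_Cons v w)"
  by (induction v) (auto simp: reduced_reduce_Cons)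

lemma reduced_reduce: "reduced (reduce w)"
  unfolding reduce_def by (rule reduced_foldr) simp

lemma reduce_reduced: "reduced w \<Longrightarrow> reduce w = w"
  by (induction w rule: induct_list012) (auto simp: reduce_def)

lemma reduce_gwords: "w \<in> gwords X \<Longrightarrow> reduce w \<in> gwords X"
proof (induction w)
  case (Cons l w)
  then show ?case by (cases "reduce w") (auto simp: reduce_def)
qed (simp add: reduce_def)

lemma reduce_pres_cong: "w \<in> gwords X \<Longrightarrow> (w, reduce w) \<in> pres_cong X R"
proof (induction w)
  case Nil
  then show ?case by (auto simp: reduce_def intro: pres_cong.refl)
next
  case (Cons l w)
  then have "(w, reduce w) \<in> pres_cong X R" by simp
  then have 1: "([l] @ w @ [], [l] @ reduce w @ []) \<in> pres_cong X R"
    using Cons by (intro pres_cong_context) auto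
  have "([l] @ reduce w, reduce_Cons l (reduce w)) \<in> pres_cong X R"
  proof (cases "\<exists>v. reduce w = inv_letter l # v")
    case True
    then obtain v where v: "reduce w = inv_letter l # v" by blast
    obtain b x where l: "l = (b, x)" by (cases l)
    have "([] @ [(b, x), (\<not> b, x)] @ v, [] @ v) \<in> pres_cong X R"
      using Cons.prems reduce_gwords[of w X] v l by (intro pres_cong.cancel) auto
    then show ?thesis using v l by simp
  next
    case False
    then have "reduce_Cons l (reduce w) = l # reduce w" by (cases "reduce w") auto
    then show ?thesis using Cons.prems reduce_gwords[of w X] by (auto intro: pres_cong.refl)
  qed
  with 1 show ?case by (auto simp: reduce_def intro: pres_cong.trans)
qed

lemma pres_cong_reduce: "(u, v) \<in> pres_cong X {} \<Longrightarrow> reduce u = reduce v"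
proof (induction rule: pres_cong.induct)
  case (cancel u v x b)
  have "foldr reduce_Cons [(b, x), (\<not> b, x)] (reduce v) = reduce v"
    using reduce_Cons_cancel[OF reduced_reduce[of v], of "(b, x)"] by simp
  then show ?case by (simp add: reduce_def)
qed auto

lemma free_class_eq_iff:
  "u \<in> gwords X \<Longrightarrow> v \<in> gwords X \<Longrightarrow> pclass X {} u = pclass X {} v \<longleftrightarrow> reduce u = reduce v"
  unfolding pclass_eq_iff
  by (metis pres_cong_reduce reduce_pres_cong pres_cong.sym pres_cong.trans)

subsection \<open>Free families\<close>

text \<open>Expresses that \<open>f\<close> is a basis of the subgroup it generates without forming
  that subgroup. The index set is a whole type, so pairs are indexed by \<open>bool\<close>.\<close>

definition free_family :: "('a, 'm) monoid_scheme \<Rightarrow> ('i \<Rightarrow> 'a) \<Rightarrow> bool"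
  where "free_family G f \<longleftrightarrow>
    range f \<subseteq> carrier G \<and> (\<forall>w. reduced w \<longrightarrow> w \<noteq> [] \<longrightarrow> word_prod G f w \<noteq> \<one>\<^bsub>G\<^esub>)"

primrec subst_word :: "('i \<Rightarrow> 'x gword) \<Rightarrow> 'i gword \<Rightarrow> 'x gword"
  where "subst_word \<sigma> [] = []"
  | "subst_word \<sigma> (l # w) = (if fst l then \<sigma> (snd l) else inv_word (\<sigma> (snd l))) @ subst_word \<sigma> w"

lemma subst_word_gwords: "range \<sigma> \<subseteq> gwords X \<Longrightarrow> subst_word \<sigma> w \<in> gwords X"
  by (induction w) auto

lemma (in group) word_prod_subst:
  assumes "f \<in> X \<rightarrow> carrier G" "range \<sigma> \<subseteq> gwords X"
  shows "word_prod G f (subst_word \<sigma> w) = word_prod G (\<lambda>i. word_prod G f (\<sigma> i)) w"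
proof (induction w)
  case (Cons l w)
  have "\<sigma> (snd l) \<in> gwords X" using assms by auto
  then show ?case
    using Cons assms subst_word_gwords[OF assms(2)] by (auto simp: word_prod_append word_prod_inv)
qed simp

text \<open>The blocks themselves are reduced, so cancellation could only occur at the seams between
  consecutive blocks; \<open>ends\<close> excludes it there.\<close>

lemma reduced_subst_word:
  fixes \<sigma> :: "'i \<Rightarrow> 'x gword"
  defines "\<tau> \<equiv> \<lambda>l. if fst l then \<sigma> (snd l) else inv_word (\<sigma> (snd l))"
  assumes ne: "\<And>i. \<sigma> i \<noteq> []" and red: "\<And>i. reduced (\<sigma> i)"
    and ends: "\<And>l l'. l' \<noteq> inv_letter l \<Longrightarrow> hd (\<tau> l') \<noteq> inv_letter (last (\<tau> l))"
  shows "reduced w \<Longrightarrow> reduced (subst_word \<sigma> w)"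
proof (induction w rule: induct_list012)
  case (3 l l' w)
  have \<tau>: "\<tau> l \<noteq> []" "reduced (\<tau> l)" for l
    using ne[of "snd l"] red unfolding \<tau>_def by (simp_all add: reduced_inv_word, simp add: inv_word_def)
  have s: "subst_word \<sigma> (l # w) = \<tau> l @ subst_word \<sigma> w" for l w by (simp add: \<tau>_def)
  have "hd (subst_word \<sigma> (l' # w)) = hd (\<tau> l')" using \<tau>(1)[of l'] unfolding s by simp
  moreover have "reduced (subst_word \<sigma> (l' # w))" using 3 by simp
  moreover have "hd (\<tau> l') \<noteq> inv_letter (last (\<tau> l))" using 3(3) by (intro ends) simp
  ultimately show ?case using \<tau>[of l] unfolding s[of l] reduced_append by simp
qed (use red in \<open>auto simp: reduced_inv_word\<close>)

lemma subst_word_eq_Nil: "(\<And>i. \<sigma> i \<noteq> []) \<Longrightarrow> subst_word \<sigma> w = [] \<longleftrightarrow> w = []"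
  by (cases w) (auto simp: inv_word_def)

lemma (in group) free_family_subst:
  assumes "free_family G f" "\<And>i. \<sigma> i \<noteq> []" "\<And>w. reduced w \<Longrightarrow> reduced (subst_word \<sigma> w)"
  shows "free_family G (\<lambda>i. word_prod G f (\<sigma> i))"
proof -
  have f: "f \<in> UNIV \<rightarrow> carrier G" using assms(1) unfolding free_family_def by auto
  have U: "range \<sigma> \<subseteq> gwords UNIV" by (auto simp: gwords_def)
  show ?thesis
    using assms word_prod_closed[OF f] U subst_word_eq_Nil[of \<sigma>]
    unfolding free_family_def word_prod_subst[OF f U, symmetric] by auto
qed

text \<open>Each letter becomes a block of copies of itself, which begins and ends with that letter,
  so a seam cancels only where the original letters did.\<close>

lemma (in group) free_family_pow:
  assumes "free_family G f" "(m::nat) > 0"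
  shows "free_family G (\<lambda>i. f i [^] m)"
proof -
  define \<sigma> where "\<sigma> = (\<lambda>i::'c. replicate m (True, i))"
  have f: "f \<in> UNIV \<rightarrow> carrier G" using assms(1) unfolding free_family_def by auto
  have "word_prod G f (\<sigma> i) = f i [^] m" for i
  proof -
    have fi: "f i \<in> carrier G" using f by auto
    show ?thesis
      unfolding \<sigma>_def
    proof (induction m)
      case (Suc m)
      then show ?case using nat_pow_Suc2[OF fi, of m] by simp
    qed simp
  qed
  moreover have "free_family G (\<lambda>i. word_prod G f (\<sigma> i))"
  proof (rule free_family_subst[OF assms(1)])
    show "\<sigma> i \<noteq> []" for i using assms(2) by (simp add: \<sigma>_def)
    have \<sigma>: "(if fst l then \<sigma> (snd l) else inv_word (\<sigma> (snd l))) = replicate m l" for l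
      by (cases l) (simp add: \<sigma>_def inv_word_def)
    have ends: "hd (replicate m l) = l" "last (replicate m l) = l" for l :: "bool \<times> 'c"
      using assms(2) by (simp_all add: hd_replicate last_replicate)
    fix w :: "'c gword" assume w: "reduced w"
    show "reduced (subst_word \<sigma> w)"
    proof (rule reduced_subst_word[OF _ _ _ w])
      show "reduced (\<sigma> i)" for i
        unfolding \<sigma>_def by (induction m rule: induct_nat_012) auto
      show "\<sigma> i \<noteq> []" for i using assms(2) by (simp add: \<sigma>_def)
      fix l l' :: "bool \<times> 'c" assume "l' \<noteq> inv_letter l"
      then show "hd (if fst l' then \<sigma> (snd l') else inv_word (\<sigma> (snd l'))) \<noteq>
        inv_letter (last (if fst l then \<sigma> (snd l) else inv_word (\<sigma> (snd l))))"
        unfolding \<sigma> ends .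
    qed
  qed
  ultimately show ?thesis by simp
qed

definition pair :: "'a \<Rightarrow> 'a \<Rightarrow> bool \<Rightarrow> 'a"
  where "pair u v b = (if b then u else v)"

text \<open>The words \<open>[x, y]\<close> and \<open>[x\<inverse>, y\<inverse>]\<close> and their inverses begin with the four different letters
  and end with the four different letters, so that nothing cancels in their products.\<close>

lemma (in group) free_family_commutators:
  assumes "free_family G (pair u v)"
  shows "free_family G (pair (u \<otimes> v \<otimes> inv u \<otimes> inv v) (inv u \<otimes> inv v \<otimes> u \<otimes> v))"
proof -
  define \<sigma> where "\<sigma> b = (if b then [(True, True), (True, False), (False, True), (False, False)]
    else [(False, True), (False, False), (True, True), (True, False)])" for b
  have uv: "u \<in> carrier G" "v \<in> carrier G"
    using assms unfolding free_family_def pair_def by (auto simp: image_def split: if_splits)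
  have "free_family G (\<lambda>b. word_prod G (pair u v) (\<sigma> b))"
  proof (rule free_family_subst[OF assms])
    show "\<sigma> b \<noteq> []" for b by (simp add: \<sigma>_def)
    fix w :: "bool gword" assume w: "reduced w"
    show "reduced (subst_word \<sigma> w)"
    proof (rule reduced_subst_word[OF _ _ _ w])
      fix l l' :: "bool \<times> bool" assume "l' \<noteq> inv_letter l"
      then show "hd (if fst l' then \<sigma> (snd l') else inv_word (\<sigma> (snd l'))) \<noteq>
        inv_letter (last (if fst l then \<sigma> (snd l) else inv_word (\<sigma> (snd l))))"
        by (cases l; cases l') (auto simp: \<sigma>_def inv_word_def)
    qed (auto simp: \<sigma>_def)
  qed
  moreover have "(\<lambda>b. word_prod G (pair u v) (\<sigma> b)) =
    pair (u \<otimes> v \<otimes> inv u \<otimes> inv v) (inv u \<otimes> inv v \<otimes> u \<otimes> v)"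
    using uv by (auto simp: fun_eq_iff pair_def \<sigma>_def m_assoc)
  ultimately show ?thesis by simp
qed

lemma (in group) free_family_hom:
  assumes "group K" "h \<in> hom G K" "inj_on h (carrier G)" "free_family G f"
  shows "free_family K (\<lambda>i. h (f i))"
proof -
  interpret hom: group_hom G K h
    using assms(1,2) is_group by (auto simp: group_hom_def group_hom_axioms_def)
  have f: "f \<in> UNIV \<rightarrow> carrier G" using assms(4) unfolding free_family_def by auto
  have "word_prod K (\<lambda>i. h (f i)) w = h (word_prod G f w)" for w
    using hom_word_prod[OF assms(1,2) f, of w] by (simp add: gwords_def)
  moreover have "h g = \<one>\<^bsub>K\<^esub> \<longleftrightarrow> g = \<one>" if "g \<in> carrier G" for g
    using assms(3) that by (metis hom.hom_one inj_onD one_closed)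
  ultimately show ?thesis
    using assms(4) f word_prod_closed[OF f] unfolding free_family_def by (auto simp: gwords_def)
qed

section \<open>Bass--Serre trees\<close>

context edge_transitive_tree
begin

lemma gdist_base: "gdist p q = 1" "gdist q p = 1"
proof -
  have "(p, q) \<in> edge_rel" "(q, p) \<in> edge_rel"
    unfolding edge_rel_def using base act_one one_closed by (metis (mono_tags, lifting) UnCI mem_Collect_eq)+
  then show "gdist p q = 1" "gdist q p = 1" using edge_gdist by blast+
qed

lemma gdist_eq_2:
  assumes "x \<in> V" "y \<in> V" "z \<in> V" "gdist x y = 1" "gdist y z = 1" "x \<noteq> z"
  shows "gdist x z = 2"
proof -
  have "even (gdist x y + gdist y z + gdist x z)" using assms by (intro d_parity)
  moreover have "gdist x z \<le> gdist x y + gdist y z" using assms by (intro gdist_triangle)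
  moreover have "gdist x z \<noteq> 0" using assms d_eq_0 by blast
  ultimately show ?thesis using assms(4,5) by (auto elim!: evenE)
qed

text \<open>The path \<open>p\<close>, \<open>q1\<close>, \<open>p2\<close>, \<open>q3\<close>,
  \<open>p4\<close> does not backtrack: at \<open>q1\<close> because \<open>b\<close> moves
  \<open>p\<close>, and at \<open>p2\<close> because \<open>a\<close> moves \<open>q\<close>; the
  turn at \<open>q3\<close> is a translate of that at \<open>q1\<close>. So
  \<open>a \<otimes> b\<close> translates by 2.\<close>

lemma axial_mult:
  assumes a: "a \<in> carrier G" "act a p = p" "a \<notin> C" and b: "b \<in> carrier G" "act b q = q" "b \<notin> C"
  shows "axial (a \<otimes> b) p"
proof -
  let ?ab = "a \<otimes> b"
  define q1 where "q1 = act a q"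
  define p2 where "p2 = act ?ab p"
  define q3 where "q3 = act ?ab q1"
  define p4 where "p4 = act ?ab p2"
  have ab: "?ab \<in> carrier G" using a b by simp
  have V: "q1 \<in> V" "p2 \<in> V" "q3 \<in> V" "p4 \<in> V"
    unfolding q1_def p2_def q3_def p4_def using a b ab base act_closed by auto
  have ne: "q1 \<noteq> q" "act b p \<noteq> p"
    using separates[OF a(1)] separates[OF b(1)] a b base q_in unfolding q1_def by auto
  have abq: "act ?ab q = q1" unfolding q1_def using a b base by (simp add: act_mult)
  have p2: "p2 = act a (act b p)" unfolding p2_def using a b base by (simp add: act_mult)
  have "p \<noteq> p2" using ne(2) a b base p2 act_closed by (metis act_inv_act)
  moreover have "gdist p q1 = 1" unfolding q1_def
    using act_isometry[OF a(1) base(1,2)] gdist_base a(2) by simp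
  moreover have "gdist q1 p2 = 1"
    using act_isometry[OF ab base(2,1)] gdist_base unfolding abq p2_def by simp
  ultimately have d1: "gdist p q1 = 1" "gdist q1 p2 = 1" "gdist p p2 = 2"
    using gdist_eq_2[OF base(1) V(1,2)] by auto
  have d2: "gdist p2 q3 = 1" "gdist q3 p4 = 1" "gdist p2 p4 = 2"
    using act_isometry[OF ab base(1) V(1)] act_isometry[OF ab V(1,2)] act_isometry[OF ab base(1) V(2)] d1
    unfolding p2_def[symmetric] q3_def[symmetric] p4_def[symmetric] by auto
  have "q1 \<noteq> q3" using ne(1) abq V base ab unfolding q3_def by (metis act_inv_act)
  then have "gdist q1 q3 = 2" using gdist_eq_2 V d1 d2 by blast
  then have "gdist p q3 = gdist p q1 + gdist q1 p2 + gdist p2 q3"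
    using d1 d2 V base by (intro geodesic_concat) auto
  then have "gdist p p4 = gdist p p2 + gdist p2 q3 + gdist q3 p4"
    using d1 d2 V base d_eq_0[of p2 q3] by (intro geodesic_concat) auto
  then show ?thesis
    using d1 d2 \<open>p \<noteq> p2\<close> unfolding axial_def p2_def p4_def by auto
qed

text \<open>If \<open>act t p\<close> were \<open>q\<close>, then \<open>t\<close> would flip the
  base edge. The flipped edge straddles \<open>H\<close>, so \<open>t\<close> would lie in
  \<open>C\<close> and fix \<open>p\<close>. Hence the path from \<open>q\<close> over
  \<open>p\<close> to \<open>act t p\<close> does not backtrack, and \<open>t\<close> translates by
  1.\<close>

lemma axial_stable_letter:
  assumes t: "t \<in> carrier G" "act t q = p"
  shows "axial t p"
proof -
  have "p \<noteq> q" using base q_in by auto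
  have V: "act t p \<in> V" "act t (act t p) \<in> V" using t base act_closed by auto
  have ne: "act t p \<noteq> p" using \<open>p \<noteq> q\<close> t base by (metis act_inv_act)
  have "act t p \<noteq> q"
  proof
    assume "act t p = q"
    then have "t \<in> C" using separates[OF t(1)] t(2) base q_in by simp
    then show False using C_fixes(1) ne by blast
  qed
  then have "act t (act t p) \<noteq> p" using t V base by (metis act_inv_act)
  moreover have 1: "gdist p (act t p) = 1"
    using act_isometry[OF t(1) base(2,1)] gdist_base t by simp
  moreover have "gdist (act t p) (act t (act t p)) = 1"
    using act_isometry[OF t(1) base(1) V(1)] 1 by simp
  ultimately have "gdist p (act t (act t p)) = 2" using gdist_eq_2[OF base(1) V] by auto
  then show ?thesis using 1 ne unfolding axial_def by simp
qed

end

text \<open>The tag separates cosets of \<open>A\<close> from cosets of \<open>B\<close> in an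
  amalgam. HNN trees use the tag \<open>True\<close> only, so that both kinds of splitting share one
  type of vertices.\<close>

definition coset_act :: "('a, 'm) monoid_scheme \<Rightarrow> 'a \<Rightarrow> bool \<times> 'a set \<Rightarrow> bool \<times> 'a set"
  where "coset_act G g x = (fst x, g <#\<^bsub>G\<^esub> snd x)"

context group
begin

lemma lcoset_self: "subgroup A G \<Longrightarrow> g \<in> carrier G \<Longrightarrow> g \<in> g <# A"
  unfolding l_coset_def using subgroup.one_closed[of A G] by force

lemma lcoset_absorb:
  assumes "subgroup A G" "g \<in> carrier G" "a \<in> A"
  shows "(g \<otimes> a) <# A = g <# A"
proof -
  have A: "A \<subseteq> carrier G" "a \<in> carrier G" using assms subgroup.subset by blast+
  have "a <# A = A"
  proof
    show "a <# A \<subseteq> A" using assms subgroup.m_closed unfolding l_coset_def by fastforce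
    show "A \<subseteq> a <# A"
    proof
      fix x assume x: "x \<in> A"
      then have "inv a \<otimes> x \<in> A" using assms by (simp add: subgroup.m_closed subgroup.m_inv_closed)
      moreover have "x = a \<otimes> (inv a \<otimes> x)" using A x by (simp add: m_assoc[symmetric] subset_iff)
      ultimately show "x \<in> a <# A" unfolding l_coset_def by blast
    qed
  qed
  then show ?thesis using lcos_m_assoc[of A g a] assms A by simp
qed

lemma lcoset_eq_iff:
  assumes "subgroup A G" "g \<in> carrier G" "g' \<in> carrier G"
  shows "g <# A = g' <# A \<longleftrightarrow> (\<exists>a\<in>A. g = g' \<otimes> a)"
proof
  assume "g <# A = g' <# A"
  then show "\<exists>a\<in>A. g = g' \<otimes> a" using lcoset_self[OF assms(1,2)] unfolding l_coset_def by auto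
qed (use lcoset_absorb assms in auto)

lemma coset_act_one: "S \<subseteq> carrier G \<Longrightarrow> coset_act G \<one> (b, S) = (b, S)"
  by (simp add: coset_act_def lcos_mult_one)

lemma coset_act_mult:
  "g \<in> carrier G \<Longrightarrow> h \<in> carrier G \<Longrightarrow> S \<subseteq> carrier G \<Longrightarrow>
    coset_act G (g \<otimes> h) (b, S) = coset_act G g (coset_act G h (b, S))"
  by (simp add: coset_act_def lcos_m_assoc)

lemma iso_presented_word:
  assumes "h \<in> iso (presented_group X R) G" "g \<in> carrier G"
  obtains w where "w \<in> gwords X" "g = h (pclass X R w)"
proof -
  have "g \<in> h ` carrier (presented_group X R)"
    using assms by (simp add: iso_def bij_betw_def)
  then obtain U where U: "U \<in> carrier (presented_group X R)" "g = h U" by blast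
  from U(1) obtain w where "w \<in> gwords X" "U = pclass X R w" unfolding presented_group_carrier by blast
  then show thesis using that U(2) by blast
qed

lemma presented_induct:
  assumes h: "h \<in> iso (presented_group X R) G" and g: "g \<in> carrier G"
    and one: "P \<one>"
    and step: "\<And>g l. g \<in> carrier G \<Longrightarrow> P g \<Longrightarrow> snd l \<in> X \<Longrightarrow>
      P (g \<otimes> (if fst l then h (pres_gen X R (snd l)) else inv (h (pres_gen X R (snd l)))))"
  shows "P g"
proof -
  have hom: "h \<in> hom (presented_group X R) G" using h by (simp add: iso_def)
  have val: "(\<lambda>x. h (pres_gen X R x)) \<in> X \<rightarrow> carrier G"
    by (auto intro!: hom_in_carrier[OF hom] pres_gen_closed)
  have "P (word_prod G (\<lambda>x. h (pres_gen X R x)) w)" if "w \<in> gwords X" for w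
    using that
  proof (induction w rule: rev_induct)
    case (snoc l w)
    then have "h (pres_gen X R (snd l)) \<in> carrier G" using val by auto
    then show ?case
      using snoc step[of "word_prod G (\<lambda>x. h (pres_gen X R x)) w" l] val
      by (simp add: word_prod_append[OF val] word_prod_closed[OF val] split: if_splits)
  qed (simp add: one)
  moreover obtain w where "w \<in> gwords X" "g = h (pclass X R w)" using iso_presented_word[OF h g] .
  ultimately show ?thesis using hom_pclass[OF is_group hom] by metis
qed

text \<open>That the graph of cosets is a tree is deduced from the presentation without normal forms: walking
  along a word while recording the side of the base edge on which one is defines a function on
  the group, because both sides of each defining relation have the same effect.\<close>

lemma presented_state_function:
  fixes upd :: "'a \<Rightarrow> bool \<times> 'x \<Rightarrow> 's \<Rightarrow> 's"
  assumes h: "h \<in> iso (presented_group X R) G"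
    and val: "\<And>x. x \<in> X \<Longrightarrow> val x = h (pres_gen X R x)"
  defines "elt \<equiv> \<lambda>l. if fst l then val (snd l) else inv (val (snd l))"
  defines "step \<equiv> \<lambda>(g, s) l. (g \<otimes> elt l, upd g l s)"
  assumes cancel: "\<And>g b x s. g \<in> carrier G \<Longrightarrow> x \<in> X \<Longrightarrow>
      upd (g \<otimes> elt (b, x)) (\<not> b, x) (upd g (b, x) s) = s"
    and rel: "\<And>g r t s. g \<in> carrier G \<Longrightarrow> (r, t) \<in> R \<Longrightarrow> r \<in> gwords X \<Longrightarrow> t \<in> gwords X \<Longrightarrow>
      snd (foldl step (g, s) r) = snd (foldl step (g, s) t)"
  obtains \<sigma> where "\<sigma> \<one> = s0"
    "\<And>g l. g \<in> carrier G \<Longrightarrow> snd l \<in> X \<Longrightarrow> \<sigma> (g \<otimes> elt l) = upd g l (\<sigma> g)"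
proof -
  have hom: "h \<in> hom (presented_group X R) G" using h by (simp add: iso_def)
  have valc: "val \<in> X \<rightarrow> carrier G"
    using val by (auto intro!: hom_in_carrier[OF hom] pres_gen_closed)
  have hw: "h (pclass X R w) = word_prod G val w" if "w \<in> gwords X" for w
  proof -
    have "word_prod G val w = word_prod G (\<lambda>x. h (pres_gen X R x)) w"
      using that val by (rule word_prod_cong)
    then show ?thesis using hom_pclass[OF is_group hom that] by simp
  qed
  have elt: "elt l \<in> carrier G" if "snd l \<in> X" for l
    using valc that unfolding elt_def by auto
  have fst: "fst (foldl step (g, s) w) = g \<otimes> word_prod G val w" if "w \<in> gwords X" "g \<in> carrier G" for g s w
    using that
  proof (induction w arbitrary: g s)
    case (Cons l w)
    then show ?case using elt[of l] word_prod_closed[OF valc, of w]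
      by (simp add: step_def m_assoc) (simp add: elt_def)
  qed simp
  have cong: "foldl step (g, s) u = foldl step (g, s) v"
    if "(u, v) \<in> pres_cong X R" "g \<in> carrier G" for u v g s
    using that
  proof (induction arbitrary: g s rule: pres_cong.induct)
    case (cancel u v x b)
    obtain g' s' where g': "foldl step (g, s) u = (g', s')" by force
    have "g' \<in> carrier G" using fst[OF cancel(1,4), of s] g' cancel word_prod_closed[OF valc] by simp
    then have "foldl step (g', s') [(b, x), (\<not> b, x)] = (g', s')"
      using assms(5)[of g' x b s'] elt[of "(b, x)"] elt[of "(\<not> b, x)"] valc cancel(3)
      by (auto simp: step_def m_assoc) (auto simp: elt_def Pi_iff m_assoc)
    then show ?case using g' by simp
  next
    case (rel u v r t)
    obtain g' s' where g': "foldl step (g, s) u = (g', s')" by force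
    have g'c: "g' \<in> carrier G" using fst[OF rel(1,6), of s] g' rel word_prod_closed[OF valc] by simp
    have "([] @ r @ [], [] @ t @ []) \<in> pres_cong X R" using rel by (intro pres_cong.rel) auto
    then have "word_prod G val r = word_prod G val t"
      using hw[OF rel(4)] hw[OF rel(5)] pclass_eq_iff[OF rel(4,5), of R] by simp
    then have "foldl step (g', s') r = foldl step (g', s') t"
      using fst[OF rel(4) g'c] fst[OF rel(5) g'c] assms(6)[OF g'c rel(3-5)] by (simp add: prod_eq_iff)
    then show ?case using g' by simp
  qed auto
  \<comment> \<open>An arbitrary representing word may define the state of an element, since by
    \<open>cong\<close> the final state depends on the element alone; \<open>run\<close> records
    this.\<close>
  define w where "w = (\<lambda>g. SOME w. w \<in> gwords X \<and> word_prod G val w = g)"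
  have w: "w g \<in> gwords X \<and> word_prod G val (w g) = g" if g: "g \<in> carrier G" for g
  proof -
    obtain v where "v \<in> gwords X" "g = h (pclass X R v)" using iso_presented_word[OF h g] .
    then have "\<exists>w. w \<in> gwords X \<and> word_prod G val w = g" using hw[of v] by auto
    then show ?thesis unfolding w_def by (rule someI_ex)
  qed
  define \<sigma> where "\<sigma> g = snd (foldl step (\<one>, s0) (w g))" for g
  have run: "foldl step (\<one>, s0) v = (word_prod G val v, \<sigma> (word_prod G val v))" if v: "v \<in> gwords X" for v
  proof -
    let ?g = "word_prod G val v"
    have g: "?g \<in> carrier G" using word_prod_closed[OF valc v] .
    have inj: "inj_on h (carrier (presented_group X R))" using h by (simp add: iso_def bij_betw_def)
    have eq: "h (pclass X R v) = h (pclass X R (w ?g))" using hw v w[OF g] by simp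
    have "pclass X R v = pclass X R (w ?g)"
      by (rule inj_onD[OF inj eq]) (use v w[OF g] in \<open>simp_all add: pclass_closed\<close>)
    then have "(v, w ?g) \<in> pres_cong X R" using pclass_eq_iff v w[OF g] by blast
    then show ?thesis
      using cong[of v "w ?g" \<one> s0] fst[OF v one_closed, of s0] g unfolding \<sigma>_def
      by (simp add: prod_eq_iff)
  qed
  show thesis
  proof (rule that[of \<sigma>])
    show "\<sigma> \<one> = s0" using run[of "[]"] by simp
    fix g and l :: "bool \<times> 'x" assume gl: "g \<in> carrier G" "snd l \<in> X"
    have wl: "w g @ [l] \<in> gwords X" using w[OF gl(1)] gl(2) by simp
    have p: "word_prod G val (w g @ [l]) = g \<otimes> elt l"
      using w[OF gl(1)] gl elt[OF gl(2)] word_prod_append[OF valc, of "w g" "[l]"]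
      by (simp add: elt_def split: if_splits)
    have "foldl step (\<one>, s0) (w g @ [l]) = step (g, \<sigma> g) l"
      using run[of "w g"] w[OF gl(1)] by simp
    then show "\<sigma> (g \<otimes> elt l) = upd g l (\<sigma> g)"
      using run[OF wl] unfolding p by (simp add: step_def)
  qed
qed

end

text \<open>What is retained of Bass--Serre theory. The last clause speaks of all positive powers
  because only some power of the element will lie in a given finite index subgroup.\<close>

definition tree_splitting ::
  "('a, 'm) monoid_scheme \<Rightarrow> 'a set \<Rightarrow> 'v set \<Rightarrow> ('v \<Rightarrow> 'v \<Rightarrow> nat) \<Rightarrow> ('a \<Rightarrow> 'v \<Rightarrow> 'v) \<Rightarrow> bool"
  where "tree_splitting G C V d act \<longleftrightarrow> tree_action G V d act \<and> V \<noteq> {} \<and>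
    (\<forall>x\<in>V. \<forall>y\<in>V. d x y = 1 \<longrightarrow> (\<exists>g\<in>carrier G. \<forall>h\<in>carrier G.
      act h x = x \<longrightarrow> act h y = y \<longrightarrow> inv\<^bsub>G\<^esub> g \<otimes>\<^bsub>G\<^esub> h \<otimes>\<^bsub>G\<^esub> g \<in> C)) \<and>
    (\<exists>g\<in>carrier G. \<forall>k>0. \<forall>x\<in>V. act (g [^]\<^bsub>G\<^esub> (k::nat)) x \<noteq> x)"

lemma (in edge_transitive_tree) tree_splittingI:
  assumes "g \<in> carrier G" "axial g p"
  shows "tree_splitting G C V gdist act"
  unfolding tree_splitting_def
  using edge_stabilizer base axial_not_elliptic_pow[OF assms(1) base(1) assms(2)] assms(1) tree_action_axioms
  unfolding elliptic_def by blast

lemma (in group) amalgam_tree: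
  assumes am: "is_amalgamated_product G A B C" and "A \<noteq> carrier G" "B \<noteq> carrier G"
  shows "\<exists>(V :: (bool \<times> 'a set) set) d. tree_splitting G C V d (coset_act G)"
proof -
  define X where "X = amalgam_gens (G\<lparr>carrier := A\<rparr>) (G\<lparr>carrier := B\<rparr>)"
  define R where "R = amalgam_rels (G\<lparr>carrier := A\<rparr>) (G\<lparr>carrier := B\<rparr>) C (\<lambda>c. c) (\<lambda>c. c)"
  obtain h where sub: "subgroup A G" "subgroup B G" "subgroup C G" "C \<subseteq> A" "C \<subseteq> B"
    and h: "h \<in> iso (presented_group X R) G"
    and hA: "\<And>a. a \<in> A \<Longrightarrow> h (pres_gen X R (Inl a)) = a"
    and hB: "\<And>b. b \<in> B \<Longrightarrow> h (pres_gen X R (Inr b)) = b"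
    using am unfolding is_amalgamated_product_def Let_def X_def R_def by blast
  have carr: "A \<subseteq> carrier G" "B \<subseteq> carrier G" "C \<subseteq> carrier G" using sub subgroup.subset by blast+
  have X: "X = Inl ` A \<union> Inr ` B" by (simp add: X_def amalgam_gens_def)
  have ind: "P g" if "g \<in> carrier G" "P \<one>" "\<And>g a. g \<in> carrier G \<Longrightarrow> P g \<Longrightarrow> a \<in> A \<Longrightarrow> P (g \<otimes> a)"
    "\<And>g b. g \<in> carrier G \<Longrightarrow> P g \<Longrightarrow> b \<in> B \<Longrightarrow> P (g \<otimes> b)" for P g
  proof (rule presented_induct[where P = P, OF h that(1,2)])
    fix g and l :: "bool \<times> ('a + 'a)" assume gl: "g \<in> carrier G" "P g" "snd l \<in> X"
    show "P (g \<otimes> (if fst l then h (pres_gen X R (snd l)) else inv (h (pres_gen X R (snd l)))))"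
    proof (cases "snd l")
      case (Inl a)
      then have "a \<in> A" using gl(3) X by auto
      then show ?thesis using Inl hA that(3)[OF gl(1,2)] subgroup.m_inv_closed[OF sub(1)] by simp
    next
      case (Inr b)
      then have "b \<in> B" using gl(3) X by auto
      then show ?thesis using Inr hB that(4)[OF gl(1,2)] subgroup.m_inv_closed[OF sub(2)] by simp
    qed
  qed
  define val where "val = case_sum (\<lambda>a::'a. a) (\<lambda>b. b)"
  let ?elt = "\<lambda>l. if fst l then val (snd l) else inv (val (snd l))"
  \<comment> \<open>Passing from \<open>g\<close> to \<open>g \<otimes> b\<close> with
    \<open>b\<close> in \<open>B\<close> walks from \<open>g <# A\<close> through
    \<open>g <# B\<close> to the next coset of \<open>A\<close>, along the edges of \<open>g\<close>
    and of \<open>g \<otimes> b\<close>. Edges are cosets of \<open>C\<close>, so the side of the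
    base edge changes iff exactly one of these two elements is in \<open>C\<close>. A letter from
    \<open>A\<close> stays at its vertex.\<close>
  define upd where "upd = (\<lambda>g l s. case snd l of Inl _ \<Rightarrow> s | Inr (_::'a) \<Rightarrow> s \<noteq> ((g \<in> C) \<noteq> (g \<otimes> ?elt l \<in> C)))"
  have gC: "g \<otimes> c \<in> C \<longleftrightarrow> g \<in> C" if "g \<in> carrier G" "c \<in> C" for g c
    using that carr sub(3) by (metis subgroup.m_closed subgroup.m_inv_closed inv_solve_right subsetD)
  have valX: "val x \<in> carrier G" "val x = h (pres_gen X R x)" if "x \<in> X" for x
    using that hA hB carr unfolding val_def X by auto
  obtain \<sigma> where \<sigma>1: "\<sigma> \<one> = False"
    and \<sigma>: "\<And>g l. g \<in> carrier G \<Longrightarrow> snd l \<in> X \<Longrightarrow> \<sigma> (g \<otimes> ?elt l) = upd g l (\<sigma> g)"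
  proof (rule presented_state_function[OF h valX(2), of upd False])
    fix g b x s assume "g \<in> carrier G" "x \<in> X"
    then show "upd (g \<otimes> ?elt (b, x)) (\<not> b, x) (upd g (b, x) s) = s"
      using valX(1)[of x] by (cases x; cases b) (auto simp: upd_def m_assoc)
  next
    fix g r t s assume g: "g \<in> carrier G" and rt: "(r, t) \<in> R" "r \<in> gwords X" "t \<in> gwords X"
    let ?step = "\<lambda>(g, s) l. (g \<otimes> ?elt l, upd g l s)"
    from rt(1) consider
      a b where "a \<in> A" "b \<in> A" "r = [(True, Inl a), (True, Inl b)]" "t = [(True, Inl (a \<otimes> b))]"
      | a b where "a \<in> B" "b \<in> B" "r = [(True, Inr a), (True, Inr b)]" "t = [(True, Inr (a \<otimes> b))]"
      | c where "c \<in> C" "r = [(True, Inl c)]" "t = [(True, Inr c)]"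
      unfolding R_def amalgam_rels_def mult_table_def by auto
    then show "snd (foldl ?step (g, s) r) = snd (foldl ?step (g, s) t)"
    proof cases
      case 2
      then have "a \<in> carrier G" "b \<in> carrier G" using carr by auto
      then show ?thesis using 2 g by (auto simp: upd_def val_def m_assoc)
    qed (use gC g in \<open>auto simp: upd_def val_def\<close>)
  qed auto
  have \<sigma>A: "\<sigma> (g \<otimes> a) = \<sigma> g" if "g \<in> carrier G" "a \<in> A" for g a
    using \<sigma>[OF that(1), of "(True, Inl a)"] that(2) by (simp add: X upd_def val_def)
  have \<sigma>B: "\<sigma> (g \<otimes> b) = (\<sigma> g \<noteq> ((g \<in> C) \<noteq> (g \<otimes> b \<in> C)))" if "g \<in> carrier G" "b \<in> B" for g b
    using \<sigma>[OF that(1), of "(True, Inr b)"] that(2) by (simp add: X upd_def val_def)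
  define V where "V = {(True, g <# A) | g. g \<in> carrier G} \<union> {(False, g <# B) | g. g \<in> carrier G}"
  \<comment> \<open>\<open>\<sigma> g\<close> tells whether \<open>g <# A\<close> lies beyond the
    base edge. The edge of \<open>g\<close> leads on to \<open>g <# B\<close>, which accounts for
    the extra flip when \<open>g \<in> C\<close>.\<close>
  define H where "H = {(True, g <# A) | g. g \<in> carrier G \<and> \<sigma> g} \<union>
    {(False, g <# B) | g. g \<in> carrier G \<and> \<sigma> g \<noteq> (g \<in> C)}"
  have HA: "(True, g <# A) \<in> H \<longleftrightarrow> \<sigma> g" if g: "g \<in> carrier G" for g
  proof -
    have "\<sigma> k = \<sigma> g" if k: "k \<in> carrier G" "g <# A = k <# A" for k
    proof -
      obtain a where "a \<in> A" "g = k \<otimes> a" using k lcoset_eq_iff[OF sub(1) g k(1)] by blast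
      then show ?thesis using \<sigma>A k by simp
    qed
    then show ?thesis using g unfolding H_def by blast
  qed
  have HB: "(False, g <# B) \<in> H \<longleftrightarrow> \<sigma> g \<noteq> (g \<in> C)" if g: "g \<in> carrier G" for g
  proof -
    have "(\<sigma> k \<noteq> (k \<in> C)) = (\<sigma> g \<noteq> (g \<in> C))" if k: "k \<in> carrier G" "g <# B = k <# B" for k
    proof -
      obtain b where "b \<in> B" "g = k \<otimes> b" using k lcoset_eq_iff[OF sub(2) g k(1)] by blast
      then show ?thesis using \<sigma>B k by auto
    qed
    then show ?thesis using g unfolding H_def by blast
  qed
  let ?act = "coset_act G" and ?p = "(True, A)" and ?q = "(False, B)"
  have act: "?act g ?p = (True, g <# A)" "?act g ?q = (False, g <# B)" for g
    by (simp_all add: coset_act_def)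
  have abs: "a \<in> A \<Longrightarrow> a <# A = A" "b \<in> B \<Longrightarrow> b <# B = B" for a b
    using lcoset_absorb[OF sub(1) one_closed, of a] lcoset_absorb[OF sub(2) one_closed, of b] carr
    by (auto simp: lcos_mult_one)
  interpret edge_transitive_tree G V ?act ?p ?q H C
  proof unfold_locales
    fix g x assume g: "g \<in> carrier G" and "x \<in> V"
    then obtain k where k: "k \<in> carrier G" "x = (True, k <# A) \<or> x = (False, k <# B)"
      unfolding V_def by blast
    have "?act g x = (True, (g \<otimes> k) <# A) \<or> ?act g x = (False, (g \<otimes> k) <# B)"
      using k g carr by (auto simp: coset_act_def lcos_m_assoc)
    then show "?act g x \<in> V" using g k unfolding V_def by blast
  next
    fix x assume "x \<in> V"
    then obtain k where k: "k \<in> carrier G" "x = (True, k <# A) \<or> x = (False, k <# B)"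
      unfolding V_def by blast
    then have S: "snd x \<subseteq> carrier G" using k carr l_coset_subset_G[of A k] l_coset_subset_G[of B k] by auto
    then show "?act \<one> x = x" using coset_act_one by (cases x) simp
    show "?act (g \<otimes> h) x = ?act g (?act h x)" if "g \<in> carrier G" "h \<in> carrier G" for g h
      using S that coset_act_mult by (cases x) simp
    show "\<exists>g\<in>carrier G. x = ?act g ?p \<or> x = ?act g ?q" using k act by auto
  next
    have "A = \<one> <# A" "B = \<one> <# B" using carr by (simp_all add: lcos_mult_one)
    then show "?p \<in> V" "?q \<in> V" unfolding V_def by blast+
    show "?p \<notin> H" using HA[of \<one>] \<sigma>1 carr by (simp add: lcos_mult_one)
    show "?act c ?p = ?p" "?act c ?q = ?q" if "c \<in> C" for c
      using that sub abs unfolding act by auto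
    show "(?act g ?p \<in> H \<longleftrightarrow> ?act g ?q \<notin> H) \<longleftrightarrow> g \<in> C" if "g \<in> carrier G" for g
      using HA HB that unfolding act by auto
    fix g assume "g \<in> carrier G"
    let ?r = "{(?act h ?p, ?act h ?q) | h. h \<in> carrier G} \<union> {(?act h ?q, ?act h ?p) | h. h \<in> carrier G}"
    show "(?p, ?act g ?p) \<in> ?r\<^sup>*"
    proof (rule ind[OF \<open>g \<in> carrier G\<close>])
      show "(?p, ?act \<one> ?p) \<in> ?r\<^sup>*" using coset_act_one carr by simp
      fix g x assume g: "g \<in> carrier G" "(?p, ?act g ?p) \<in> ?r\<^sup>*"
      show "(?p, ?act (g \<otimes> x) ?p) \<in> ?r\<^sup>*" if "x \<in> A"
        using g that lcoset_absorb[OF sub(1)] unfolding act by simp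
      assume x: "x \<in> B"
      then have gx: "g \<otimes> x \<in> carrier G" using g carr by auto
      have "?act (g \<otimes> x) ?q = ?act g ?q" using g x lcoset_absorb[OF sub(2)] unfolding act by simp
      then have "(?act g ?p, ?act (g \<otimes> x) ?q) \<in> ?r" using g by blast
      moreover have "(?act (g \<otimes> x) ?q, ?act (g \<otimes> x) ?p) \<in> ?r" using gx by blast
      ultimately show "(?p, ?act (g \<otimes> x) ?p) \<in> ?r\<^sup>*" using g(2) by (meson rtrancl.rtrancl_into_rtrancl)
    qed
  qed (use sub(3) in \<open>auto simp: subgroup_def\<close>)
  \<comment> \<open>Otherwise one factor would contain both generating subgroups and be all of
    \<open>G\<close>.\<close>
  have "\<not> A \<subseteq> B"
  proof
    assume "A \<subseteq> B"
    have "g \<in> B" if "g \<in> carrier G" for g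
      by (rule ind[where P = "\<lambda>g. g \<in> B", OF that])
        (use \<open>A \<subseteq> B\<close> subgroup.one_closed[OF sub(2)] subgroup.m_closed[OF sub(2)] in blast)+
    then show False using assms(3) carr by blast
  qed
  moreover have "\<not> B \<subseteq> A"
  proof
    assume "B \<subseteq> A"
    have "g \<in> A" if "g \<in> carrier G" for g
      by (rule ind[where P = "\<lambda>g. g \<in> A", OF that])
        (use \<open>B \<subseteq> A\<close> subgroup.one_closed[OF sub(1)] subgroup.m_closed[OF sub(1)] in blast)+
    then show False using assms(2) carr by blast
  qed
  ultimately obtain a b where ab: "a \<in> A" "a \<notin> C" "b \<in> B" "b \<notin> C" using sub(4,5) by blast
  then have "axial (a \<otimes> b) ?p" using carr abs act by (intro axial_mult) auto
  then show ?thesis using tree_splittingI ab carr by blast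
qed

lemma (in group) hnn_tree:
  assumes hnn: "is_hnn_extension G A C"
  shows "\<exists>(V :: (bool \<times> 'a set) set) d. tree_splitting G C V d (coset_act G)"
proof -
  from hnn obtain \<phi> where \<phi>: "\<phi> \<in> hom (G\<lparr>carrier := C\<rparr>) (G\<lparr>carrier := A\<rparr>)"
    and ex: "\<exists>h\<in>iso (presented_group (hnn_gens (G\<lparr>carrier := A\<rparr>)) (hnn_rels (G\<lparr>carrier := A\<rparr>) C \<phi>)) G.
      \<forall>a\<in>A. h (pres_gen (hnn_gens (G\<lparr>carrier := A\<rparr>)) (hnn_rels (G\<lparr>carrier := A\<rparr>) C \<phi>) (Some a)) = a"
    unfolding is_hnn_extension_def Let_def by blast
  define X where "X = hnn_gens (G\<lparr>carrier := A\<rparr>)"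
  define R where "R = hnn_rels (G\<lparr>carrier := A\<rparr>) C \<phi>"
  have sub: "subgroup A G" "subgroup C G" "C \<subseteq> A" using hnn unfolding is_hnn_extension_def by auto
  from ex obtain h where h: "h \<in> iso (presented_group X R) G"
    and hA: "\<And>a. a \<in> A \<Longrightarrow> h (pres_gen X R (Some a)) = a"
    unfolding X_def R_def by blast
  define t where "t = h (pres_gen X R None)"
  have carr: "A \<subseteq> carrier G" "C \<subseteq> carrier G" using sub subgroup.subset by blast+
  have X: "X = insert None (Some ` A)" by (simp add: X_def hnn_gens_def)
  have \<phi>A: "\<phi> c \<in> A" if "c \<in> C" for c using \<phi> that hom_in_carrier by fastforce
  have t: "t \<in> carrier G"
    unfolding t_def using h by (intro hom_in_carrier[OF _ pres_gen_closed]) (auto simp: iso_def X)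
  have ind: "P g" if "g \<in> carrier G" "P \<one>" "\<And>g a. g \<in> carrier G \<Longrightarrow> P g \<Longrightarrow> a \<in> A \<Longrightarrow> P (g \<otimes> a)"
    "\<And>g. g \<in> carrier G \<Longrightarrow> P g \<Longrightarrow> P (g \<otimes> t)" "\<And>g. g \<in> carrier G \<Longrightarrow> P g \<Longrightarrow> P (g \<otimes> inv t)" for P g
  proof (rule presented_induct[where P = P, OF h that(1,2)])
    fix g and l :: "bool \<times> 'a option" assume gl: "g \<in> carrier G" "P g" "snd l \<in> X"
    show "P (g \<otimes> (if fst l then h (pres_gen X R (snd l)) else inv (h (pres_gen X R (snd l)))))"
    proof (cases "snd l")
      case None
      then show ?thesis using that(4,5)[OF gl(1,2)] unfolding t_def by simp
    next
      case (Some a)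
      then have "a \<in> A" using gl(3) X by auto
      then show ?thesis using Some hA that(3)[OF gl(1,2)] subgroup.m_inv_closed[OF sub(1)] by simp
    qed
  qed
  define val where "val = case_option t (\<lambda>a. a)"
  let ?elt = "\<lambda>l. if fst l then val (snd l) else inv (val (snd l))"
  \<comment> \<open>The edge of an element \<open>k\<close> joins \<open>k <# A\<close> to
    \<open>(k \<otimes> inv t) <# A\<close>. Reading \<open>t\<close> at \<open>g\<close> traverses
    the edge of \<open>g \<otimes> t\<close> backwards, and reading its inverse traverses the edge
    of \<open>g\<close>; the side changes iff the respective element lies in
    \<open>C\<close>.\<close>
  define upd where "upd = (\<lambda>g l s. case snd l of Some (_::'a) \<Rightarrow> s
    | None \<Rightarrow> if fst l then s \<noteq> (g \<otimes> t \<in> C) else s \<noteq> (g \<in> C))"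
  have gC: "g \<otimes> c \<in> C \<longleftrightarrow> g \<in> C" if "g \<in> carrier G" "c \<in> C" for g c
    using that carr sub(2) by (metis subgroup.m_closed subgroup.m_inv_closed inv_solve_right subsetD)
  have valX: "val x \<in> carrier G" "val x = h (pres_gen X R x)" if "x \<in> X" for x
    using that hA carr t unfolding val_def X t_def by auto
  obtain \<sigma> where \<sigma>1: "\<sigma> \<one> = False"
    and \<sigma>: "\<And>g l. g \<in> carrier G \<Longrightarrow> snd l \<in> X \<Longrightarrow> \<sigma> (g \<otimes> ?elt l) = upd g l (\<sigma> g)"
  proof (rule presented_state_function[OF h valX(2), of upd False])
    fix g b x s assume "g \<in> carrier G" "x \<in> X"
    then show "upd (g \<otimes> ?elt (b, x)) (\<not> b, x) (upd g (b, x) s) = s"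
      using t by (cases x; cases b) (auto simp: upd_def val_def m_assoc)
  next
    fix g r t' s assume g: "g \<in> carrier G" and rt: "(r, t') \<in> R" "r \<in> gwords X" "t' \<in> gwords X"
    let ?step = "\<lambda>(g, s) l. (g \<otimes> ?elt l, upd g l s)"
    from rt(1) consider
      a b where "a \<in> A" "b \<in> A" "r = [(True, Some a), (True, Some b)]" "t' = [(True, Some (a \<otimes> b))]"
      | c where "c \<in> C" "r = [(True, None), (True, Some c), (False, None)]" "t' = [(True, Some (\<phi> c))]"
      unfolding R_def hnn_rels_def mult_table_def by auto
    \<comment> \<open>In the relation for the stable letter, the flips at \<open>t\<close> and at
      its inverse cancel: multiplying \<open>g \<otimes> t\<close> by an element of \<open>C\<close>
      does not affect membership in \<open>C\<close>.\<close>
    then show "snd (foldl ?step (g, s) r) = snd (foldl ?step (g, s) t')"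
      by cases (use gC[of "g \<otimes> t"] g t in \<open>auto simp: upd_def val_def\<close>)
  qed auto
  have \<sigma>A: "\<sigma> (g \<otimes> a) = \<sigma> g" if "g \<in> carrier G" "a \<in> A" for g a
    using \<sigma>[OF that(1), of "(True, Some a)"] that(2) by (simp add: X upd_def val_def)
  have \<sigma>t: "\<sigma> (g \<otimes> inv t) = (\<sigma> g \<noteq> (g \<in> C))" if "g \<in> carrier G" for g
    using \<sigma>[OF that(1), of "(False, None)"] by (simp add: X upd_def val_def)
  define V where "V = {(True, g <# A) | g. g \<in> carrier G}"
  define H where "H = {(True, g <# A) | g. g \<in> carrier G \<and> \<sigma> g}"
  have HA: "(True, g <# A) \<in> H \<longleftrightarrow> \<sigma> g" if g: "g \<in> carrier G" for g
  proof -
    have "\<sigma> k = \<sigma> g" if k: "k \<in> carrier G" "g <# A = k <# A" for k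
    proof -
      obtain a where "a \<in> A" "g = k \<otimes> a" using k lcoset_eq_iff[OF sub(1) g k(1)] by blast
      then show ?thesis using \<sigma>A k by simp
    qed
    then show ?thesis using g unfolding H_def by blast
  qed
  let ?act = "coset_act G" and ?p = "(True, A)" and ?q = "(True, inv t <# A)"
  have act: "?act g ?p = (True, g <# A)" "g \<in> carrier G \<Longrightarrow> ?act g ?q = (True, (g \<otimes> inv t) <# A)" for g
    using t carr by (simp_all add: coset_act_def lcos_m_assoc)
  have abs: "a \<in> A \<Longrightarrow> a <# A = A" for a
    using lcoset_absorb[OF sub(1) one_closed, of a] carr by (auto simp: lcos_mult_one)
  have rel: "t \<otimes> c \<otimes> inv t = \<phi> c" if c: "c \<in> C" for c
  proof -
    let ?r = "[(True, None), (True, Some c), (False, None)]" and ?s = "[(True, Some (\<phi> c))]"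
    have cA: "c \<in> A" "\<phi> c \<in> A" using c sub \<phi>A by auto
    have gw: "?r \<in> gwords X" "?s \<in> gwords X" using cA by (auto simp: X)
    have "(?r, ?s) \<in> R" using c unfolding R_def hnn_rels_def by blast
    then have "([] @ ?r @ [], [] @ ?s @ []) \<in> pres_cong X R" using gw by (intro pres_cong.rel) auto
    then have "pclass X R ?r = pclass X R ?s" using pclass_eq_iff[OF gw] by simp
    then have "word_prod G (\<lambda>x. h (pres_gen X R x)) ?r = word_prod G (\<lambda>x. h (pres_gen X R x)) ?s"
      using hom_pclass[OF is_group _ gw(1)] hom_pclass[OF is_group _ gw(2)] h unfolding iso_def by auto
    then show ?thesis using hA cA carr t by (auto simp: t_def[symmetric] m_assoc subset_iff)
  qed
  interpret edge_transitive_tree G V ?act ?p ?q H C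
  proof unfold_locales
    fix g x assume g: "g \<in> carrier G" and "x \<in> V"
    then obtain k where k: "k \<in> carrier G" "x = (True, k <# A)" unfolding V_def by blast
    then have "?act g x = (True, (g \<otimes> k) <# A)"
      using g carr by (auto simp: coset_act_def lcos_m_assoc)
    then show "?act g x \<in> V" using g k unfolding V_def by blast
  next
    fix x assume "x \<in> V"
    then obtain k where k: "k \<in> carrier G" "x = (True, k <# A)" unfolding V_def by blast
    then have S: "snd x \<subseteq> carrier G" using k carr l_coset_subset_G[of A k] by auto
    then show "?act \<one> x = x" using coset_act_one by (cases x) simp
    show "?act (g \<otimes> h) x = ?act g (?act h x)" if "g \<in> carrier G" "h \<in> carrier G" for g h
      using S that coset_act_mult by (cases x) simp
    show "\<exists>g\<in>carrier G. x = ?act g ?p \<or> x = ?act g ?q" using k act by auto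
  next
    have "A = \<one> <# A" using carr by (simp add: lcos_mult_one)
    then show "?p \<in> V" "?q \<in> V" using t unfolding V_def by blast+
    show "?p \<notin> H" using HA[of \<one>] \<sigma>1 carr by (simp add: lcos_mult_one)
    show "?act c ?p = ?p" if "c \<in> C" for c
      using that sub abs unfolding act by auto
    show "?act c ?q = ?q" if "c \<in> C" for c
    proof -
      have c: "c \<in> carrier G" using that carr by auto
      have "c \<otimes> inv t = inv t \<otimes> \<phi> c"
        using rel[OF that, symmetric] c t by (simp add: m_assoc[symmetric])
      then show ?thesis using lcoset_absorb[OF sub(1) inv_closed[OF t] \<phi>A[OF that]] act(2)[OF c] by simp
    qed
    show "(?act g ?p \<in> H \<longleftrightarrow> ?act g ?q \<notin> H) \<longleftrightarrow> g \<in> C" if "g \<in> carrier G" for g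
      using HA \<sigma>t t that by (auto simp: act)
    fix g assume "g \<in> carrier G"
    let ?r = "{(?act h ?p, ?act h ?q) | h. h \<in> carrier G} \<union> {(?act h ?q, ?act h ?p) | h. h \<in> carrier G}"
    show "(?p, ?act g ?p) \<in> ?r\<^sup>*"
    proof (rule ind[OF \<open>g \<in> carrier G\<close>])
      show "(?p, ?act \<one> ?p) \<in> ?r\<^sup>*" using coset_act_one carr by simp
      fix g assume g: "g \<in> carrier G" "(?p, ?act g ?p) \<in> ?r\<^sup>*"
      show "(?p, ?act (g \<otimes> x) ?p) \<in> ?r\<^sup>*" if "x \<in> A" for x
        using g that lcoset_absorb[OF sub(1)] unfolding act by simp
      have "?act (g \<otimes> t) ?q = ?act g ?p" "?act g ?q = ?act (g \<otimes> inv t) ?p"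
        using g t act by (auto simp: m_assoc)
      moreover have "(?act (g \<otimes> t) ?q, ?act (g \<otimes> t) ?p) \<in> ?r" "(?act g ?p, ?act g ?q) \<in> ?r"
        using g t m_closed by blast+
      ultimately show "(?p, ?act (g \<otimes> t) ?p) \<in> ?r\<^sup>*" "(?p, ?act (g \<otimes> inv t) ?p) \<in> ?r\<^sup>*"
        using g(2) by (metis (no_types, lifting) rtrancl.rtrancl_into_rtrancl)+
    qed
  qed (use sub(2) in \<open>auto simp: subgroup_def\<close>)
  have "?act t ?q = ?p" using act(2)[OF t] t carr by (simp add: lcos_mult_one)
  then show ?thesis using tree_splittingI[OF t axial_stable_letter[OF t]] by blast
qed

lemma splitting_tree:
  fixes G :: "('a, 'm) monoid_scheme"
  assumes "group G" "splits_nontrivially_over G C"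
  obtains V :: "(bool \<times> 'a set) set" and d where "tree_splitting G C V d (coset_act G)"
proof -
  have "\<exists>(V :: (bool \<times> 'a set) set) d. tree_splitting G C V d (coset_act G)"
    using assms(2) unfolding splits_nontrivially_over_def
  proof (elim disjE exE conjE)
    fix A B assume "is_amalgamated_product G A B C" "A \<noteq> carrier G" "B \<noteq> carrier G"
    then show ?thesis by (rule group.amalgam_tree[OF assms(1)])
  next
    fix A assume "is_hnn_extension G A C"
    then show ?thesis by (rule group.hnn_tree[OF assms(1)])
  qed
  then show thesis by (elim exE) (rule that)
qed

section \<open>Automorphisms of free groups\<close>

lemma reduced_map:
  assumes "inj f" shows "reduced (map (apsnd f) w) \<longleftrightarrow> reduced w"
proof -
  have "apsnd f l' = inv_letter (apsnd f l) \<longleftrightarrow> l' = inv_letter l" for l l' :: "bool \<times> 'a"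
    using assms by (cases l; cases l') (auto dest: injD)
  then show ?thesis by (simp add: reduced_def successively_map)
qed

lemma word_prod_carrier_update:
  assumes "group G" "subgroup H G" "range f \<subseteq> H"
  shows "word_prod (G\<lparr>carrier := H\<rparr>) f w = word_prod G f w"
proof (induction w)
  case (Cons l w)
  have "f (snd l) \<in> H" using assms(3) by blast
  then show ?case using Cons group.m_inv_consistent[OF assms(1,2)] by simp
qed simp

lemma free_family_carrier_update:
  assumes "group G" "subgroup H G" "range f \<subseteq> H"
  shows "free_family (G\<lparr>carrier := H\<rparr>) f \<longleftrightarrow> free_family G f"
  using assms subgroup.subset[OF assms(2)] word_prod_carrier_update[OF assms] unfolding free_family_def by auto

locale free_automorphisms =
  fixes X :: "'x set"
begin

abbreviation F :: "'x gword set monoid" where "F \<equiv> presented_group X {}"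

abbreviation gen :: "'x \<Rightarrow> 'x gword set" where "gen \<equiv> pres_gen X {}"

abbreviation cls :: "'x gword \<Rightarrow> 'x gword set" where "cls \<equiv> pclass X {}"

sublocale F: group F
  by (rule group_presented_group)

abbreviation Aut :: "('x gword set \<Rightarrow> 'x gword set) monoid" where "Aut \<equiv> AutoGroup F"

sublocale Aut: group Aut
  by (rule F.AutoGroup)

lemma Aut_carrier: "carrier Aut = auto F"
  by (simp add: AutoGroup_def)

lemma aut_hom: "\<alpha> \<in> carrier Aut \<Longrightarrow> \<alpha> \<in> hom F F"
  by (simp add: Aut_carrier auto_def)

lemma aut_closed [simp]: "\<alpha> \<in> carrier Aut \<Longrightarrow> U \<in> carrier F \<Longrightarrow> \<alpha> U \<in> carrier F"
  by (rule hom_in_carrier[OF aut_hom])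

lemma aut_group_hom: "\<alpha> \<in> carrier Aut \<Longrightarrow> group_hom F F \<alpha>"
  using aut_hom F.is_group by (simp add: group_hom_def group_hom_axioms_def)

lemma Aut_mult_apply:
  "\<alpha> \<in> carrier Aut \<Longrightarrow> \<beta> \<in> carrier Aut \<Longrightarrow> U \<in> carrier F \<Longrightarrow> (\<alpha> \<otimes>\<^bsub>Aut\<^esub> \<beta>) U = \<alpha> (\<beta> U)"
  by (simp add: AutoGroup_def auto_def BijGroup_def compose_eq)

lemma Aut_one_apply: "U \<in> carrier F \<Longrightarrow> \<one>\<^bsub>Aut\<^esub> U = U"
  by (simp add: AutoGroup_def BijGroup_def)

lemma gen_closed [simp]: "i \<in> X \<Longrightarrow> gen i \<in> carrier F"
  by (rule pres_gen_closed)

lemma cls_closed [simp]: "w \<in> gwords X \<Longrightarrow> cls w \<in> carrier F"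
  by (rule pclass_closed)

lemma aut_eqI:
  assumes "\<alpha> \<in> carrier Aut" "\<beta> \<in> carrier Aut" "\<And>i. i \<in> X \<Longrightarrow> \<alpha> (gen i) = \<beta> (gen i)"
  shows "\<alpha> = \<beta>"
proof (rule extensionalityI[of _ "carrier F"])
  show "\<alpha> \<in> extensional (carrier F)" "\<beta> \<in> extensional (carrier F)"
    using assms(1,2) by (simp_all add: Aut_carrier auto_def Bij_def)
  show "\<alpha> U = \<beta> U" if "U \<in> carrier F" for U
    using hom_presented_eqI[OF F.is_group aut_hom[OF assms(1)] aut_hom[OF assms(2)] assms(3) that] .
qed

lemma id_on_gens:
  assumes "h \<in> hom F F" "\<And>i. i \<in> X \<Longrightarrow> h (gen i) = gen i" "U \<in> carrier F"
  shows "h U = U"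
proof -
  have "(\<lambda>U. U) \<in> hom F F" by (auto intro: homI)
  from hom_presented_eqI[OF F.is_group assms(1) this assms(2,3)] show ?thesis .
qed

text \<open>Endomorphisms are determined by their values on generators, so it suffices to test both
  composites there.\<close>

lemma autI:
  assumes f: "f \<in> hom F F" "f \<in> extensional (carrier F)" and g: "g \<in> hom F F"
    and inverse: "\<And>i. i \<in> X \<Longrightarrow> f (g (gen i)) = gen i" "\<And>i. i \<in> X \<Longrightarrow> g (f (gen i)) = gen i"
  shows "f \<in> carrier Aut"
proof -
  have comp: "(\<lambda>U. f (g U)) \<in> hom F F" "(\<lambda>U. g (f U)) \<in> hom F F"
    using hom_compose[OF g f(1)] hom_compose[OF f(1) g] by (simp_all add: o_def)
  have "f (g U) = U" "g (f U) = U" if "U \<in> carrier F" for U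
    using id_on_gens[OF comp(1) _ that] id_on_gens[OF comp(2) _ that] inverse by auto
  then have "bij_betw f (carrier F) (carrier F)"
    using f(1) g by (intro bij_betw_byWitness[where f' = g]) (auto intro: hom_in_carrier)
  then show ?thesis using f by (simp add: Aut_carrier auto_def Bij_def)
qed

subsection \<open>Inner automorphisms\<close>

definition inn :: "'x gword set \<Rightarrow> 'x gword set \<Rightarrow> 'x gword set"
  where "inn g = (\<lambda>U \<in> carrier F. g \<otimes>\<^bsub>F\<^esub> U \<otimes>\<^bsub>F\<^esub> inv\<^bsub>F\<^esub> g)"

lemma inn_apply: "U \<in> carrier F \<Longrightarrow> inn g U = g \<otimes>\<^bsub>F\<^esub> U \<otimes>\<^bsub>F\<^esub> inv\<^bsub>F\<^esub> g"
  by (simp add: inn_def)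

lemma conj_mult:
  assumes "g \<in> carrier F" "U \<in> carrier F" "V \<in> carrier F"
  shows "g \<otimes>\<^bsub>F\<^esub> (U \<otimes>\<^bsub>F\<^esub> V) \<otimes>\<^bsub>F\<^esub> inv\<^bsub>F\<^esub> g =
    g \<otimes>\<^bsub>F\<^esub> U \<otimes>\<^bsub>F\<^esub> inv\<^bsub>F\<^esub> g \<otimes>\<^bsub>F\<^esub> (g \<otimes>\<^bsub>F\<^esub> V \<otimes>\<^bsub>F\<^esub> inv\<^bsub>F\<^esub> g)"
proof -
  have "inv\<^bsub>F\<^esub> g \<otimes>\<^bsub>F\<^esub> (g \<otimes>\<^bsub>F\<^esub> W) = W" if "W \<in> carrier F" for W
    using assms(1) that by (simp add: F.m_assoc[symmetric])
  then show ?thesis using assms by (simp add: F.m_assoc)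
qed

lemma inn_hom_F: "g \<in> carrier F \<Longrightarrow> inn g \<in> hom F F"
  by (rule homI) (simp_all add: inn_apply conj_mult)

lemma inn_comp:
  assumes "g \<in> carrier F" "h \<in> carrier F" "U \<in> carrier F"
  shows "inn g (inn h U) = inn (g \<otimes>\<^bsub>F\<^esub> h) U"
  using assms by (simp add: inn_apply F.m_assoc F.inv_mult_group)

lemma inn_closed [simp]: "g \<in> carrier F \<Longrightarrow> inn g \<in> carrier Aut"
  by (rule autI[of _ "inn (inv\<^bsub>F\<^esub> g)"]) (simp_all add: inn_hom_F inn_comp, simp_all add: inn_def)

lemma inn_mult:
  assumes "g \<in> carrier F" "h \<in> carrier F"
  shows "inn (g \<otimes>\<^bsub>F\<^esub> h) = inn g \<otimes>\<^bsub>Aut\<^esub> inn h"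
  by (rule aut_eqI) (use assms in \<open>simp_all add: Aut_mult_apply inn_comp\<close>)

lemma inn_hom: "inn \<in> hom F Aut"
  by (rule homI) (simp_all add: inn_mult)

lemma inn_inv: "g \<in> carrier F \<Longrightarrow> inn (inv\<^bsub>F\<^esub> g) = inv\<^bsub>Aut\<^esub> (inn g)"
  using group_hom.hom_inv[of F Aut inn g] inn_hom F.is_group Aut.is_group
  by (simp add: group_hom_def group_hom_axioms_def)

lemma inn_pow: "g \<in> carrier F \<Longrightarrow> inn (g [^]\<^bsub>F\<^esub> (k::nat)) = inn g [^]\<^bsub>Aut\<^esub> k"
  using group_hom.hom_nat_pow[of F Aut inn g k] inn_hom F.is_group Aut.is_group
  by (simp add: group_hom_def group_hom_axioms_def)

lemma aut_inn:
  assumes \<beta>: "\<beta> \<in> carrier Aut" and g: "g \<in> carrier F"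
  shows "\<beta> \<otimes>\<^bsub>Aut\<^esub> inn g = inn (\<beta> g) \<otimes>\<^bsub>Aut\<^esub> \<beta>"
proof (rule aut_eqI)
  interpret \<beta>: group_hom F F \<beta> using aut_group_hom[OF \<beta>] .
  fix i assume "i \<in> X"
  then show "(\<beta> \<otimes>\<^bsub>Aut\<^esub> inn g) (gen i) = (inn (\<beta> g) \<otimes>\<^bsub>Aut\<^esub> \<beta>) (gen i)"
    using \<beta> g by (simp add: Aut_mult_apply inn_apply)
qed (use \<beta> g in simp_all)

lemma conj_inn:
  assumes "\<beta> \<in> carrier Aut" "g \<in> carrier F"
  shows "\<beta> \<otimes>\<^bsub>Aut\<^esub> inn g \<otimes>\<^bsub>Aut\<^esub> inv\<^bsub>Aut\<^esub> \<beta> = inn (\<beta> g)"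
  using assms by (simp add: aut_inn Aut.m_assoc)

subsection \<open>Conjugating one generator by words in the others\<close>

definition without :: "'x \<Rightarrow> 'x gword set set"
  where "without k = cls ` gwords (X - {k})"

lemma gwords_mono: "w \<in> gwords (X - {k}) \<Longrightarrow> w \<in> gwords X"
  by (auto simp: gwords_def)

lemma without_subgroup: "subgroup (without k) F"
proof (rule F.subgroupI)
  show "without k \<subseteq> carrier F" unfolding without_def by (intro image_subsetI cls_closed gwords_mono)
  have "cls [] \<in> without k" unfolding without_def by (rule imageI) simp
  then show "without k \<noteq> {}" by blast
  show "inv\<^bsub>F\<^esub> U \<in> without k" if U: "U \<in> without k" for U
  proof -
    obtain w where w: "w \<in> gwords (X - {k})" "U = cls w" using U unfolding without_def by blast
    then have "inv\<^bsub>F\<^esub> U = cls (inv_word w)" by (simp add: pclass_inv gwords_mono)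
    then show ?thesis unfolding without_def using w by simp
  qed
  show "U \<otimes>\<^bsub>F\<^esub> V \<in> without k" if UV: "U \<in> without k" "V \<in> without k" for U V
  proof -
    obtain u v where uv: "u \<in> gwords (X - {k})" "U = cls u" "v \<in> gwords (X - {k})" "V = cls v"
      using UV unfolding without_def by blast
    then have "U \<otimes>\<^bsub>F\<^esub> V = cls (u @ v)" by (simp add: presented_group_mult gwords_mono)
    then show ?thesis unfolding without_def using uv by simp
  qed
qed

lemma without_closed: "U \<in> without k \<Longrightarrow> U \<in> carrier F"
  using subgroup.subset[OF without_subgroup] by blast

lemma gen_without: "i \<in> X \<Longrightarrow> i \<noteq> k \<Longrightarrow> gen i \<in> without k"
  unfolding without_def pres_gen_def by (rule imageI) simp

text \<open>The inverse stands on the left so that products of conjugators become products of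
  automorphisms in the same order; with \<open>U\<close> on the left the map would reverse
  products.\<close>

definition conj_gen :: "'x \<Rightarrow> 'x gword set \<Rightarrow> 'x gword set \<Rightarrow> 'x gword set"
  where "conj_gen k U =
    pres_lift X {} F (\<lambda>i. if i = k then inv\<^bsub>F\<^esub> U \<otimes>\<^bsub>F\<^esub> gen k \<otimes>\<^bsub>F\<^esub> U else gen i)"

lemma conj_gen_hom_F:
  assumes "U \<in> without k" shows "conj_gen k U \<in> hom F F"
  unfolding conj_gen_def using without_closed[OF assms] by (intro F.pres_lift_hom) auto

lemma conj_gen_gen:
  assumes "U \<in> without k" "i \<in> X"
  shows "conj_gen k U (gen i) = (if i = k then inv\<^bsub>F\<^esub> U \<otimes>\<^bsub>F\<^esub> gen k \<otimes>\<^bsub>F\<^esub> U else gen i)"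
proof -
  let ?f = "\<lambda>i. if i = k then inv\<^bsub>F\<^esub> U \<otimes>\<^bsub>F\<^esub> gen k \<otimes>\<^bsub>F\<^esub> U else gen i"
  have f: "?f \<in> X \<rightarrow> carrier F" using without_closed[OF assms(1)] by auto
  have "conj_gen k U (cls [(True, i)]) = word_prod F ?f [(True, i)]"
    unfolding conj_gen_def by (rule F.pres_lift_pclass[OF f]) (use assms(2) in auto)
  also have "\<dots> = ?f i" using f assms(2) by (auto simp: Pi_iff)
  finally show ?thesis unfolding pres_gen_def .
qed

lemma conj_gen_without:
  assumes "U \<in> without k" "V \<in> without k"
  shows "conj_gen k U V = V"
proof -
  obtain w where w: "w \<in> gwords (X - {k})" "V = cls w" using assms(2) unfolding without_def by blast
  have "conj_gen k U (cls w) = word_prod F (\<lambda>i. conj_gen k U (gen i)) w"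
    by (rule hom_pclass[OF F.is_group conj_gen_hom_F[OF assms(1)] gwords_mono[OF w(1)]])
  also have "\<dots> = word_prod F gen w"
    using w(1) by (rule word_prod_cong) (use conj_gen_gen[OF assms(1)] in auto)
  also have "\<dots> = cls w" using gwords_mono[OF w(1)] by (rule word_prod_pres_gen)
  finally show ?thesis using w(2) by simp
qed

lemma conj_gen_comp:
  assumes U: "U \<in> without k" "V \<in> without k" and i: "i \<in> X"
  shows "conj_gen k U (conj_gen k V (gen i)) = conj_gen k (U \<otimes>\<^bsub>F\<^esub> V) (gen i)"
proof -
  interpret h: group_hom F F "conj_gen k U"
    using conj_gen_hom_F[OF U(1)] F.is_group by (simp add: group_hom_def group_hom_axioms_def)
  have UV: "U \<otimes>\<^bsub>F\<^esub> V \<in> without k" using without_subgroup U by (rule subgroup.m_closed)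
  show ?thesis
    using U i conj_gen_without[OF U] without_closed[OF U(1)] without_closed[OF U(2)]
    by (cases "i = k") (auto simp: conj_gen_gen UV F.inv_mult_group F.m_assoc)
qed

lemma conj_gen_one: "i \<in> X \<Longrightarrow> conj_gen k \<one>\<^bsub>F\<^esub> (gen i) = gen i"
  using conj_gen_gen[OF subgroup.one_closed[OF without_subgroup], of i k] by (cases "i = k") auto

lemma conj_gen_closed [simp]:
  assumes "U \<in> without k" shows "conj_gen k U \<in> carrier Aut"
proof -
  have inv: "inv\<^bsub>F\<^esub> U \<in> without k" using without_subgroup assms by (rule subgroup.m_inv_closed)
  show ?thesis
    using assms inv without_closed[OF assms]
    by (intro autI[of _ "conj_gen k (inv\<^bsub>F\<^esub> U)"] conj_gen_hom_F)
      (simp_all add: conj_gen_comp conj_gen_one, simp add: conj_gen_def pres_lift_def)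
qed

lemma conj_gen_hom: "conj_gen k \<in> hom (F\<lparr>carrier := without k\<rparr>) Aut"
proof (rule homI)
  fix U V assume "U \<in> carrier (F\<lparr>carrier := without k\<rparr>)" "V \<in> carrier (F\<lparr>carrier := without k\<rparr>)"
  then have UV: "U \<in> without k" "V \<in> without k" by simp_all
  then have "U \<otimes>\<^bsub>F\<^esub> V \<in> without k" using subgroup.m_closed[OF without_subgroup] by blast
  then have "conj_gen k (U \<otimes>\<^bsub>F\<^esub> V) = conj_gen k U \<otimes>\<^bsub>Aut\<^esub> conj_gen k V"
    using UV by (intro aut_eqI) (simp_all add: Aut_mult_apply conj_gen_comp)
  then show "conj_gen k (U \<otimes>\<^bsub>F\<lparr>carrier := without k\<rparr>\<^esub> V) = conj_gen k U \<otimes>\<^bsub>Aut\<^esub> conj_gen k V" by simp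
qed simp

lemma conj_gen_inv: "U \<in> without k \<Longrightarrow> conj_gen k (inv\<^bsub>F\<^esub> U) = inv\<^bsub>Aut\<^esub> (conj_gen k U)"
  using group_hom.hom_inv[of "F\<lparr>carrier := without k\<rparr>" Aut "conj_gen k" U] conj_gen_hom
    F.subgroup_imp_group[OF without_subgroup] Aut.is_group F.m_inv_consistent[OF without_subgroup]
  by (simp add: group_hom_def group_hom_axioms_def)

text \<open>Conjugating \<open>inn V\<close> by an automorphism yields the inner automorphism of the
  image of \<open>V\<close>, and \<open>conj_gen k U\<close> fixes every word lacking x_k. This
  supplies the commuting free pairs.\<close>

lemma conj_gen_inn_commute:
  "U \<in> without k \<Longrightarrow> V \<in> without k \<Longrightarrow>
    conj_gen k U \<otimes>\<^bsub>Aut\<^esub> inn V = inn V \<otimes>\<^bsub>Aut\<^esub> conj_gen k U"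
  using aut_inn[of "conj_gen k U" V] by (simp add: conj_gen_without without_closed)

subsection \<open>Free families of automorphisms\<close>

text \<open>For the reduced word w of \<open>U\<close>, the word w x_k w^-1 is already reduced
  because w does not contain x_k; it is x_k only if w is empty. The injectivity of both
  \<open>inn\<close> and \<open>conj_gen k\<close> on \<open>without k\<close> rests on
  this.\<close>

lemma conj_eq_gen:
  assumes U: "U \<in> without k" and k: "k \<in> X" and eq: "U \<otimes>\<^bsub>F\<^esub> gen k \<otimes>\<^bsub>F\<^esub> inv\<^bsub>F\<^esub> U = gen k"
  shows "U = \<one>\<^bsub>F\<^esub>"
proof -
  obtain w0 where w0: "w0 \<in> gwords (X - {k})" "U = cls w0" using U unfolding without_def by blast
  define w where "w = reduce w0"
  have w: "w \<in> gwords (X - {k})" "w \<in> gwords X" "reduced w" "U = cls w"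
    using w0 reduce_gwords[OF w0(1)] reduced_reduce[of w0] reduce_pres_cong[OF gwords_mono[OF w0(1)], of "{}"]
      pclass_eq_iff[of w0 X w "{}"] gwords_mono unfolding w_def by auto
  have "cls (w @ [(True, k)] @ inv_word w) = cls [(True, k)]"
    using eq w k by (simp add: pres_gen_def pclass_inv presented_group_mult)
  then have "reduce (w @ [(True, k)] @ inv_word w) = reduce [(True, k)]"
    using w k by (subst (asm) free_class_eq_iff) auto
  moreover have "reduced (w @ [(True, k)] @ inv_word w)"
  proof -
    have nk: "snd l \<noteq> k" if "l \<in> set w" for l using w(1) that by (auto simp: gwords_def)
    moreover have "snd l \<noteq> k" if "l \<in> set (inv_word w)" for l
    proof -
      have "l \<in> inv_letter ` set w" using that by (simp add: inv_word_def)
      then obtain l' where "l' \<in> set w" "l = inv_letter l'" by blast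
      then show ?thesis using nk by simp
    qed
    ultimately have "hd (inv_word w) \<noteq> (False, k)" "last w \<noteq> (False, k)" if "w \<noteq> []"
      using that hd_in_set[of "inv_word w"] last_in_set[of w] by (force simp: inv_word_def)+
    then show ?thesis
      using w(3) unfolding reduced_append reduced_inv_word
      by (cases "w = []") (cases "last w", auto)+
  qed
  ultimately have "w @ [(True, k)] @ inv_word w = [(True, k)]" by (simp add: reduce_reduced)
  then have "w = []" by (cases w) auto
  then show ?thesis using w(4) by (simp add: presented_group_one)
qed

lemma free_family_gens:
  assumes "i \<in> X" "j \<in> X" "i \<noteq> j"
  shows "free_family F (pair (gen i) (gen j))"
proof -
  let ?\<iota> = "pair i j"
  have inj: "inj ?\<iota>" using assms(3) by (auto simp: inj_def pair_def)
  have gw: "map (apsnd ?\<iota>) w \<in> gwords X" for w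
    using assms by (induction w) (auto simp: pair_def)
  have eval: "word_prod F (pair (gen i) (gen j)) w = cls (map (apsnd ?\<iota>) w)" for w
  proof -
    have "word_prod F (pair (gen i) (gen j)) w = word_prod F gen (map (apsnd ?\<iota>) w)"
      by (induction w) (auto simp: pair_def)
    then show ?thesis using word_prod_pres_gen[OF gw] by simp
  qed
  have "word_prod F (pair (gen i) (gen j)) w \<noteq> \<one>\<^bsub>F\<^esub>" if w: "reduced w" "w \<noteq> []" for w
  proof
    assume "word_prod F (pair (gen i) (gen j)) w = \<one>\<^bsub>F\<^esub>"
    then have "reduce (map (apsnd ?\<iota>) w) = reduce []"
      using free_class_eq_iff[OF gw[of w], of "[]"] unfolding eval presented_group_one by simp
    moreover have "reduced (map (apsnd ?\<iota>) w)" using reduced_map[OF inj] w(1) by blast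
    ultimately show False using w(2) by (simp add: reduce_reduced)
  qed
  then show ?thesis using assms unfolding free_family_def by (auto simp: pair_def)
qed

lemma free_family_hom_without:
  assumes i: "i \<in> X" "j \<in> X" "i \<noteq> j" "i \<noteq> k" "j \<noteq> k"
    and h: "h \<in> hom (F\<lparr>carrier := without k\<rparr>) Aut"
    and kernel: "\<And>U. U \<in> without k \<Longrightarrow> h U = \<one>\<^bsub>Aut\<^esub> \<Longrightarrow> U = \<one>\<^bsub>F\<^esub>"
  shows "free_family Aut (pair (h (gen i)) (h (gen j)))"
proof -
  let ?W = "F\<lparr>carrier := without k\<rparr>"
  interpret W: group ?W by (rule F.subgroup_imp_group[OF without_subgroup])
  interpret h: group_hom ?W Aut h
    using h W.is_group Aut.is_group by (simp add: group_hom_def group_hom_axioms_def)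
  have "inj_on h (carrier ?W)" unfolding h.inj_on_one_iff using kernel by simp
  moreover have "range (pair (gen i) (gen j)) \<subseteq> without k" using i gen_without by (auto simp: pair_def)
  then have "free_family ?W (pair (gen i) (gen j))"
    using free_family_gens[OF i(1-3)] free_family_carrier_update[OF F.is_group without_subgroup] by blast
  ultimately have "free_family Aut (\<lambda>b. h (pair (gen i) (gen j) b))"
    using W.free_family_hom[OF Aut.is_group h] by blast
  moreover have "(\<lambda>b. h (pair (gen i) (gen j) b)) = pair (h (gen i)) (h (gen j))"
    by (auto simp: pair_def)
  ultimately show ?thesis by simp
qed

text \<open>The third generator detects the kernel: a trivial inner automorphism fixes x_k, so the
  word in the other generators that induces it commutes with x_k.\<close>

lemma free_family_inn:
  assumes "i \<in> X" "j \<in> X" "k \<in> X" "i \<noteq> j" "i \<noteq> k" "j \<noteq> k"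
  shows "free_family Aut (pair (inn (gen i)) (inn (gen j)))"
proof (rule free_family_hom_without[OF assms(1,2,4,5,6)])
  show "inn \<in> hom (F\<lparr>carrier := without k\<rparr>) Aut"
    by (rule homI) (use without_closed in \<open>simp_all add: inn_mult\<close>)
  fix U assume U: "U \<in> without k" "inn U = \<one>\<^bsub>Aut\<^esub>"
  then have "inn U (gen k) = gen k" using Aut_one_apply assms(3) by simp
  then show "U = \<one>\<^bsub>F\<^esub>" using conj_eq_gen[OF U(1) assms(3)] assms(3) by (simp add: inn_apply)
qed

lemma free_family_conj_gen:
  assumes "i \<in> X" "j \<in> X" "k \<in> X" "i \<noteq> j" "i \<noteq> k" "j \<noteq> k"
  shows "free_family Aut (pair (conj_gen k (gen i)) (conj_gen k (gen j)))"
proof (rule free_family_hom_without[OF assms(1,2,4,5,6) conj_gen_hom])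
  fix U assume U: "U \<in> without k" "conj_gen k U = \<one>\<^bsub>Aut\<^esub>"
  have inv: "inv\<^bsub>F\<^esub> U \<in> without k" using without_subgroup U(1) by (rule subgroup.m_inv_closed)
  have "conj_gen k U (gen k) = gen k" using U(2) Aut_one_apply assms(3) by simp
  then have "inv\<^bsub>F\<^esub> U = \<one>\<^bsub>F\<^esub>"
    using conj_eq_gen[OF inv assms(3)] conj_gen_gen[OF U(1) assms(3)] without_closed[OF U(1)] by simp
  then show "U = \<one>\<^bsub>F\<^esub>" using without_closed[OF U(1)] by simp
qed

subsection \<open>Symmetric automorphisms\<close>

definition symmetric :: "('x gword set \<Rightarrow> 'x gword set) set"
  where "symmetric = {\<alpha> \<in> carrier Aut. \<forall>i\<in>X. \<exists>j\<in>X. \<exists>g\<in>carrier F.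
     \<alpha> (gen i) = g \<otimes>\<^bsub>F\<^esub> gen j \<otimes>\<^bsub>F\<^esub> inv\<^bsub>F\<^esub> g \<or>
     \<alpha> (gen i) = g \<otimes>\<^bsub>F\<^esub> inv\<^bsub>F\<^esub> (gen j) \<otimes>\<^bsub>F\<^esub> inv\<^bsub>F\<^esub> g}"

lemma symmetricE:
  assumes "\<alpha> \<in> symmetric" "i \<in> X"
  obtains j g e where "j \<in> X" "g \<in> carrier F" "e = gen j \<or> e = inv\<^bsub>F\<^esub> (gen j)"
    "\<alpha> (gen i) = g \<otimes>\<^bsub>F\<^esub> e \<otimes>\<^bsub>F\<^esub> inv\<^bsub>F\<^esub> g"
proof -
  obtain j g where "j \<in> X" "g \<in> carrier F"
    "\<alpha> (gen i) = g \<otimes>\<^bsub>F\<^esub> gen j \<otimes>\<^bsub>F\<^esub> inv\<^bsub>F\<^esub> g \<or>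
     \<alpha> (gen i) = g \<otimes>\<^bsub>F\<^esub> inv\<^bsub>F\<^esub> (gen j) \<otimes>\<^bsub>F\<^esub> inv\<^bsub>F\<^esub> g"
    using assms unfolding symmetric_def by blast
  then show thesis using that by metis
qed

lemma symmetric_mult:
  assumes "\<alpha> \<in> symmetric" "\<beta> \<in> symmetric"
  shows "\<alpha> \<otimes>\<^bsub>Aut\<^esub> \<beta> \<in> symmetric"
proof -
  have aut: "\<alpha> \<in> carrier Aut" "\<beta> \<in> carrier Aut" using assms unfolding symmetric_def by auto
  interpret \<alpha>: group_hom F F \<alpha> using aut_group_hom[OF aut(1)] .
  have "\<exists>j\<in>X. \<exists>g\<in>carrier F. (\<alpha> \<otimes>\<^bsub>Aut\<^esub> \<beta>) (gen i) = g \<otimes>\<^bsub>F\<^esub> gen j \<otimes>\<^bsub>F\<^esub> inv\<^bsub>F\<^esub> g \<or>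
     (\<alpha> \<otimes>\<^bsub>Aut\<^esub> \<beta>) (gen i) = g \<otimes>\<^bsub>F\<^esub> inv\<^bsub>F\<^esub> (gen j) \<otimes>\<^bsub>F\<^esub> inv\<^bsub>F\<^esub> g" if i: "i \<in> X" for i
  proof -
    obtain j g e where j: "j \<in> X" "g \<in> carrier F" "e = gen j \<or> e = inv\<^bsub>F\<^esub> (gen j)"
      "\<beta> (gen i) = g \<otimes>\<^bsub>F\<^esub> e \<otimes>\<^bsub>F\<^esub> inv\<^bsub>F\<^esub> g" using symmetricE[OF assms(2) i] .
    obtain k h e' where k: "k \<in> X" "h \<in> carrier F" "e' = gen k \<or> e' = inv\<^bsub>F\<^esub> (gen k)"
      "\<alpha> (gen j) = h \<otimes>\<^bsub>F\<^esub> e' \<otimes>\<^bsub>F\<^esub> inv\<^bsub>F\<^esub> h" using symmetricE[OF assms(1) j(1)] .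
    have e: "e \<in> carrier F" "e' \<in> carrier F" using j(1,3) k(1,3) by auto
    have ag: "\<alpha> g \<in> carrier F" using j(2) aut(1) by simp
    have 1: "(\<alpha> \<otimes>\<^bsub>Aut\<^esub> \<beta>) (gen i) = \<alpha> g \<otimes>\<^bsub>F\<^esub> \<alpha> e \<otimes>\<^bsub>F\<^esub> inv\<^bsub>F\<^esub> (\<alpha> g)"
      using j(2,4) e(1) i aut by (simp add: Aut_mult_apply)
    obtain f where f: "f = gen k \<or> f = inv\<^bsub>F\<^esub> (gen k)" "\<alpha> e = h \<otimes>\<^bsub>F\<^esub> f \<otimes>\<^bsub>F\<^esub> inv\<^bsub>F\<^esub> h"
    proof (cases "e = gen j")
      case True
      then show thesis using that[of e'] k(3,4) by simp
    next
      case False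
      then have "\<alpha> e = inv\<^bsub>F\<^esub> (h \<otimes>\<^bsub>F\<^esub> e' \<otimes>\<^bsub>F\<^esub> inv\<^bsub>F\<^esub> h)" using j(1,3) k(4) by simp
      also have "\<dots> = h \<otimes>\<^bsub>F\<^esub> inv\<^bsub>F\<^esub> e' \<otimes>\<^bsub>F\<^esub> inv\<^bsub>F\<^esub> h"
        using k(2) e(2) by (simp add: F.inv_mult_group F.m_assoc)
      finally show thesis using that[of "inv\<^bsub>F\<^esub> e'"] k(1,3) by auto
    qed
    have fc: "f \<in> carrier F" using f(1) k(1) by auto
    have "(\<alpha> \<otimes>\<^bsub>Aut\<^esub> \<beta>) (gen i) = (\<alpha> g \<otimes>\<^bsub>F\<^esub> h) \<otimes>\<^bsub>F\<^esub> f \<otimes>\<^bsub>F\<^esub> inv\<^bsub>F\<^esub> (\<alpha> g \<otimes>\<^bsub>F\<^esub> h)"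
      unfolding 1 f(2) using ag k(2) fc by (simp add: F.inv_mult_group F.m_assoc)
    moreover have "\<alpha> g \<otimes>\<^bsub>F\<^esub> h \<in> carrier F" using ag k(2) by simp
    ultimately show ?thesis using k(1) f(1) by blast
  qed
  then show ?thesis using aut unfolding symmetric_def by simp
qed

lemma symmetric_inn: "g \<in> carrier F \<Longrightarrow> inn g \<in> symmetric"
  unfolding symmetric_def by (auto simp: inn_apply)

lemma symmetric_conj_gen:
  assumes "U \<in> without k" shows "conj_gen k U \<in> symmetric"
proof -
  note U = without_closed[OF assms]
  have "\<exists>g\<in>carrier F. conj_gen k U (gen i) = g \<otimes>\<^bsub>F\<^esub> gen i \<otimes>\<^bsub>F\<^esub> inv\<^bsub>F\<^esub> g" if "i \<in> X" for i
    using conj_gen_gen[OF assms that] U that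
    by (intro bexI[of _ "if i = k then inv\<^bsub>F\<^esub> U else \<one>\<^bsub>F\<^esub>"]) auto
  then show ?thesis using conj_gen_closed[OF assms] unfolding symmetric_def by blast
qed

text \<open>The largest subgroup of \<open>Aut\<close> inside \<open>symmetric\<close>, whose
  definition does not display inverses. All \<open>inn g\<close> and \<open>conj_gen k U\<close>
  belong to it because their inverses have the same form, and powers are taken of such elements and
  their conjugates only.\<close>

definition symmetric_units :: "('x gword set \<Rightarrow> 'x gword set) set"
  where "symmetric_units = {\<alpha> \<in> symmetric. inv\<^bsub>Aut\<^esub> \<alpha> \<in> symmetric}"

lemma symmetric_subset: "symmetric \<subseteq> carrier Aut"
  unfolding symmetric_def by blast

lemma symmetric_units_subgroup: "subgroup symmetric_units Aut"
proof (rule Aut.subgroupI)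
  show "symmetric_units \<subseteq> carrier Aut" unfolding symmetric_units_def symmetric_def by blast
  have "inn \<one>\<^bsub>F\<^esub> \<in> symmetric_units"
    unfolding symmetric_units_def using symmetric_inn[of "\<one>\<^bsub>F\<^esub>"] symmetric_inn[of "inv\<^bsub>F\<^esub> \<one>\<^bsub>F\<^esub>"]
    by (metis (no_types, lifting) F.inv_closed F.one_closed inn_inv mem_Collect_eq)
  then show "symmetric_units \<noteq> {}" by blast
  show "inv\<^bsub>Aut\<^esub> \<alpha> \<in> symmetric_units" if "\<alpha> \<in> symmetric_units" for \<alpha>
  proof -
    have "\<alpha> \<in> carrier Aut" using that symmetric_subset unfolding symmetric_units_def by blast
    then show ?thesis using that unfolding symmetric_units_def by simp
  qed
  show "\<alpha> \<otimes>\<^bsub>Aut\<^esub> \<beta> \<in> symmetric_units" if "\<alpha> \<in> symmetric_units" "\<beta> \<in> symmetric_units" for \<alpha> \<beta>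
  proof -
    have "\<alpha> \<in> carrier Aut" "\<beta> \<in> carrier Aut"
      using that symmetric_subset unfolding symmetric_units_def by blast+
    then show ?thesis
      using that symmetric_mult unfolding symmetric_units_def by (simp add: Aut.inv_mult_group)
  qed
qed

lemma inn_unit:
  assumes "g \<in> carrier F" shows "inn g \<in> symmetric_units"
proof -
  have "inv\<^bsub>Aut\<^esub> (inn g) \<in> symmetric"
    unfolding inn_inv[OF assms, symmetric] by (rule symmetric_inn[OF F.inv_closed[OF assms]])
  then show ?thesis unfolding symmetric_units_def using symmetric_inn[OF assms] by blast
qed

lemma conj_gen_unit:
  assumes "U \<in> without k" shows "conj_gen k U \<in> symmetric_units"
proof -
  have "inv\<^bsub>F\<^esub> U \<in> without k" using without_subgroup assms by (rule subgroup.m_inv_closed)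
  then have "inv\<^bsub>Aut\<^esub> (conj_gen k U) \<in> symmetric"
    unfolding conj_gen_inv[OF assms, symmetric] by (rule symmetric_conj_gen)
  then show ?thesis unfolding symmetric_units_def using symmetric_conj_gen[OF assms] by blast
qed

end

section \<open>Fixed points of commuting free groups\<close>

lemma (in group) free_pair_not_NF:
  assumes free: "free_family G (f :: bool \<Rightarrow> 'a)"
  shows "\<not> NF G"
proof -
  have f: "f \<in> UNIV \<rightarrow> carrier G" "f b \<in> carrier G" for b using free unfolding free_family_def by auto
  have nontriv: "word_prod G f w \<noteq> \<one>" if "reduced w" "w \<noteq> []" for w
    using free that unfolding free_family_def by blast
  have "f True \<otimes> inv (f False) \<noteq> \<one>"
    using nontriv[of "[(True, True), (False, False)]"] f(2) by simp
  then have "f True \<noteq> f False" using f(2)[of False] by auto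
  then have inj: "inj f" by (auto simp: inj_def) (metis (full_types))+
  have ncomm: "f True \<otimes> f False \<noteq> f False \<otimes> f True"
  proof
    assume eq: "f True \<otimes> f False = f False \<otimes> f True"
    have "f True \<otimes> (f False \<otimes> (inv (f True) \<otimes> inv (f False))) = (f True \<otimes> f False) \<otimes> inv (f False \<otimes> f True)"
      using f(2) by (simp add: inv_mult_group m_assoc)
    also have "\<dots> = \<one>" unfolding eq using f(2) by simp
    finally show False
      using nontriv[of "[(True, True), (True, False), (False, True), (False, False)]"] f(2) by simp
  qed
  \<comment> \<open>\<open>is_free_group\<close> asks for a basis within the element type, so the
    members of the family themselves serve as generators and are evaluated by the identity.\<close>
  define X where "X = range f"
  interpret F: group "presented_group X {}" by (rule group_presented_group)
  have id: "(\<lambda>x. x) \<in> X \<rightarrow> carrier G" using f(2) unfolding X_def by auto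
  let ?\<Phi> = "pres_lift X {} G (\<lambda>x. x)"
  have \<Phi>: "?\<Phi> (pclass X {} w) = word_prod G (\<lambda>x. x) w" if "w \<in> gwords X" for w
    using pres_lift_pclass[OF id _ that, of "{}"] by simp
  have \<Phi>hom: "?\<Phi> \<in> hom (presented_group X {}) G" using pres_lift_hom[OF id, of "{}"] by simp
  interpret \<Phi>: group_hom "presented_group X {}" G ?\<Phi>
    using \<Phi>hom F.is_group is_group by (simp add: group_hom_def group_hom_axioms_def)
  have "U = \<one>\<^bsub>presented_group X {}\<^esub>" if U: "U \<in> carrier (presented_group X {})" "?\<Phi> U = \<one>" for U
  proof -
    from U(1) obtain w0 where w0: "w0 \<in> gwords X" "U = pclass X {} w0"
      unfolding presented_group_carrier by blast
    define w where "w = reduce w0"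
    have w: "w \<in> gwords X" "reduced w" "pclass X {} w0 = pclass X {} w"
      using w0 reduce_gwords reduced_reduce reduce_pres_cong[of w0 X "{}"] pclass_eq_iff[of w0 X w "{}"]
      unfolding w_def by auto
    let ?w = "map (apsnd (inv_into UNIV f)) w"
    have "word_prod G f (map (apsnd (inv_into UNIV f)) v) = word_prod G (\<lambda>x. x) v" if "v \<in> gwords X" for v
      using that by (induction v) (auto simp: X_def inj)
    then have "word_prod G f ?w = \<one>" using U(2) \<Phi> w w0 by simp
    moreover have "map (apsnd f) ?w = w"
    proof -
      have "apsnd f (apsnd (inv_into UNIV f) l) = l" if "l \<in> set w" for l
        using w(1) that by (cases l) (auto simp: gwords_def X_def f_inv_into_f)
      then show ?thesis by (simp add: map_idI)
    qed
    then have "reduced ?w" using w(2) reduced_map[OF inj, of ?w] by simp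
    ultimately have "?w = []" using nontriv by blast
    then show ?thesis using w0 w by (simp add: presented_group_one)
  qed
  then have inj\<Phi>: "inj_on ?\<Phi> (carrier (presented_group X {}))" unfolding \<Phi>.inj_on_one_iff by simp
  define H where "H = ?\<Phi> ` carrier (presented_group X {})"
  have H: "subgroup H G" unfolding H_def by (rule \<Phi>.img_is_subgroup)
  have "?\<Phi> \<in> iso (presented_group X {}) (G\<lparr>carrier := H\<rparr>)"
    using inj\<Phi> \<Phi>hom unfolding iso_def bij_betw_def H_def hom_def by auto
  then have "presented_group X {} \<cong> G\<lparr>carrier := H\<rparr>" by (rule is_isoI)
  then have "G\<lparr>carrier := H\<rparr> \<cong> free_group X" unfolding free_group_def by (rule F.iso_sym)
  then have "is_free_group (G\<lparr>carrier := H\<rparr>)" unfolding is_free_group_def by blast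
  moreover have "f b \<in> H" for b
  proof -
    have "[(True, f b)] \<in> gwords X" by (simp add: X_def)
    then have "?\<Phi> (pclass X {} [(True, f b)]) \<in> H" unfolding H_def by (intro imageI pclass_closed)
    then show ?thesis using \<Phi>[OF \<open>[(True, f b)] \<in> gwords X\<close>] f(2) by simp
  qed
  then have "\<not> comm_group (G\<lparr>carrier := H\<rparr>)"
    using ncomm comm_groupE(4)[of "G\<lparr>carrier := H\<rparr>" "f True" "f False"] by auto
  ultimately show ?thesis using H unfolding NF_def by blast
qed

lemma (in group) free_family_conj:
  assumes "free_family G f" "g \<in> carrier G"
  shows "free_family G (\<lambda>i. g \<otimes> f i \<otimes> inv g)"
proof (rule free_family_hom[OF is_group _ _ assms(1), of "\<lambda>x. g \<otimes> x \<otimes> inv g"])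
  have c: "inv g \<otimes> (g \<otimes> x) = x" if "x \<in> carrier G" for x
    using assms(2) that by (simp add: m_assoc[symmetric])
  show "(\<lambda>x. g \<otimes> x \<otimes> inv g) \<in> hom G G"
    by (rule homI) (use assms(2) c in \<open>simp_all add: m_assoc\<close>)
  show "inj_on (\<lambda>x. g \<otimes> x \<otimes> inv g) (carrier G)"
    by (rule inj_onI) (use assms(2) in simp)
qed

lemma pair_apply: "(\<lambda>b. f (pair u v b)) = pair (f u) (f v)"
  by (auto simp: pair_def)

lemma range_pair: "range (pair u v) = {u, v}"
  by (auto simp: pair_def image_def)

text \<open>By the pigeonhole principle two of the powers with exponents from 0 to the number of
  cosets lie in the same coset. Their difference is an exponent dividing the factorial, so one
  exponent works for all \<open>g\<close>. The set \<open>S\<close> only has to contain the powers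
  of \<open>g\<close>, which permits its use for \<open>symmetric\<close>.\<close>

lemma (in group) power_in_finite_index:
  assumes K: "subgroup K G" and fin: "finite ((\<lambda>a. K #> a) ` S)"
    and g: "g \<in> carrier G" "\<And>i::nat. g [^] i \<in> S"
  shows "g [^] (fact (card ((\<lambda>a. K #> a) ` S)) :: nat) \<in> K"
proof -
  let ?c = "card ((\<lambda>a. K #> a) ` S)"
  have "(\<lambda>i. K #> g [^] i) ` {0..?c} \<subseteq> (\<lambda>a. K #> a) ` S" using g(2) by blast
  then have "card ((\<lambda>i. K #> g [^] i) ` {0..?c}) \<le> ?c" using fin card_mono by blast
  then have "\<not> inj_on (\<lambda>i. K #> g [^] i) {0..?c}"
    using card_image[of "\<lambda>i. K #> g [^] i" "{0..?c}"] by auto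
  then obtain i j where ij: "i < j" "j \<le> ?c" "K #> g [^] i = K #> g [^] j"
    unfolding inj_on_def by (metis atLeastAtMost_iff linorder_neqE_nat)
  have "\<one> \<otimes> g [^] j \<in> K #> g [^] j" unfolding r_coset_def using subgroup.one_closed[OF K] by blast
  then have "g [^] j \<in> K #> g [^] i" using ij(3) g(1) by simp
  then obtain h where h: "h \<in> K" "g [^] j = h \<otimes> g [^] i" unfolding r_coset_def by blast
  have "g [^] (j - i) \<otimes> g [^] i = h \<otimes> g [^] i"
    using h(2) ij(1) g(1) by (simp add: nat_pow_mult)
  then have "g [^] (j - i) = h"
    using g(1) h(1) subgroup.subset[OF K] by (metis nat_pow_closed right_cancel subsetD)
  then have gK: "g [^] (j - i) \<in> K" using h(1) by simp
  have "j - i dvd (fact ?c :: nat)" using ij(1,2) by (intro dvd_fact) auto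
  then obtain k where k: "(fact ?c :: nat) = (j - i) * k" by blast
  have "(g [^] (j - i)) [^] l \<in> K" for l :: nat
    by (induction l) (use gK subgroup.one_closed[OF K] subgroup.m_closed[OF K] in auto)
  then show ?thesis unfolding k using g(1) by (simp add: nat_pow_pow)
qed

locale NF_tree_action = tree_action G V d act
  for G :: "('a, 'm) monoid_scheme" (structure) and V :: "'v set" and d act +
  fixes C :: "'a set"
  assumes nonempty: "V \<noteq> {}"
    and C: "subgroup C G" "NF (G\<lparr>carrier := C\<rparr>)"
    and edge_stab: "x \<in> V \<Longrightarrow> y \<in> V \<Longrightarrow> d x y = 1 \<Longrightarrow>
      \<exists>g\<in>carrier G. \<forall>h\<in>carrier G. act h x = x \<longrightarrow> act h y = y \<longrightarrow> inv g \<otimes> h \<otimes> g \<in> C"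
begin

text \<open>With two fixed vertices, the pair would fix the first edge of the geodesic between them,
  and a conjugate of it would be a free pair in the NF group \<open>C\<close>.\<close>

lemma free_pair_fixes_unique:
  assumes free: "free_family G (pair u v)"
    and x: "x \<in> V" "act u x = x" "act v x = x" and y: "y \<in> V" "act u y = y" "act v y = y"
  shows "x = y"
proof (rule ccontr)
  assume "x \<noteq> y"
  then have "1 \<le> d x y" using d_eq_0[of x y] x y by auto
  then obtain z where z: "z \<in> V" "d x z = 1" "1 + d z y = d x y" using geodesic x(1) y(1) by blast
  have uv: "u \<in> carrier G" "v \<in> carrier G" using free unfolding free_family_def range_pair by auto
  have "act u z = z" "act v z = z"
    using act_fixes_geodesic[OF _ x(1) y(1) z(1)] uv x y z by auto
  moreover obtain g where g: "g \<in> carrier G"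
    "\<And>h. h \<in> carrier G \<Longrightarrow> act h x = x \<Longrightarrow> act h z = z \<Longrightarrow> inv g \<otimes> h \<otimes> g \<in> C"
    using edge_stab[OF x(1) z(1,2)] by blast
  ultimately have uvC: "inv g \<otimes> u \<otimes> g \<in> C" "inv g \<otimes> v \<otimes> g \<in> C" using uv x by auto
  have "free_family G (\<lambda>b. inv g \<otimes> pair u v b \<otimes> inv (inv g))"
    by (rule free_family_conj[OF free]) (use g in simp)
  also have "(\<lambda>b. inv g \<otimes> pair u v b \<otimes> inv (inv g)) = pair (inv g \<otimes> u \<otimes> g) (inv g \<otimes> v \<otimes> g)"
    using g(1) by (auto simp: pair_def)
  finally have "free_family (G\<lparr>carrier := C\<rparr>) (pair (inv g \<otimes> u \<otimes> g) (inv g \<otimes> v \<otimes> g))"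
    using free_family_carrier_update[OF is_group C(1)] uvC range_pair by (metis empty_subsetI insert_subset)
  then show False
    using group.free_pair_not_NF[OF subgroup_imp_group[OF C(1)]] C(2) by blast
qed

text \<open>If some element of \<open>\<langle>a, a'\<rangle>\<close> were hyperbolic, then the commutators of the group
  \<open>\<langle>b, b'\<rangle>\<close>, which centralizes it, would fix its axis.\<close>

lemma commuting_free_pairs:
  assumes a: "free_family G (pair a a')" "even_displacement a" "even_displacement a'"
    and b: "free_family G (pair b b')"
    and commute: "\<And>s t. s \<in> {a, a'} \<Longrightarrow> t \<in> {b, b'} \<Longrightarrow> s \<otimes> t = t \<otimes> s"
  shows "\<exists>!x. x \<in> V \<and> act a x = x \<and> act a' x = x"
proof -
  have carr: "a \<in> carrier G" "a' \<in> carrier G" "b \<in> carrier G" "b' \<in> carrier G"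
    using a(1) b unfolding free_family_def range_pair by auto
  have ell: "elliptic g" if g: "g \<in> carrier G" "even_displacement g" "g \<otimes> b = b \<otimes> g" "g \<otimes> b' = b' \<otimes> g" for g
  proof (rule ccontr)
    assume "\<not> elliptic g"
    then obtain x where x: "x \<in> V" "axial g x" using exists_axial[OF g(1,2) _ nonempty] by blast
    have inv: "g \<otimes> inv t = inv t \<otimes> g" if t: "t \<in> carrier G" "g \<otimes> t = t \<otimes> g" for t
    proof -
      have "g \<otimes> inv t = inv t \<otimes> (t \<otimes> g) \<otimes> inv t" using t(1) g(1) by (simp add: m_assoc[symmetric])
      also have "\<dots> = inv t \<otimes> g" unfolding t(2)[symmetric] using t(1) g(1) by (simp add: m_assoc)
      finally show ?thesis .
    qed
    let ?u = "b \<otimes> b' \<otimes> inv b \<otimes> inv b'" and ?v = "inv b \<otimes> inv b' \<otimes> b \<otimes> b'"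
    have fix_uv: "act ?u x = x" "act ?v x = x"
      using commutator_fixes_axis[OF g(1) x carr(3) g(3) carr(4) g(4)]
        commutator_fixes_axis[OF g(1) x inv_closed[OF carr(3)] inv[OF carr(3) g(3)]
          inv_closed[OF carr(4)] inv[OF carr(4) g(4)]] carr by auto
    have gt: "g \<otimes> (s \<otimes> t) = (s \<otimes> t) \<otimes> g"
      if "s \<in> carrier G" "t \<in> carrier G" "g \<otimes> s = s \<otimes> g" "g \<otimes> t = t \<otimes> g" for s t
      using that g(1) by (metis m_assoc)
    have uv: "?u \<in> carrier G" "?v \<in> carrier G" using carr by auto
    have "g \<otimes> ?u = ?u \<otimes> g" "g \<otimes> ?v = ?v \<otimes> g"
      using carr g(3,4) inv[OF carr(3) g(3)] inv[OF carr(4) g(4)] by (intro gt; simp)+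
    then have "act ?u (act g x) = act g x" "act ?v (act g x) = act g x"
      using fix_uv uv g(1) x(1) act_mult by metis+
    \<comment> \<open>Commuting with \<open>g\<close>, the free pair of commutators also fixes the
      translate of \<open>x\<close> by \<open>g\<close>, so uniqueness applies to these two
      vertices.\<close>
    then have "x = act g x"
      using free_pair_fixes_unique[OF free_family_commutators[OF b] x(1) fix_uv] act_closed g(1) x(1) by blast
    then show False using x(2) unfolding axial_def by simp
  qed
  have mult_commute: "(a \<otimes> a') \<otimes> t = t \<otimes> (a \<otimes> a')" if "t \<in> {b, b'}" for t
  proof -
    have "t \<in> carrier G" using that carr by auto
    then show ?thesis using commute[OF _ that] carr(1,2) by (metis insertI1 insertI2 m_assoc singletonI)
  qed
  have "elliptic a" "elliptic a'" using ell a carr commute by auto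
  moreover have "elliptic (a \<otimes> a')"
    using even_displacement_mult[OF carr(1,2) a(2,3)] mult_commute carr by (intro ell) auto
  ultimately obtain x where "x \<in> V" "act a x = x" "act a' x = x"
    using common_fixed_point carr by blast
  then show ?thesis using free_pair_fixes_unique[OF a(1)] by blast
qed

end

section \<open>Loop braid groups acting on trees\<close>

text \<open>Finite index of \<open>K\<close> enters through the uniform exponent \<open>r\<close>,
  and the presence of at least three generators through \<open>third\<close>.\<close>

locale symmetric_tree_action =
  free_automorphisms X + NF_tree_action G V d act C
  for X :: "'x set" and G :: "('a, 'm) monoid_scheme" (structure) and V :: "'v set" and d act C +
  fixes K :: "('x gword set \<Rightarrow> 'x gword set) set" and \<psi> :: "('x gword set \<Rightarrow> 'x gword set) \<Rightarrow> 'a"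
    and r :: nat
  assumes X_nonempty: "X \<noteq> {}"
    and third: "i \<in> X \<Longrightarrow> j \<in> X \<Longrightarrow> \<exists>k\<in>X. k \<noteq> i \<and> k \<noteq> j"
    and K: "subgroup K Aut" "K \<subseteq> symmetric"
    and \<psi>: "\<psi> \<in> hom (Aut\<lparr>carrier := K\<rparr>) G" "inj_on \<psi> K"
    and r_pos: "r > 0"
    and power_in_K: "\<alpha> \<in> symmetric_units \<Longrightarrow> \<alpha> [^]\<^bsub>Aut\<^esub> r \<in> K"
begin

text \<open>The exponent is even so that the powers have even displacement.\<close>

definition pow_image :: "('x gword set \<Rightarrow> 'x gword set) \<Rightarrow> 'a"
  where "pow_image \<alpha> = \<psi> (\<alpha> [^]\<^bsub>Aut\<^esub> (2 * r))"

lemma \<psi>_mult: "\<alpha> \<in> K \<Longrightarrow> \<beta> \<in> K \<Longrightarrow> \<psi> (\<alpha> \<otimes>\<^bsub>Aut\<^esub> \<beta>) = \<psi> \<alpha> \<otimes> \<psi> \<beta>"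
  using \<psi>(1) by (simp add: hom_def)

lemma \<psi>_closed: "\<alpha> \<in> K \<Longrightarrow> \<psi> \<alpha> \<in> carrier G"
  using \<psi>(1) by (auto simp: hom_def)

lemma \<psi>_inv: "\<alpha> \<in> K \<Longrightarrow> \<psi> (inv\<^bsub>Aut\<^esub> \<alpha>) = inv (\<psi> \<alpha>)"
  using group_hom.hom_inv[of "Aut\<lparr>carrier := K\<rparr>" G \<psi> \<alpha>] \<psi>(1) is_group
    Aut.subgroup_imp_group[OF K(1)] Aut.m_inv_consistent[OF K(1)]
  by (simp add: group_hom_def group_hom_axioms_def)

lemma unit_carrier: "\<alpha> \<in> symmetric_units \<Longrightarrow> \<alpha> \<in> carrier Aut"
  using subgroup.subset[OF symmetric_units_subgroup] by blast

lemma power_split: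
  assumes "\<alpha> \<in> symmetric_units"
  shows "\<alpha> [^]\<^bsub>Aut\<^esub> (2 * r) = \<alpha> [^]\<^bsub>Aut\<^esub> r \<otimes>\<^bsub>Aut\<^esub> \<alpha> [^]\<^bsub>Aut\<^esub> r"
  using unit_carrier[OF assms] by (simp add: Aut.nat_pow_mult mult_2)

lemma power2_in_K: "\<alpha> \<in> symmetric_units \<Longrightarrow> \<alpha> [^]\<^bsub>Aut\<^esub> (2 * r) \<in> K"
  unfolding power_split by (intro subgroup.m_closed[OF K(1)] power_in_K)

lemma pow_image_closed: "\<alpha> \<in> symmetric_units \<Longrightarrow> pow_image \<alpha> \<in> carrier G"
  unfolding pow_image_def by (intro \<psi>_closed power2_in_K)

lemma pow_image_even: "\<alpha> \<in> symmetric_units \<Longrightarrow> even_displacement (pow_image \<alpha>)"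
  unfolding pow_image_def power_split
  using even_displacement_square[OF \<psi>_closed[OF power_in_K]] \<psi>_mult[OF power_in_K power_in_K] by simp

lemma pow_image_commute:
  assumes "\<alpha> \<in> symmetric_units" "\<beta> \<in> symmetric_units" "\<alpha> \<otimes>\<^bsub>Aut\<^esub> \<beta> = \<beta> \<otimes>\<^bsub>Aut\<^esub> \<alpha>"
  shows "pow_image \<alpha> \<otimes> pow_image \<beta> = pow_image \<beta> \<otimes> pow_image \<alpha>"
proof -
  note c = unit_carrier[OF assms(1)] unit_carrier[OF assms(2)]
  have "\<alpha> [^]\<^bsub>Aut\<^esub> (2 * r) \<otimes>\<^bsub>Aut\<^esub> \<beta> = \<beta> \<otimes>\<^bsub>Aut\<^esub> \<alpha> [^]\<^bsub>Aut\<^esub> (2 * r)"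
    by (rule Aut.group_commutes_pow[OF assms(3) c])
  from Aut.group_commutes_pow[OF this[symmetric] c(2) Aut.nat_pow_closed[OF c(1)], of "2 * r"]
  show ?thesis
    unfolding pow_image_def using \<psi>_mult[OF power2_in_K power2_in_K] assms by metis
qed

lemma pow_image_free:
  assumes "free_family Aut (pair \<alpha> \<beta>)" "\<alpha> \<in> symmetric_units" "\<beta> \<in> symmetric_units"
  shows "free_family G (pair (pow_image \<alpha>) (pow_image \<beta>))"
proof -
  let ?f = "\<lambda>b. pair \<alpha> \<beta> b [^]\<^bsub>Aut\<^esub> (2 * r)"
  have "free_family Aut ?f" using assms(1) r_pos by (intro Aut.free_family_pow) auto
  moreover have "range ?f \<subseteq> K" using power2_in_K assms(2,3) by (auto simp: pair_def)
  ultimately have "free_family (Aut\<lparr>carrier := K\<rparr>) ?f"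
    using free_family_carrier_update[OF Aut.is_group K(1)] by blast
  then have "free_family G (\<lambda>b. \<psi> (?f b))"
    using group.free_family_hom[OF Aut.subgroup_imp_group[OF K(1)] is_group \<psi>(1)] \<psi>(2) by simp
  moreover have "(\<lambda>b. \<psi> (?f b)) = pair (pow_image \<alpha>) (pow_image \<beta>)"
    by (auto simp: pair_def pow_image_def)
  ultimately show ?thesis by simp
qed

definition inn_image :: "('x gword set \<Rightarrow> 'x gword set) \<Rightarrow> 'x \<Rightarrow> 'a"
  where "inn_image \<beta> i = pow_image (inn (\<beta> (gen i)))"

lemma inn_unit': "\<beta> \<in> carrier Aut \<Longrightarrow> i \<in> X \<Longrightarrow> inn (\<beta> (gen i)) \<in> symmetric_units"
  by (simp add: inn_unit)

lemma inn_image_closed: "\<beta> \<in> carrier Aut \<Longrightarrow> i \<in> X \<Longrightarrow> inn_image \<beta> i \<in> carrier G"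
  unfolding inn_image_def by (intro pow_image_closed inn_unit')

text \<open>The commuting partner comes from \<open>?\<theta> i\<close> and
  \<open>?\<theta> j\<close>, which conjugate the member x_k of the basis moved by
  \<open>\<beta>\<close>. Conjugation by \<open>\<beta>\<close> is carried out in \<open>Aut\<close>
  before powers are taken, since \<open>\<beta>\<close> may lie outside \<open>K\<close>, where
  \<open>\<psi>\<close> is not controlled.\<close>

lemma inn_image_fixed_point:
  assumes \<beta>: "\<beta> \<in> symmetric_units" and ij: "i \<in> X" "j \<in> X" "i \<noteq> j"
  shows "\<exists>!v. v \<in> V \<and> act (inn_image \<beta> i) v = v \<and> act (inn_image \<beta> j) v = v"
proof -
  obtain k where k: "k \<in> X" "k \<noteq> i" "k \<noteq> j" using third ij by blast
  note \<beta>c = unit_carrier[OF \<beta>]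
  let ?c = "\<lambda>\<alpha>. \<beta> \<otimes>\<^bsub>Aut\<^esub> \<alpha> \<otimes>\<^bsub>Aut\<^esub> inv\<^bsub>Aut\<^esub> \<beta>"
  let ?\<theta> = "\<lambda>i. ?c (conj_gen k (gen i))"
  have unit: "?c \<alpha> \<in> symmetric_units" if "\<alpha> \<in> symmetric_units" for \<alpha>
    using \<beta> that subgroup.m_closed[OF symmetric_units_subgroup] subgroup.m_inv_closed[OF symmetric_units_subgroup]
    by blast
  have w: "gen i \<in> without k" "gen j \<in> without k" using gen_without ij k by auto
  have conj_free: "free_family Aut (pair (?c \<alpha>) (?c \<alpha>'))" if "free_family Aut (pair \<alpha> \<alpha>')" for \<alpha> \<alpha>'
    using Aut.free_family_conj[OF that \<beta>c] by (simp add: pair_apply[of ?c])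
  have "free_family Aut (pair (inn (\<beta> (gen i))) (inn (\<beta> (gen j))))"
    using conj_free[OF free_family_inn[of i j k]] ij k conj_inn[OF \<beta>c] by simp
  then have 1: "free_family G (pair (inn_image \<beta> i) (inn_image \<beta> j))"
    unfolding inn_image_def by (rule pow_image_free) (use inn_unit'[OF \<beta>c] ij in auto)
  have \<theta>: "?\<theta> i \<in> symmetric_units" "?\<theta> j \<in> symmetric_units"
    using unit conj_gen_unit w by auto
  have "free_family Aut (pair (?\<theta> i) (?\<theta> j))"
    using conj_free[OF free_family_conj_gen[of i j k]] ij k by simp
  then have 2: "free_family G (pair (pow_image (?\<theta> i)) (pow_image (?\<theta> j)))"
    using \<theta> by (rule pow_image_free)
  have comm: "inn_image \<beta> s \<otimes> pow_image (?\<theta> t) = pow_image (?\<theta> t) \<otimes> inn_image \<beta> s"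
    if st: "s \<in> {i, j}" "t \<in> {i, j}" for s t
  proof -
    have s: "s \<in> X" "gen s \<in> without k" "gen t \<in> without k" "gen s \<in> carrier F" using st ij w by auto
    have cc: "?c \<alpha> \<otimes>\<^bsub>Aut\<^esub> ?c \<alpha>' = ?c (\<alpha> \<otimes>\<^bsub>Aut\<^esub> \<alpha>')" if "\<alpha> \<in> carrier Aut" "\<alpha>' \<in> carrier Aut" for \<alpha> \<alpha>'
    proof -
      have "inv\<^bsub>Aut\<^esub> \<beta> \<otimes>\<^bsub>Aut\<^esub> (\<beta> \<otimes>\<^bsub>Aut\<^esub> \<gamma>) = \<gamma>" if "\<gamma> \<in> carrier Aut" for \<gamma>
        using \<beta>c that by (simp add: Aut.m_assoc[symmetric])
      then show ?thesis using \<beta>c that by (simp add: Aut.m_assoc)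
    qed
    have "?c (inn (gen s)) \<otimes>\<^bsub>Aut\<^esub> ?\<theta> t = ?\<theta> t \<otimes>\<^bsub>Aut\<^esub> ?c (inn (gen s))"
      using s conj_gen_inn_commute[OF s(3,2)] by (simp add: cc)
    then have "inn (\<beta> (gen s)) \<otimes>\<^bsub>Aut\<^esub> ?\<theta> t = ?\<theta> t \<otimes>\<^bsub>Aut\<^esub> inn (\<beta> (gen s))"
      unfolding conj_inn[OF \<beta>c s(4)] .
    then show ?thesis
      unfolding inn_image_def using inn_unit'[OF \<beta>c s(1)] \<theta> st(2) by (intro pow_image_commute) auto
  qed
  have ev: "even_displacement (inn_image \<beta> i)" "even_displacement (inn_image \<beta> j)"
    unfolding inn_image_def using pow_image_even inn_unit'[OF \<beta>c] ij by auto
  have "s \<otimes> t = t \<otimes> s" if "s \<in> {inn_image \<beta> i, inn_image \<beta> j}"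
    "t \<in> {pow_image (?\<theta> i), pow_image (?\<theta> j)}" for s t
    using comm that by auto
  from commuting_free_pairs[OF 1 ev 2 this] show ?thesis by blast
qed

section \<open>The vertex belonging to a basis\<close>

definition fixes_point :: "('x gword set \<Rightarrow> 'x gword set) \<Rightarrow> 'v \<Rightarrow> bool"
  where "fixes_point \<beta> v \<longleftrightarrow> v \<in> V \<and> (\<forall>i\<in>X. act (inn_image \<beta> i) v = v)"

text \<open>The vertex \<open>v\<close> of one pair serves every further generator: by the Helly
  property all three powers fix some vertex \<open>m\<close>, and \<open>m\<close> is
  \<open>v\<close> because the first pair fixes only one vertex.\<close>

lemma fixes_point_exists:
  assumes \<beta>: "\<beta> \<in> symmetric_units" shows "\<exists>v. fixes_point \<beta> v"
proof -
  obtain i where i: "i \<in> X" using X_nonempty by blast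
  obtain j where j: "j \<in> X" "j \<noteq> i" using third i by blast
  note u = inn_image_fixed_point[OF \<beta>]
  note c = inn_image_closed[OF unit_carrier[OF \<beta>]]
  obtain v where v: "v \<in> V" "act (inn_image \<beta> i) v = v" "act (inn_image \<beta> j) v = v"
    using u[OF i j(1)] j(2) by blast
  have "act (inn_image \<beta> k) v = v" if k: "k \<in> X" for k
  proof (cases "k = i \<or> k = j")
    case False
    obtain p where p: "p \<in> V" "act (inn_image \<beta> i) p = p" "act (inn_image \<beta> k) p = p"
      using u[OF i k] False by blast
    obtain q where q: "q \<in> V" "act (inn_image \<beta> j) q = q" "act (inn_image \<beta> k) q = q"
      using u[OF j(1) k] False by blast
    obtain m where m: "m \<in> V" "act (inn_image \<beta> i) m = m" "act (inn_image \<beta> j) m = m" "act (inn_image \<beta> k) m = m"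
      by (rule helly[OF c[OF i] c[OF j(1)] c[OF k] v(1,2,3) q p]) blast
    then have "m = v" using u[OF i j(1)] j(2) v by blast
    then show ?thesis using m by simp
  qed (use v in auto)
  then show ?thesis using v(1) unfolding fixes_point_def by blast
qed

lemma fixes_point_unique:
  assumes "\<beta> \<in> symmetric_units" "fixes_point \<beta> v" "fixes_point \<beta>' v'"
    "i \<in> X" "j \<in> X" "i \<noteq> j" "\<beta> (gen i) = \<beta>' (gen i)" "\<beta> (gen j) = \<beta>' (gen j)"
  shows "v = v'"
proof -
  have "inn_image \<beta> i = inn_image \<beta>' i" "inn_image \<beta> j = inn_image \<beta>' j"
    unfolding inn_image_def using assms(7,8) by simp_all
  then show ?thesis
    using inn_image_fixed_point[OF assms(1,4,5,6)] assms(2-5) unfolding fixes_point_def by metis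
qed

text \<open>The basis \<open>\<beta>(x)\<close> and its conjugate by \<open>\<beta>(x\<^sub>i)\<close> both have two members in common with the
  basis obtained from the former by conjugating the single member \<open>\<beta>(x\<^sub>k)\<close>.\<close>

lemma fixes_point_inn_gen:
  assumes \<beta>: "\<beta> \<in> symmetric_units" and v: "fixes_point \<beta> v" and i: "i \<in> X"
  shows "fixes_point (\<beta> \<otimes>\<^bsub>Aut\<^esub> inn (gen i)) v"
proof -
  obtain j where j: "j \<in> X" "j \<noteq> i" using third i by blast
  obtain k where k: "k \<in> X" "k \<noteq> i" "k \<noteq> j" using third i j by blast
  note \<beta>c = unit_carrier[OF \<beta>]
  let ?U = "inv\<^bsub>F\<^esub> (gen i)"
  have U: "?U \<in> without k"
    by (rule subgroup.m_inv_closed[OF without_subgroup gen_without[OF i k(2)[symmetric]]])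
  let ?\<alpha> = "\<beta> \<otimes>\<^bsub>Aut\<^esub> conj_gen k ?U" and ?\<gamma> = "\<beta> \<otimes>\<^bsub>Aut\<^esub> inn (gen i)"
  have unit: "?\<alpha> \<in> symmetric_units" "?\<gamma> \<in> symmetric_units"
    using \<beta> conj_gen_unit[OF U] inn_unit[OF gen_closed[OF i]] subgroup.m_closed[OF symmetric_units_subgroup]
    by auto
  obtain v' where v': "fixes_point ?\<alpha> v'" using fixes_point_exists[OF unit(1)] by blast
  obtain v'' where v'': "fixes_point ?\<gamma> v''" using fixes_point_exists[OF unit(2)] by blast
  have \<alpha>: "?\<alpha> (gen l) = \<beta> (gen l)" if "l \<in> X" "l \<noteq> k" for l
    using that conj_gen_gen[OF U that(1)] \<beta>c U by (simp add: Aut_mult_apply)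
  have "v = v'"
    by (rule fixes_point_unique[OF \<beta> v v' i j(1)]) (use \<alpha> i j k in auto)
  moreover have "?\<alpha> (gen k) = ?\<gamma> (gen k)" "?\<alpha> (gen i) = ?\<gamma> (gen i)"
    using \<alpha>[OF i] conj_gen_gen[OF U k(1)] \<beta>c U i k by (simp_all add: Aut_mult_apply inn_apply F.m_assoc)
  then have "v' = v''"
    by (intro fixes_point_unique[OF unit(1) v' v'' i k(1)]) (use k in auto)
  ultimately show ?thesis using v'' by simp
qed

text \<open>Conjugating the basis of \<open>?\<gamma>\<close> by the generator leads back to
  \<open>\<beta>\<close>. So the vertex of \<open>?\<gamma>\<close> also belongs to
  \<open>\<beta>\<close>, which has only one.\<close>

lemma fixes_point_inn_inv_gen:
  assumes \<beta>: "\<beta> \<in> symmetric_units" and v: "fixes_point \<beta> v" and i: "i \<in> X"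
  shows "fixes_point (\<beta> \<otimes>\<^bsub>Aut\<^esub> inn (inv\<^bsub>F\<^esub> (gen i))) v"
proof -
  let ?\<gamma> = "\<beta> \<otimes>\<^bsub>Aut\<^esub> inn (inv\<^bsub>F\<^esub> (gen i))"
  note \<beta>c = unit_carrier[OF \<beta>]
  have \<gamma>: "?\<gamma> \<in> symmetric_units"
    using \<beta> inn_unit[OF F.inv_closed[OF gen_closed[OF i]]] subgroup.m_closed[OF symmetric_units_subgroup] by blast
  obtain v' where v': "fixes_point ?\<gamma> v'" using fixes_point_exists[OF \<gamma>] by blast
  have "?\<gamma> \<otimes>\<^bsub>Aut\<^esub> inn (gen i) = \<beta>"
    using \<beta>c i by (simp add: inn_inv Aut.m_assoc)
  then have "fixes_point \<beta> v'" using fixes_point_inn_gen[OF \<gamma> v' i] by simp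
  moreover obtain j where "j \<in> X" "j \<noteq> i" using third i by blast
  ultimately have "v = v'" using fixes_point_unique[OF \<beta> v _ i] by metis
  then show ?thesis using v' by simp
qed

lemma K_fixes_point:
  obtains v where "v \<in> V" "\<And>\<alpha>. \<alpha> \<in> K \<Longrightarrow> act (\<psi> \<alpha>) v = v"
proof -
  let ?id = "inn \<one>\<^bsub>F\<^esub>"
  have id: "?id \<in> symmetric_units" by (simp add: inn_unit)
  have id_gen: "?id (gen i) = gen i" if "i \<in> X" for i using that by (simp add: inn_apply)
  obtain v where v: "fixes_point ?id v" using fixes_point_exists[OF id] by blast
  \<comment> \<open>Multiplying \<open>\<beta>\<close> on the right by \<open>inn\<close> of a
    letter conjugates its basis by the image of that letter, so words are built up at their right
    end.\<close>
  have inn_v: "fixes_point (inn (cls w)) v" if "w \<in> gwords X" for w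
    using that
  proof (induction w rule: rev_induct)
    case Nil
    then show ?case using v by (simp add: presented_group_one)
  next
    case (snoc l w)
    then have w: "w \<in> gwords X" "fixes_point (inn (cls w)) v" "snd l \<in> X" by auto
    have u: "inn (cls w) \<in> symmetric_units" using w(1) by (simp add: inn_unit)
    have "cls (w @ [l]) = cls w \<otimes>\<^bsub>F\<^esub> (if fst l then gen (snd l) else inv\<^bsub>F\<^esub> (gen (snd l)))"
      using w(1,3) by (cases l) (auto simp: presented_group_mult pres_gen_def pclass_inv inv_word_def)
    then have "inn (cls (w @ [l])) =
        inn (cls w) \<otimes>\<^bsub>Aut\<^esub> inn (if fst l then gen (snd l) else inv\<^bsub>F\<^esub> (gen (snd l)))"
      using w(1,3) by (simp add: inn_mult)
    then show ?case
      using fixes_point_inn_gen[OF u w(2,3)] fixes_point_inn_inv_gen[OF u w(2,3)] by (cases "fst l") simp_all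
  qed
  have inn_v': "fixes_point (inn h) v" if "h \<in> carrier F" for h
    using that inn_v presented_group_carrier[of h X "{}"] by blast
  have vV: "v \<in> V" using v unfolding fixes_point_def by blast
  have "act (\<psi> \<alpha>) v = v" if \<alpha>: "\<alpha> \<in> K" for \<alpha>
  proof -
    have \<alpha>c: "\<alpha> \<in> carrier Aut" using subgroup.subset[OF K(1)] \<alpha> by blast
    \<comment> \<open>The same element is computed twice: by equivariance it is a conjugate by
      \<open>\<psi> \<alpha>\<close> of a power for the standard basis; since
      \<open>\<alpha>\<close> is symmetric it is, up to inversion, a power for a conjugate of that
      basis, and so fixes \<open>v\<close>.\<close>
    have img: "inn_image \<alpha> i = \<psi> \<alpha> \<otimes> inn_image ?id i \<otimes> inv (\<psi> \<alpha>)"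
      and fixed: "act (inn_image \<alpha> i) v = v" if i: "i \<in> X" for i
    proof -
      let ?p = "inn (gen i) [^]\<^bsub>Aut\<^esub> (2 * r)"
      have p: "?p \<in> K" using power2_in_K inn_unit i by simp
      have inv: "inv\<^bsub>Aut\<^esub> \<alpha> \<in> K" using subgroup.m_inv_closed[OF K(1) \<alpha>] .
      interpret \<alpha>: group_hom F F \<alpha> using aut_group_hom[OF \<alpha>c] .
      have "inn (\<alpha> (gen i)) [^]\<^bsub>Aut\<^esub> (2 * r) = inn (\<alpha> (gen i [^]\<^bsub>F\<^esub> (2 * r)))"
        using i \<alpha>c by (simp add: inn_pow \<alpha>.hom_nat_pow)
      also have "\<dots> = \<alpha> \<otimes>\<^bsub>Aut\<^esub> ?p \<otimes>\<^bsub>Aut\<^esub> inv\<^bsub>Aut\<^esub> \<alpha>"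
        using i \<alpha>c by (simp add: conj_inn inn_pow[symmetric])
      finally show "inn_image \<alpha> i = \<psi> \<alpha> \<otimes> inn_image ?id i \<otimes> inv (\<psi> \<alpha>)"
        unfolding inn_image_def pow_image_def id_gen[OF i]
        using \<psi>_mult \<psi>_inv[OF \<alpha>] \<alpha> p inv subgroup.m_closed[OF K(1)] by simp
      have "\<alpha> \<in> symmetric" using K(2) \<alpha> by blast
      from symmetricE[OF this i] obtain j g e where j: "j \<in> X" "g \<in> carrier F"
        "e = gen j \<or> e = inv\<^bsub>F\<^esub> (gen j)" "\<alpha> (gen i) = g \<otimes>\<^bsub>F\<^esub> e \<otimes>\<^bsub>F\<^esub> inv\<^bsub>F\<^esub> g" .
      have jv: "act (inn_image (inn g) j) v = v"
        using inn_v'[OF j(2)] j(1) unfolding fixes_point_def by blast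
      have jc: "inn_image (inn g) j \<in> carrier G" using inn_image_closed j(1,2) by simp
      have gj: "inn g (gen j) \<in> carrier F" using j(1,2) by simp
      show "act (inn_image \<alpha> i) v = v"
      proof (cases "e = gen j")
        case True
        then have "\<alpha> (gen i) = inn g (gen j)" using j by (simp add: inn_apply)
        then show ?thesis using jv unfolding inn_image_def by simp
      next
        case False
        then have eq: "\<alpha> (gen i) = inv\<^bsub>F\<^esub> (inn g (gen j))"
          using j by (simp add: inn_apply F.inv_mult_group F.m_assoc)
        let ?q = "inn (inn g (gen j))"
        have q: "?q \<in> symmetric_units" "?q \<in> carrier Aut" using gj by (simp_all add: inn_unit)
        have "inn (\<alpha> (gen i)) [^]\<^bsub>Aut\<^esub> (2 * r) = inv\<^bsub>Aut\<^esub> (?q [^]\<^bsub>Aut\<^esub> (2 * r))"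
          unfolding eq inn_inv[OF gj] using q(2) by (simp add: Aut.nat_pow_inv)
        then have "inn_image \<alpha> i = inv (inn_image (inn g) j)"
          unfolding inn_image_def pow_image_def using \<psi>_inv[OF power2_in_K[OF q(1)]] by simp
        then show ?thesis using act_inv_fixed[OF jc vV jv] by simp
      qed
    qed
    let ?v' = "act (inv (\<psi> \<alpha>)) v"
    note \<psi>c = \<psi>_closed[OF \<alpha>]
    \<comment> \<open>The powers for the standard basis thus fix \<open>v\<close> and its image
      under the inverse of \<open>\<psi> \<alpha>\<close>; both coincide because the vertex of a
      basis is unique.\<close>
    have "fixes_point ?id ?v'"
      unfolding fixes_point_def
    proof (intro conjI ballI)
      show "?v' \<in> V" using act_closed \<psi>c vV by simp
      fix i assume i: "i \<in> X"
      have c: "inn_image ?id i \<in> carrier G" using inn_image_closed i by simp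
      have "act (\<psi> \<alpha>) (act (inn_image ?id i) ?v') = v"
        using fixed[OF i] c \<psi>c vV act_closed unfolding img[OF i] by (simp add: act_mult)
      then show "act (inn_image ?id i) ?v' = ?v'"
        using act_inv_act[OF \<psi>c] c \<psi>c vV act_closed by (metis inv_closed)
    qed
    moreover obtain i where i: "i \<in> X" using X_nonempty by blast
    moreover obtain j where "j \<in> X" "j \<noteq> i" using third i by blast
    ultimately have "v = ?v'" using fixes_point_unique[OF id v] by metis
    then show ?thesis using act_act_inv[OF \<psi>c vV] by simp
  qed
  then show thesis using that vV by blast
qed

end

text \<open>Here \<open>K\<close> is a subgroup relative to the bare carrier
  \<open>symmetric\<close>, whose inverse operation is not known to agree with that of
  \<open>Aut\<close>. The inverse in \<open>Aut\<close> of a member of \<open>K\<close> is obtained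
  by pulling back an inverse from \<open>H\<close> along \<open>\<psi>\<close>.\<close>

lemma (in free_automorphisms) commensurating_subgroup:
  assumes G: "group G" "subgroup H G"
    and K: "subgroup K (Aut\<lparr>carrier := symmetric\<rparr>)"
    and \<psi>: "\<psi> \<in> iso (Aut\<lparr>carrier := K\<rparr>) (G\<lparr>carrier := H\<rparr>)"
  shows "subgroup K Aut" "\<psi> \<in> hom (Aut\<lparr>carrier := K\<rparr>) G" "inj_on \<psi> K" "\<psi> ` K = H"
proof -
  interpret G: group G by fact
  have KS: "K \<subseteq> carrier Aut" using subgroup.subset[OF K] symmetric_subset by auto
  have one: "\<one>\<^bsub>Aut\<^esub> \<in> K" using subgroup.one_closed[OF K] by simp
  have mult: "\<alpha> \<otimes>\<^bsub>Aut\<^esub> \<beta> \<in> K" if "\<alpha> \<in> K" "\<beta> \<in> K" for \<alpha> \<beta>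
    using subgroup.m_closed[OF K] that by simp
  have H: "H \<subseteq> carrier G" using subgroup.subset[OF G(2)] .
  show inj: "inj_on \<psi> K" and im: "\<psi> ` K = H" using \<psi> by (auto simp: iso_def bij_betw_def)
  have hom: "\<psi> (\<alpha> \<otimes>\<^bsub>Aut\<^esub> \<beta>) = \<psi> \<alpha> \<otimes>\<^bsub>G\<^esub> \<psi> \<beta>" if "\<alpha> \<in> K" "\<beta> \<in> K" for \<alpha> \<beta>
    using \<psi> that by (simp add: iso_def hom_def)
  then show "\<psi> \<in> hom (Aut\<lparr>carrier := K\<rparr>) G" using im H by (intro homI) auto
  have "\<psi> \<one>\<^bsub>Aut\<^esub> \<in> carrier G" using one im H by blast
  then have \<psi>1: "\<psi> \<one>\<^bsub>Aut\<^esub> = \<one>\<^bsub>G\<^esub>" using hom[OF one one] by simp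
  show "subgroup K Aut"
  proof (rule Aut.subgroupI)
    show "K \<noteq> {}" using one by blast
    show "inv\<^bsub>Aut\<^esub> \<alpha> \<in> K" if \<alpha>: "\<alpha> \<in> K" for \<alpha>
    proof -
      have "inv\<^bsub>G\<^esub> (\<psi> \<alpha>) \<in> \<psi> ` K" using subgroup.m_inv_closed[OF G(2)] \<alpha> im by auto
      then obtain \<beta> where \<beta>: "\<beta> \<in> K" "\<psi> \<beta> = inv\<^bsub>G\<^esub> (\<psi> \<alpha>)" by force
      have "\<psi> \<alpha> \<in> carrier G" using \<alpha> im H by blast
      then have "\<psi> (\<beta> \<otimes>\<^bsub>Aut\<^esub> \<alpha>) = \<psi> \<one>\<^bsub>Aut\<^esub>" using hom[OF \<beta>(1) \<alpha>] \<beta>(2) \<psi>1 by simp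
      then have "\<beta> \<otimes>\<^bsub>Aut\<^esub> \<alpha> = \<one>\<^bsub>Aut\<^esub>" 
        by (rule inj_onD[OF inj _ mult[OF \<beta>(1) \<alpha>] one])
      then have "inv\<^bsub>Aut\<^esub> \<alpha> = \<beta>" by (rule Aut.inv_equality) (use \<alpha> \<beta>(1) KS in blast)+
      then show ?thesis using \<beta>(1) by simp
    qed
  qed (use KS mult in auto)
qed

lemma rcosets_eq_image: "rcosets\<^bsub>G\<^esub> H = (\<lambda>a. H #>\<^bsub>G\<^esub> a) ` carrier G"
  by (auto simp: RCOSETS_def)

theorem theorem5p2:
  fixes n :: nat and G :: "('a, 'm) monoid_scheme" and C :: "'a set"
  assumes "n \<ge> 3"
    and "group G"
    and "subgroup C G"
    and "NF (G\<lparr>carrier := C\<rparr>)"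
    and "splits_nontrivially_over G C"
  shows "\<not> commensurable (loop_braid_group n) G"
proof
  assume comm: "commensurable (loop_braid_group n) G"
  interpret G: group G by fact
  interpret free_automorphisms "{1..n}" .
  have L: "loop_braid_group n = Aut\<lparr>carrier := symmetric\<rparr>"
    unfolding loop_braid_group_def symmetric_automorphisms_def symmetric_def Let_def free_group_def Aut_carrier ..
  obtain K H \<psi> where K: "finite_index K (Aut\<lparr>carrier := symmetric\<rparr>)" and H: "finite_index H G"
    and \<psi>: "\<psi> \<in> iso (Aut\<lparr>carrier := K\<rparr>) (G\<lparr>carrier := H\<rparr>)"
    using comm unfolding commensurable_def L is_iso_def by auto
  have Hs: "subgroup H G" and Ks: "subgroup K (Aut\<lparr>carrier := symmetric\<rparr>)"
    using H K unfolding finite_index_def by auto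
  note KH = commensurating_subgroup[OF assms(2) Hs Ks \<psi>]
  obtain V :: "(bool \<times> 'a set) set" and d where tree: "tree_splitting G C V d (coset_act G)"
    using splitting_tree[OF assms(2,5)] .
  obtain g where g: "g \<in> carrier G" "\<And>k x. (k::nat) > 0 \<Longrightarrow> x \<in> V \<Longrightarrow> coset_act G (g [^]\<^bsub>G\<^esub> k) x \<noteq> x"
    using tree unfolding tree_splitting_def by blast
  define r :: nat where "r = fact (card ((\<lambda>\<alpha>. K #>\<^bsub>Aut\<^esub> \<alpha>) ` symmetric))"
  have fin: "finite ((\<lambda>\<alpha>. K #>\<^bsub>Aut\<^esub> \<alpha>) ` symmetric)"
    using K unfolding finite_index_def rcosets_eq_image by (simp add: r_coset_def)
  have pow: "\<alpha> [^]\<^bsub>Aut\<^esub> r \<in> K" if \<alpha>: "\<alpha> \<in> symmetric_units" for \<alpha>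
  proof -
    have "\<alpha> [^]\<^bsub>Aut\<^esub> i \<in> symmetric_units" for i :: nat
      by (induction i) (use \<alpha> subgroup.one_closed[OF symmetric_units_subgroup]
        subgroup.m_closed[OF symmetric_units_subgroup] in auto)
    then have "\<alpha> [^]\<^bsub>Aut\<^esub> i \<in> symmetric" for i :: nat unfolding symmetric_units_def by blast
    moreover have "\<alpha> \<in> carrier Aut" using subgroup.subset[OF symmetric_units_subgroup] \<alpha> by blast
    ultimately show ?thesis unfolding r_def using Aut.power_in_finite_index[OF KH(1) fin] by blast
  qed
  have "\<exists>k\<in>{1..n}. k \<noteq> i \<and> k \<noteq> j" for i j :: nat
  proof (rule ccontr)
    assume "\<not> (\<exists>k\<in>{1..n}. k \<noteq> i \<and> k \<noteq> j)"
    then have *: "k = i \<or> k = j" if "k \<in> {1..n}" for k using that by blast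
    show False using *[of 1] *[of 2] *[of 3] assms(1) by auto
  qed
  note third = this
  have T: "tree_action G V d (coset_act G)" "V \<noteq> {}"
    and stab: "\<forall>x\<in>V. \<forall>y\<in>V. d x y = 1 \<longrightarrow> (\<exists>g\<in>carrier G. \<forall>h\<in>carrier G.
      coset_act G h x = x \<longrightarrow> coset_act G h y = y \<longrightarrow> inv\<^bsub>G\<^esub> g \<otimes>\<^bsub>G\<^esub> h \<otimes>\<^bsub>G\<^esub> g \<in> C)"
    using tree unfolding tree_splitting_def by simp_all
  interpret NF_tree_action G V d "coset_act G" C
  proof (intro NF_tree_action.intro NF_tree_action_axioms.intro)
    show "tree_action G V d (coset_act G)" "V \<noteq> {}" by (rule T)+
    show "subgroup C G" "NF (G\<lparr>carrier := C\<rparr>)" by fact+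
    show "\<exists>g\<in>carrier G. \<forall>h\<in>carrier G. coset_act G h x = x \<longrightarrow> coset_act G h y = y \<longrightarrow>
        inv\<^bsub>G\<^esub> g \<otimes>\<^bsub>G\<^esub> h \<otimes>\<^bsub>G\<^esub> g \<in> C" if "x \<in> V" "y \<in> V" "d x y = 1" for x y
      using bspec[OF bspec[OF stab that(1)] that(2)] that(3) by (rule mp)
  qed
  interpret symmetric_tree_action "{1..n}" G V d "coset_act G" C K \<psi> r
  proof (intro symmetric_tree_action.intro symmetric_tree_action_axioms.intro)
    show "NF_tree_action G V d (coset_act G) C" by (rule NF_tree_action_axioms)
    show "{1..n} \<noteq> {}" using assms(1) by auto
    show "\<exists>k\<in>{1..n}. k \<noteq> i \<and> k \<noteq> j" for i j by (rule third)
    show "subgroup K Aut" "\<psi> \<in> hom (Aut\<lparr>carrier := K\<rparr>) G" "inj_on \<psi> K" using KH by blast+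
    show "K \<subseteq> symmetric" using subgroup.subset[OF Ks] by simp
    show "0 < r" unfolding r_def by simp
    show "\<alpha> [^]\<^bsub>Aut\<^esub> r \<in> K" if "\<alpha> \<in> symmetric_units" for \<alpha> using that by (rule pow)
  qed
  obtain v where v: "v \<in> V" "\<And>\<alpha>. \<alpha> \<in> K \<Longrightarrow> coset_act G (\<psi> \<alpha>) v = v" by (rule K_fixes_point) blast
  \<comment> \<open>Some positive power of the hyperbolic element \<open>g\<close> lies in
    \<open>H\<close>, the image of \<open>K\<close>, and would therefore fix
    \<open>v\<close>.\<close>
  have "finite ((\<lambda>a. H #>\<^bsub>G\<^esub> a) ` carrier G)" using H unfolding finite_index_def rcosets_eq_image by simp
  from G.power_in_finite_index[OF Hs this g(1) G.nat_pow_closed[OF g(1)]]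
  obtain k :: nat where k: "g [^]\<^bsub>G\<^esub> k \<in> H" "k > 0" using fact_gt_zero by blast
  have "g [^]\<^bsub>G\<^esub> k \<in> \<psi> ` K" using k(1) KH(4) by simp
  then obtain \<alpha> where "\<alpha> \<in> K" "g [^]\<^bsub>G\<^esub> k = \<psi> \<alpha>" by (elim imageE)
  then have "coset_act G (g [^]\<^bsub>G\<^esub> k) v = v" using v(2)[of \<alpha>] by simp
  then show False using g(2)[OF k(2) v(1)] by blast
qed

end
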